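(* Work in the classical case $\Bbbk=\mathbb{Z}$. Let $t$ be a seed and $t'=\boldsymbol\mu t$, and assume $t,t'$ are similar up to a permutation $\sigma$ of $I_{\mathrm{uf}}$. Let $\mathrm{var}^N_{t'}:N(t')\to N(t)$ be a linear map, let $\mathrm{var}^M_t:M^\circ(t)_{\mathbb Q}\to M^\circ(t')_{\mathbb Q}$ denote its pullback (dual map), and let $\mathrm{var}^X_{t'}$, $\mathrm{var}^A_t$ denote the associated monomial maps. Define $\mathrm{tw}^X_{t'}=(\boldsymbol\mu^{-1})^*\circ\mathrm{var}^X_{t'}$ and $\mathrm{tw}^A_t=\boldsymbol\mu^*\circ\mathrm{var}^A_t$. (1) $\mathrm{tw}^X_{t'}$ is a twist endomorphism on $\mathcal U^X(t')$ if and only if $\mathrm{tw}^A_t$ is a twist endomorphism on $\mathcal U^A(t)_{\mathcal Z^{\mathbb Q}}$. (2) If $\mathrm{tw}^X_{t'}$ is a twist automorphism, then $(\mathrm{tw}^X_{t'})^{-1}$ is also a twist automorphism (after identification by mutations); let $(\mathrm{tw}^X_t)^{-1}:=\boldsymbol\mu^*(\mathrm{tw}^X_{t'})^{-1}(\boldsymbol\mu^* )^{-1}$ denote the corresponding twist automorphism on $\mathcal U^X(t)$. Then $(\mathrm{tw}^X_t)^{-1}$ preserves the Poisson structure if and only if $p^*(\mathrm{tw}^X_t)^{-1}=\mathrm{tw}^A_t\,p^*$.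
   Context: Seeds. Fix a finite set $I=I_{\mathrm{uf}}\sqcup I_{\mathrm f}$ (unfrozen, frozen) and integers $d_i>0$. A seed $t$ consists of indeterminates $(A_i)_{i\in I}$, $(X_i)_{i\in I}$ and an integer matrix $B(t)=(b_{ij})_{i,j\in I}$ with $\frac1{d_i}b_{ij}=-\frac1{d_j}b_{ji}$. $N(t)=\mathbb{Z}^I$ has basis $\mathbf e_i$; $\mathbf e_i^*$ is the dual basis, $\mathbf f_i=\frac1{d_i}\mathbf e_i^*$, $M^\circ(t)=\bigoplus_i\mathbb{Z}\mathbf f_i$, $M^\circ_{\mathrm f}(t)=\bigoplus_{j\in I_{\mathrm f}}\mathbb{Z}\mathbf f_j$; thus $M^\circ(t)_{\mathbb Q}$ is the dual of $N(t)_{\mathbb Q}$ (subscript $\mathbb{Q}$ means $\otimes\mathbb{Q}$). $p^*:N(t)\to M^\circ(t)$, $p^*\mathbf e_j=\sum_ib_{ij}\mathbf f_i$. $\omega$ is the skew-symmetric form on $N(t)$ with $\omega(\mathbf e_i,\mathbf e_j)=\frac1{d_j}b_{ji}$. Objects of $t'$ carry a prime. Algebras. $\mathcal{LP}^A(t)=\mathbb{Z}[A_i^{\pm1}]$, $\mathcal{LP}^X(t)=\mathbb{Z}[X_i^{\pm1}]$ with monomials $A^m$ ($m\in M^\circ(t)$), $X^n$ ($n\in N(t)$) and fraction fields $\mathcal F^A(t),\mathcal F^X(t)$. Poisson bracket (over $\mathbb{Q}$): $\{X^n,X^{n'}\}=-\omega(n,n')X^{n+n'}$. For $k\in I_{\mathrm{uf}}$,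 $\mu_kt$ has matrix $b'_{ij}=-b_{ij}$ if $k\in\{i,j\}$, $b'_{ij}=b_{ij}+b_{ik}[b_{kj}]_++[-b_{ik}]_+b_{kj}$ otherwise, where $[x]_+=\max(x,0)$; mutation isomorphisms $\mu_k^*:\mathcal F^\bullet(\mu_kt)\to\mathcal F^\bullet(t)$: $A_i'\mapsto A_i$ ($i\neq k$), $A_k'\mapsto A_k^{-1}(\prod_jA_j^{[-b_{jk}]_+}+\prod_jA_j^{[b_{jk}]_+})$; $X_k'\mapsto X_k^{-1}$, $X_i'\mapsto X_iX_k^{[b_{ki}]_+}(1+X_k)^{-b_{ki}}$ ($i\ne k$). For $\boldsymbol\mu=\mu_{k_l}\cdots\mu_{k_1}$: $\boldsymbol\mu^*=\mu_{k_1}^*\cdots\mu_{k_l}^*$ and $(\boldsymbol\mu^{-1})^*=(\boldsymbol\mu^* )^{-1}$. $\mathcal U^\bullet(t)=\bigcap_{\boldsymbol\nu}\boldsymbol\nu^*\mathcal{LP}^\bullet(\boldsymbol\nu t)\subset\mathcal F^\bullet(t)$ over all mutation sequences. $\mathcal Z$ is the group generated by $A_j^{\pm1}$, $j\in I_{\mathrm f}$ (unchanged by mutation), $\mathcal Z^{\mathbb Q}$ the group generated by all $A_j^{\pm1/r}$, $r\in\mathbb{Z}_{>0}$, and $R_{\mathcal Z^{\mathbb Q}}=R\otimes_{\mathbb{Z}[\mathcal Z]}\mathbb{Z}[\mathcal Z^{\mathbb Q}]$. Similarity: $b_{ij}(t)=b_{\sigma i,\sigma j}(t')$ and $d_i=d_{\sigma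 i}$ for $i,j\in I_{\mathrm{uf}}$. Variation maps. A linear map $\mathrm{var}^M_t:M^\circ(t)_{\mathbb Q}\to M^\circ(t')_{\mathbb Q}$ is a variation map if for $k\in I_{\mathrm{uf}}$, $j\in I_{\mathrm f}$: $\mathrm{var}^M_t(\mathbf f_k)\in\mathbf f'_{\sigma k}+M^\circ_{\mathrm f}(t')_{\mathbb Q}$, $\mathrm{var}^M_t(\mathbf f_j)\in M^\circ_{\mathrm f}(t')_{\mathbb Q}$, $\mathrm{var}^M_t(p^*\mathbf e_k)=p^*\mathbf e'_{\sigma k}$. A linear map $\mathrm{var}^N_{t'}:N(t')_{\mathbb Q}\to N(t)_{\mathbb Q}$ is a variation map if $\mathrm{var}^N_{t'}(\mathbf e'_k)=\mathbf e_{\sigma^{-1}k}$ for $k\in I_{\mathrm{uf}}$ and $\omega(\mathrm{var}^N_{t'}\mathbf e'_i,\mathrm{var}^N_{t'}\mathbf e'_k)=\omega(\mathbf e'_i,\mathbf e'_k)$ for all $i\in I$, $k\in I_{\mathrm{uf}}$; it is Poisson if this holds for all $i,k\in I$. The associated monomial maps are $A^m\mapsto(A')^{\mathrm{var}^M_t(m)}$ and $(X')^n\mapsto X^{\mathrm{var}^N_{t'}(n)}$. Twists. $\mathrm{tw}^A_t$ (resp. $\mathrm{tw}^X_{t'}$) is called a twist endomorphism on $\mathcal U^A(t)_{\mathcal Z^{\mathbb Q}}$ (resp. on $\mathcal U^X(t')$) if the map $\mathrm{var}^M_t$ (resp. $\mathrm{var}^N_{t'}$) defining it is a variation map; it then maps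 that algebra to itself. It is a twist automorphism if moreover $\mathrm{var}^X_{t'}:\mathcal{LP}^X(t')\to\mathcal{LP}^X(t)$ (resp. $\mathrm{var}^A_t$ on $\mathcal{LP}^A(\cdot)_{\mathcal Z^{\mathbb Q}}$) is invertible. So $(\mathrm{tw}^X_t)^{-1}=\boldsymbol\mu^*\circ(\mathrm{var}^X_{t'})^{-1}$, a twist automorphism on $\mathcal U^X(t)$ with variation map $(\mathrm{var}^X_{t'})^{-1}:\mathcal{LP}^X(t)\to\mathcal{LP}^X(t')$. A twist preserves the Poisson structure when its variation map does. The map $p^*$ on algebras: $X^n\mapsto A^{p^*n}$, $\mathcal{LP}^X(t)\to\mathcal{LP}^A(t)$; it extends to fractions whose denominators are nonzero polynomials in the $X_i$ with nonnegative coefficients, it commutes with mutations, and it restricts to $\mathcal U^X(t)\to\mathcal U^A(t)$. The identity $p^*(\mathrm{tw}^X_t)^{-1}=\mathrm{tw}^A_tp^*$ is understood as an equality of the homomorphisms given by these formulas on the whole Laurent ring $\mathcal{LP}^X(t)$, i.e. after evaluation at all cluster $X$-variables $X_i(t)$. *)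

theory Defs
  imports
    Complex_Main
    "HOL-Library.Poly_Mapping"
    "HOL-Computational_Algebra.Fraction_Field"
    "HOL-Combinatorics.Permutations"
begin

text \<open>
  The index set \<open>I\<close> is a finite type \<open>'i\<close>; the unfrozen part is a set \<open>Iuf\<close>, the frozen part its
  complement. The sort \<open>linorder\<close> on \<open>'i\<close> is only there because the library instance
  ``Laurent polynomials form an integral domain'' needs an ordered exponent group; no definition
  refers to the order.
\<close>

subsection \<open>Seeds, lattices and matrix mutation\<close>

text \<open>
  A seed is represented by its exchange matrix; its indeterminates are the generators of its own
  copy of the Laurent polynomial rings below. The multipliers \<open>d\<close> are common to all seeds.
  \<open>N(t)\<close> is \<open>'i latN\<close> with basis \<open>e\<^sub>i\<close>; an element of \<open>M\<degree>(t) \<otimes> \<rat>\<close> is given by its coordinates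
  with respect to \<open>f\<^sub>i = e\<^sub>i\<^sup>* / d\<^sub>i\<close>.
\<close>

type_synonym 'i seed = "'i \<Rightarrow> 'i \<Rightarrow> int"
type_synonym 'i latN = "'i \<Rightarrow>\<^sub>0 int"
type_synonym 'i latM = "'i \<Rightarrow>\<^sub>0 rat"

definition is_seed :: "('i \<Rightarrow> int) \<Rightarrow> 'i seed \<Rightarrow> bool" where
  "is_seed d B \<longleftrightarrow>
     (\<forall>i j. 1 / of_int (d i) * of_int (B i j) = - (1 / of_int (d j) * of_int (B j i) :: rat))"

definition pos_part :: "int \<Rightarrow> int" where
  "pos_part x = max x 0"

definition mut :: "'i \<Rightarrow> 'i seed \<Rightarrow> 'i seed" where
  "mut k B = (\<lambda>i j. if i = k \<or> j = k then - B i j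
                    else B i j + B i k * pos_part (B k j) + pos_part (- B i k) * B k j)"

text \<open>The list \<open>[k\<^sub>1, \<dots>, k\<^sub>l]\<close> stands for the mutation sequence that mutates at \<open>k\<^sub>1\<close> first.\<close>

primrec mut_seq :: "'i list \<Rightarrow> 'i seed \<Rightarrow> 'i seed" where
  "mut_seq [] B = B"
| "mut_seq (k # ks) B = mut_seq ks (mut k B)"

definition basis_e :: "'i \<Rightarrow> 'i latN" where
  "basis_e i = Poly_Mapping.single i 1"

definition basis_f :: "'i \<Rightarrow> 'i latM" where
  "basis_f i = Poly_Mapping.single i 1"

definition frozen_M :: "'i set \<Rightarrow> 'i latM set" where
  "frozen_M Iuf = {m. \<forall>i\<in>Iuf. Poly_Mapping.lookup m i = 0}"

definition pstar :: "'i::finite seed \<Rightarrow> 'i latN \<Rightarrow> 'i latM" where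
  "pstar B n = (\<Sum>j\<in>UNIV. \<Sum>i\<in>UNIV.
     Poly_Mapping.single i (of_int (Poly_Mapping.lookup n j * B i j)))"

definition omega :: "('i \<Rightarrow> int) \<Rightarrow> 'i::finite seed \<Rightarrow> 'i latN \<Rightarrow> 'i latN \<Rightarrow> rat" where
  "omega d B n n' = (\<Sum>i\<in>UNIV. \<Sum>j\<in>UNIV.
     of_int (Poly_Mapping.lookup n i * Poly_Mapping.lookup n' j) * (1 / of_int (d j) * of_int (B j i)))"

text \<open>The evaluation pairing between \<open>M\<degree>(t) \<otimes> \<rat>\<close> and \<open>N(t)\<close>; note \<open>f\<^sub>i(e\<^sub>i) = 1 / d\<^sub>i\<close>.\<close>

definition pairing :: "('i \<Rightarrow> int) \<Rightarrow> 'i::finite latM \<Rightarrow> 'i latN \<Rightarrow> rat" where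
  "pairing d m n =
     (\<Sum>i\<in>UNIV. Poly_Mapping.lookup m i * of_int (Poly_Mapping.lookup n i) / of_int (d i))"

text \<open>The dual map \<open>m \<mapsto> m \<circ> V\<close>, written out in the basis \<open>f\<^sub>i\<close>: the \<open>f\<^sub>i\<close>-coordinate of a functional
  is \<open>d\<^sub>i\<close> times its value at \<open>e\<^sub>i\<close>.\<close>

definition pullback :: "('i \<Rightarrow> int) \<Rightarrow> ('i::finite latN \<Rightarrow> 'i latN) \<Rightarrow> 'i latM \<Rightarrow> 'i latM" where
  "pullback d V m =
     (\<Sum>i\<in>UNIV. Poly_Mapping.single i (of_int (d i) * pairing d m (V (basis_e i))))"

lemma pairing_pullback:
  assumes "additive V" and "\<And>i. d i > 0"
  shows "pairing d (pullback d V m) n = pairing d m (V n)"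
proof -
  have padd: "additive (pairing d m)"
    by standard (simp add: pairing_def lookup_add sum.distrib ring_distribs add_divide_distrib)
  define g where "g = (\<lambda>x. pairing d m (V x))"
  have g: "additive g"
    using assms(1) padd by (simp add: additive_def g_def)
  have g_single: "g (Poly_Mapping.single i c) = of_int c * g (basis_e i)" for i and c :: int
  proof (induction c rule: int_induct[where k = 0])
    case base
    then show ?case using additive.zero[OF g] by simp
  next
    case (step1 c)
    then show ?case
      using additive.add[OF g, of "Poly_Mapping.single i c" "basis_e i"]
      by (simp add: basis_e_def single_add[symmetric] algebra_simps)
  next
    case (step2 c)
    then show ?case
      using additive.diff[OF g, of "Poly_Mapping.single i c" "basis_e i"]
      by (simp add: basis_e_def single_diff[symmetric] algebra_simps)
  qed
  have n: "n = (\<Sum>i\<in>UNIV. Poly_Mapping.single i (Poly_Mapping.lookup n i))"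
    by (rule poly_mapping_eqI) (simp add: lookup_sum lookup_single when_def)
  have "g n = (\<Sum>i\<in>UNIV. of_int (Poly_Mapping.lookup n i) * g (basis_e i))"
    by (subst n, subst additive.sum[OF g]) (simp add: g_single)
  moreover have "Poly_Mapping.lookup (pullback d V m) i = of_int (d i) * g (basis_e i)" for i
    by (simp add: pullback_def lookup_sum lookup_single when_def g_def)
  moreover have "d i \<noteq> 0" for i
    using assms(2)[of i] by simp
  ultimately have "pairing d (pullback d V m) n = g n"
    by (simp add: pairing_def mult.commute)
  then show ?thesis
    by (simp add: g_def)
qed

subsection \<open>Similarity and variation maps\<close>

definition similar :: "'i set \<Rightarrow> ('i \<Rightarrow> int) \<Rightarrow> ('i \<Rightarrow> 'i) \<Rightarrow> 'i seed \<Rightarrow> 'i seed \<Rightarrow> bool" where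
  "similar Iuf d \<sigma> t t' \<longleftrightarrow>
     \<sigma> permutes Iuf \<and> (\<forall>i\<in>Iuf. \<forall>j\<in>Iuf. t i j = t' (\<sigma> i) (\<sigma> j)) \<and> (\<forall>i\<in>Iuf. d i = d (\<sigma> i))"

text \<open>Variation maps \<open>M\<degree>(t) \<otimes> \<rat> \<rightarrow> M\<degree>(t') \<otimes> \<rat>\<close>; between rational vector spaces, additive maps are
  linear.\<close>

definition variation_M ::
  "'i set \<Rightarrow> ('i \<Rightarrow> 'i) \<Rightarrow> 'i::finite seed \<Rightarrow> 'i seed \<Rightarrow> ('i latM \<Rightarrow> 'i latM) \<Rightarrow> bool" where
  "variation_M Iuf \<sigma> t t' W \<longleftrightarrow>
     additive W \<and>
     (\<forall>k\<in>Iuf. W (basis_f k) - basis_f (\<sigma> k) \<in> frozen_M Iuf) \<and>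
     (\<forall>j\<in>- Iuf. W (basis_f j) \<in> frozen_M Iuf) \<and>
     (\<forall>k\<in>Iuf. W (pstar t (basis_e k)) = pstar t' (basis_e (\<sigma> k)))"

text \<open>Variation maps \<open>N(t') \<rightarrow> N(t)\<close>; the conditions only concern basis vectors, so for a map of
  lattices they are the conditions on its extension to \<open>N(t') \<otimes> \<rat> \<rightarrow> N(t) \<otimes> \<rat>\<close>.\<close>

definition variation_N ::
  "'i set \<Rightarrow> ('i \<Rightarrow> int) \<Rightarrow> ('i \<Rightarrow> 'i) \<Rightarrow> 'i::finite seed \<Rightarrow> 'i seed \<Rightarrow> ('i latN \<Rightarrow> 'i latN) \<Rightarrow> bool" where
  "variation_N Iuf d \<sigma> t t' V \<longleftrightarrow>
     additive V \<and>
     (\<forall>k\<in>Iuf. V (basis_e k) = basis_e (inv \<sigma> k)) \<and>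
     (\<forall>i. \<forall>k\<in>Iuf. omega d t (V (basis_e i)) (V (basis_e k)) = omega d t' (basis_e i) (basis_e k))"

subsection \<open>Laurent polynomials and their fractions\<close>

text \<open>
  The type \<open>('a, 'c) laurent\<close> is the group ring of the exponent group \<open>'a\<close>.
  On the \<open>X\<close> side exponents lie in \<open>N(t) = \<int>\<^sup>I\<close>, so the type itself is the Laurent ring.
  On the \<open>A\<close> side exponents lie in \<open>M\<degree>(t) \<otimes> \<rat> = \<rat>\<^sup>I\<close>, which leaves room for the rational powers of the
  frozen variables; the Laurent rings proper are the subrings \<open>LP_A\<close>
  (integral exponents) and \<open>poly_A_ZQ Iuf\<close> (rational powers of frozen variables only). All
  objects on the \<open>A\<close> side are subsets of the one field \<open>'i fieldA\<close>.
\<close>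

type_synonym ('a, 'c) laurent = "'a \<Rightarrow>\<^sub>0 'c"
type_synonym 'i fieldX = "('i latN, int) laurent fract"
type_synonym 'i fieldA = "('i latM, int) laurent fract"

definition to_field :: "'a::idom \<Rightarrow> 'a fract" where
  "to_field p = Fraction_Field.Fract p 1"

definition monomial :: "'a \<Rightarrow> ('a, 'c::zero_neq_one) laurent" where
  "monomial m = Poly_Mapping.single m 1"

definition monomial_map ::
  "('a \<Rightarrow> 'b) \<Rightarrow> ('a, 'c::comm_monoid_add) laurent \<Rightarrow> ('b, 'c) laurent" where
  "monomial_map L p = (\<Sum>n\<in>Poly_Mapping.keys p. Poly_Mapping.single (L n) (Poly_Mapping.lookup p n))"

definition LP_X :: "'i::{finite,linorder} fieldX set" where
  "LP_X = range to_field"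

definition LP_A :: "'i::{finite,linorder} fieldA set" where
  "LP_A = to_field ` {p. \<forall>m\<in>Poly_Mapping.keys p. \<forall>i. Poly_Mapping.lookup m i \<in> \<int>}"

definition poly_A_ZQ :: "'i set \<Rightarrow> ('i latM, int) laurent set" where
  "poly_A_ZQ Iuf = {p. \<forall>m\<in>Poly_Mapping.keys p. \<forall>i\<in>Iuf. Poly_Mapping.lookup m i \<in> \<int>}"

text \<open>
  The extension of a ring homomorphism \<open>\<phi>\<close> from a ring \<open>R\<close> of Laurent polynomials into a field
  to those fractions over \<open>R\<close> that have a denominator not killed by \<open>\<phi>\<close>. The value does not depend
  on the representation. For injective \<open>\<phi>\<close> this is everything in the fraction field of \<open>R\<close>; for a
  monomial map it includes all fractions whose denominator is a nonzero polynomial with nonnegative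
  coefficients. Outside this domain the value is meaningless.
\<close>

definition frac_ext :: "'a::idom set \<Rightarrow> ('a \<Rightarrow> 'b::field) \<Rightarrow> 'a fract \<Rightarrow> 'b" where
  "frac_ext R \<phi> f =
     (THE g. \<exists>a\<in>R. \<exists>b\<in>R. b \<noteq> 0 \<and> \<phi> b \<noteq> 0 \<and> f = Fraction_Field.Fract a b \<and> g = \<phi> a / \<phi> b)"

definition varX :: "('i latN \<Rightarrow> 'i latN) \<Rightarrow> 'i::{finite,linorder} fieldX \<Rightarrow> 'i fieldX" where
  "varX V = frac_ext UNIV (\<lambda>p. to_field (monomial_map V p))"

definition varA :: "'i set \<Rightarrow> ('i latM \<Rightarrow> 'i latM) \<Rightarrow> 'i::{finite,linorder} fieldA \<Rightarrow> 'i fieldA" where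
  "varA Iuf W = frac_ext (poly_A_ZQ Iuf) (\<lambda>p. to_field (monomial_map W p))"

definition pstar_alg :: "'i::{finite,linorder} seed \<Rightarrow> 'i fieldX \<Rightarrow> 'i fieldA" where
  "pstar_alg t = frac_ext UNIV (\<lambda>p. to_field (monomial_map (pstar t) p))"

subsection \<open>Mutation isomorphisms\<close>

definition Xvar :: "'i \<Rightarrow> 'i::{finite,linorder} fieldX" where
  "Xvar i = to_field (monomial (basis_e i))"

definition Avar :: "'i \<Rightarrow> 'i::{finite,linorder} fieldA" where
  "Avar i = to_field (monomial (basis_f i))"

text \<open>The images of \<open>X\<^sub>i'\<close> and \<open>A\<^sub>i'\<close> under the mutation \<open>\<mu>\<^sub>k\<^sup>*\<close>; the matrix is that of the seed \<open>t\<close>, not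
  of \<open>\<mu>\<^sub>k t\<close>.\<close>

definition mut_X_gen :: "'i::{finite,linorder} seed \<Rightarrow> 'i \<Rightarrow> 'i \<Rightarrow> 'i fieldX" where
  "mut_X_gen t k i =
     (if i = k then inverse (Xvar k)
      else Xvar i * Xvar k powi pos_part (t k i) * (1 + Xvar k) powi (- t k i))"

definition mut_A_gen :: "'i::{finite,linorder} seed \<Rightarrow> 'i \<Rightarrow> 'i \<Rightarrow> 'i fieldA" where
  "mut_A_gen t k i =
     (if i = k then inverse (Avar k) *
        ((\<Prod>j\<in>UNIV. Avar j powi pos_part (- t j k)) + (\<Prod>j\<in>UNIV. Avar j powi pos_part (t j k)))
      else Avar i)"

definition subst_X ::
  "('i \<Rightarrow> 'i fieldX) \<Rightarrow> ('i::{finite,linorder} latN, int) laurent \<Rightarrow> 'i fieldX" where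
  "subst_X g p = (\<Sum>n\<in>Poly_Mapping.keys p.
     of_int (Poly_Mapping.lookup p n) * (\<Prod>i\<in>UNIV. g i powi Poly_Mapping.lookup n i))"

text \<open>Substitution for the unfrozen variables; the (rational powers of) frozen variables stay as they
  are. Only used on \<open>poly_A_ZQ Iuf\<close>, where the exponents of unfrozen variables are integers.\<close>

definition subst_A ::
  "'i set \<Rightarrow> ('i \<Rightarrow> 'i fieldA) \<Rightarrow> ('i::{finite,linorder} latM, int) laurent \<Rightarrow> 'i fieldA" where
  "subst_A Iuf g p = (\<Sum>m\<in>Poly_Mapping.keys p.
     of_int (Poly_Mapping.lookup p m) *
     (\<Prod>i\<in>Iuf. g i powi \<lfloor>Poly_Mapping.lookup m i\<rfloor>) *
     to_field (monomial (\<Sum>j\<in>- Iuf. Poly_Mapping.single j (Poly_Mapping.lookup m j))))"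

definition mut_X :: "'i::{finite,linorder} seed \<Rightarrow> 'i \<Rightarrow> 'i fieldX \<Rightarrow> 'i fieldX" where
  "mut_X t k = frac_ext UNIV (subst_X (mut_X_gen t k))"

definition mut_A :: "'i set \<Rightarrow> 'i::{finite,linorder} seed \<Rightarrow> 'i \<Rightarrow> 'i fieldA \<Rightarrow> 'i fieldA" where
  "mut_A Iuf t k = frac_ext (poly_A_ZQ Iuf) (subst_A Iuf (mut_A_gen t k))"

primrec mut_seq_X :: "'i list \<Rightarrow> 'i::{finite,linorder} seed \<Rightarrow> 'i fieldX \<Rightarrow> 'i fieldX" where
  "mut_seq_X [] t = id"
| "mut_seq_X (k # ks) t = mut_X t k \<circ> mut_seq_X ks (mut k t)"

primrec mut_seq_A :: "'i set \<Rightarrow> 'i list \<Rightarrow> 'i::{finite,linorder} seed \<Rightarrow> 'i fieldA \<Rightarrow> 'i fieldA" where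
  "mut_seq_A Iuf [] t = id"
| "mut_seq_A Iuf (k # ks) t = mut_A Iuf t k \<circ> mut_seq_A Iuf ks (mut k t)"

subsection \<open>Upper cluster algebras\<close>

definition upper_X :: "'i set \<Rightarrow> 'i::{finite,linorder} seed \<Rightarrow> 'i fieldX set" where
  "upper_X Iuf t = (\<Inter>ks\<in>lists Iuf. mut_seq_X ks t ` LP_X)"

definition upper_A :: "'i set \<Rightarrow> 'i::{finite,linorder} seed \<Rightarrow> 'i fieldA set" where
  "upper_A Iuf t = (\<Inter>ks\<in>lists Iuf. mut_seq_A Iuf ks t ` LP_A)"

text \<open>
  \<open>R \<otimes>\<^bsub>\<int>[Z]\<^esub> \<int>[Z\<^sup>\<rat>]\<close> for a subring \<open>R\<close> of the field of fractions of \<open>LP_A\<close> that contains the frozen Laurent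
  monomials. Since \<open>\<int>[Z\<^sup>\<rat>]\<close> is free over \<open>\<int>[Z]\<close>, multiplication identifies the tensor product with the
  set of \<open>R\<close>-linear combinations of elements of \<open>Z\<^sup>\<rat>\<close>, i.e. of monomials with exponent in
  \<open>frozen_M Iuf\<close>.
\<close>

definition extend_ZQ :: "'i set \<Rightarrow> 'i::{finite,linorder} fieldA set \<Rightarrow> 'i fieldA set" where
  "extend_ZQ Iuf R =
     {\<Sum>z\<in>Z. r z * to_field (monomial z) | Z r.
        finite Z \<and> Z \<subseteq> frozen_M Iuf \<and> (\<forall>z\<in>Z. r z \<in> R)}"

definition ring_endo_on :: "'a::comm_ring_1 set \<Rightarrow> ('a \<Rightarrow> 'a) \<Rightarrow> bool" where
  "ring_endo_on U \<phi> \<longleftrightarrow>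
     \<phi> ` U \<subseteq> U \<and> \<phi> 1 = 1 \<and>
     (\<forall>x\<in>U. \<forall>y\<in>U. \<phi> (x + y) = \<phi> x + \<phi> y \<and> \<phi> (x * y) = \<phi> x * \<phi> y)"

subsection \<open>Twists\<close>

text \<open>
  \<open>\<phi>\<close> is the twist endomorphism on \<open>\<U>\<^sup>X(t')\<close> with variation map \<open>V : N(t') \<rightarrow> N(t)\<close>, where
  \<open>\<iota> : F\<^sup>X(t) \<rightarrow> F\<^sup>X(t')\<close> is the identification by mutations. That \<open>\<phi>\<close> maps the algebra to itself is a
  consequence of \<open>V\<close> being a variation map; it is kept in the definition because it is what the
  word endomorphism asserts.
\<close>

definition twist_endo_X ::
  "'i set \<Rightarrow> ('i \<Rightarrow> int) \<Rightarrow> ('i \<Rightarrow> 'i) \<Rightarrow> 'i::{finite,linorder} seed \<Rightarrow> 'i seed \<Rightarrow>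
   ('i fieldX \<Rightarrow> 'i fieldX) \<Rightarrow> ('i latN \<Rightarrow> 'i latN) \<Rightarrow> ('i fieldX \<Rightarrow> 'i fieldX) \<Rightarrow> bool" where
  "twist_endo_X Iuf d \<sigma> t t' \<iota> V \<phi> \<longleftrightarrow>
     variation_N Iuf d \<sigma> t t' V \<and> \<phi> = \<iota> \<circ> varX V \<and> ring_endo_on (upper_X Iuf t') \<phi>"

definition twist_auto_X ::
  "'i set \<Rightarrow> ('i \<Rightarrow> int) \<Rightarrow> ('i \<Rightarrow> 'i) \<Rightarrow> 'i::{finite,linorder} seed \<Rightarrow> 'i seed \<Rightarrow>
   ('i fieldX \<Rightarrow> 'i fieldX) \<Rightarrow> ('i latN \<Rightarrow> 'i latN) \<Rightarrow> ('i fieldX \<Rightarrow> 'i fieldX) \<Rightarrow> bool" where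
  "twist_auto_X Iuf d \<sigma> t t' \<iota> V \<phi> \<longleftrightarrow>
     twist_endo_X Iuf d \<sigma> t t' \<iota> V \<phi> \<and> bij_betw (varX V) LP_X LP_X"

text \<open>The analogue on \<open>\<U>\<^sup>A(t)\<close> with rational frozen powers, for \<open>W : M\<degree>(t) \<otimes> \<rat> \<rightarrow> M\<degree>(t') \<otimes> \<rat>\<close> and the
  identification \<open>\<iota> : F\<^sup>A(t') \<rightarrow> F\<^sup>A(t)\<close>.\<close>

definition twist_endo_A ::
  "'i set \<Rightarrow> ('i \<Rightarrow> 'i) \<Rightarrow> 'i::{finite,linorder} seed \<Rightarrow> 'i seed \<Rightarrow>
   ('i fieldA \<Rightarrow> 'i fieldA) \<Rightarrow> ('i latM \<Rightarrow> 'i latM) \<Rightarrow> ('i fieldA \<Rightarrow> 'i fieldA) \<Rightarrow> bool" where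
  "twist_endo_A Iuf \<sigma> t t' \<iota> W \<phi> \<longleftrightarrow>
     variation_M Iuf \<sigma> t t' W \<and> \<phi> = \<iota> \<circ> varA Iuf W \<and>
     ring_endo_on (extend_ZQ Iuf (upper_A Iuf t)) \<phi>"

subsection \<open>Poisson structure\<close>

definition poisson ::
  "('i \<Rightarrow> int) \<Rightarrow> 'i::finite seed \<Rightarrow> ('i latN, rat) laurent \<Rightarrow> ('i latN, rat) laurent \<Rightarrow>
   ('i latN, rat) laurent" where
  "poisson d B f g = (\<Sum>n\<in>Poly_Mapping.keys f. \<Sum>n'\<in>Poly_Mapping.keys g.
     Poly_Mapping.single (n + n')
       (Poly_Mapping.lookup f n * Poly_Mapping.lookup g n' * (- omega d B n n')))"

text \<open>A twist preserves the Poisson structure if its variation map \<open>V : N(s) \<rightarrow> N(s')\<close> does.\<close>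

definition preserves_poisson ::
  "('i \<Rightarrow> int) \<Rightarrow> 'i::finite seed \<Rightarrow> 'i seed \<Rightarrow> ('i latN \<Rightarrow> 'i latN) \<Rightarrow> bool" where
  "preserves_poisson d s s' V \<longleftrightarrow>
     (\<forall>f g. monomial_map V (poisson d s f g) = poisson d s' (monomial_map V f) (monomial_map V g))"

end

theory Submission
  imports Defs
begin

text \<open>
  Every map in the statement extends a multiplicative character of an exponent group to fractions:
  a mutation is given by the character \<open>n \<mapsto> z\<^sup>\<tau>\<^sup>n (1 + z\<^sup>u)\<^sup>l\<^sup>n\<close> with \<open>\<tau>\<close> and \<open>l\<close> linear, the variation maps and
  \<open>p\<^sup>*\<close> by monomial characters. Composites of such maps are determined by their values on monomials, so a
  variation map commutes with a mutation as soon as it intertwines the data \<open>(\<tau>, l, u)\<close> of the two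
  mutations; conjugating it with the involutions \<open>\<tau>\<close> gives the variation map between the mutated seeds.
  Hence variation maps commute with all mutation sequences and preserve the upper cluster algebras.
  The two notions of variation map are dual under the pairing \<open>\<omega>(n, n') = \<langle>p\<^sup>* n, n'\<rangle>\<close>, and the Poisson
  property and the identity \<open>p\<^sup>* (tw\<^sup>X)\<^sup>-\<^sup>1 = tw\<^sup>A p\<^sup>*\<close> both say that \<open>\<omega>\<close> is preserved on all of \<open>N\<close>.
\<close>

text \<open>A variation map may have a kernel, and so may \<open>pstar\<close>; the homomorphisms
  they induce then do not extend to the whole fraction field. Each extension is therefore a ring
  homomorphism on its own local ring of fractions, and every commutation statement must also say
  that the fractions concerned stay inside these domains. The remedy is the injectivity of
  mutations: a denominator that survives a monomial map cannot be killed by a mutation applied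
  afterwards. The involution \<open>\<tau>\<close> depends on the exchange matrix, and mutating back
  uses the matrix of the mutated seed. The composite of the two involutions is a transvection along
  \<open>u\<close>, not the identity; it absorbs the monomial in
  \<open>1 + z\<^sup>-\<^sup>u = z\<^sup>-\<^sup>u (1 + z\<^sup>u)\<close>. As \<open>pstar\<close>
  can lose information, statements on the \<open>A\<close> side are not deduced from the
  \<open>X\<close> side; both are instances of the same lemmas about exponent groups. The tensor
  product with rational frozen powers is not an intersection by definition. It is turned into one by
  grading exponents modulo integral ones, and only then can mutations be applied seed by
  seed.\<close>

section \<open>Partial homomorphisms of fields\<close>

text \<open>The model is a local subring of a field whose maximal ideal is the kernel of
  \<open>f\<close>: \<open>inverse_closed\<close> makes every element with nonzero image a unit of
  \<open>D\<close>, which lets \<open>f\<close> pass through quotients and integer powers.\<close>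

locale partial_hom =
  fixes D :: "'a::field set" and f :: "'a \<Rightarrow> 'b::field"
  assumes one_closed: "1 \<in> D" and f_one: "f 1 = 1"
    and add_closed: "x \<in> D \<Longrightarrow> y \<in> D \<Longrightarrow> x + y \<in> D"
    and f_add: "x \<in> D \<Longrightarrow> y \<in> D \<Longrightarrow> f (x + y) = f x + f y"
    and mult_closed: "x \<in> D \<Longrightarrow> y \<in> D \<Longrightarrow> x * y \<in> D"
    and f_mult: "x \<in> D \<Longrightarrow> y \<in> D \<Longrightarrow> f (x * y) = f x * f y"
    and uminus_closed: "x \<in> D \<Longrightarrow> - x \<in> D"
    and inverse_closed: "x \<in> D \<Longrightarrow> f x \<noteq> 0 \<Longrightarrow> inverse x \<in> D"
begin

lemma zero_closed: "0 \<in> D"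
  using add_closed[OF one_closed uminus_closed[OF one_closed]] by simp

lemma f_zero: "f 0 = 0"
  using f_add[OF zero_closed zero_closed] by (metis add_0 add_cancel_right_right)

lemma f_uminus: "x \<in> D \<Longrightarrow> f (- x) = - f x"
  using f_add[of x "- x"] uminus_closed[of x] f_zero by (simp add: eq_neg_iff_add_eq_0 add.commute)

lemma f_inverse:
  assumes "x \<in> D" "f x \<noteq> 0"
  shows "f (inverse x) = inverse (f x)"
proof -
  have "x \<noteq> 0"
    using assms f_zero by auto
  then have "f x * f (inverse x) = 1"
    using f_mult[OF assms(1) inverse_closed[OF assms]] f_one by simp
  then show ?thesis
    by (simp add: inverse_unique)
qed

lemma divide_closed: "x \<in> D \<Longrightarrow> y \<in> D \<Longrightarrow> f y \<noteq> 0 \<Longrightarrow> x / y \<in> D"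
  by (simp add: divide_inverse mult_closed inverse_closed)

lemma f_divide: "x \<in> D \<Longrightarrow> y \<in> D \<Longrightarrow> f y \<noteq> 0 \<Longrightarrow> f (x / y) = f x / f y"
  by (simp add: divide_inverse f_mult inverse_closed f_inverse)

lemma of_nat_closed: "of_nat n \<in> D"
  by (induction n) (auto intro: zero_closed one_closed add_closed)

lemma f_of_nat: "f (of_nat n) = of_nat n"
  by (induction n) (auto simp: f_zero f_one f_add of_nat_closed one_closed)

lemma of_int_closed: "of_int n \<in> D"
  by (cases n) (auto intro!: of_nat_closed uminus_closed simp del: of_nat_Suc)

lemma f_of_int: "f (of_int n) = of_int n"
  by (cases n) (auto simp: f_of_nat f_uminus of_nat_closed simp del: of_nat_Suc)

lemma sum_closed: "(\<And>x. x \<in> A \<Longrightarrow> g x \<in> D) \<Longrightarrow> sum g A \<in> D"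
  by (induction A rule: infinite_finite_induct) (auto intro: zero_closed add_closed)

lemma f_sum: "(\<And>x. x \<in> A \<Longrightarrow> g x \<in> D) \<Longrightarrow> f (sum g A) = (\<Sum>x\<in>A. f (g x))"
  by (induction A rule: infinite_finite_induct) (auto simp: f_zero f_add sum_closed)

lemma power_closed: "x \<in> D \<Longrightarrow> x ^ n \<in> D"
  by (induction n) (auto intro: one_closed mult_closed)

lemma f_power: "x \<in> D \<Longrightarrow> f (x ^ n) = f x ^ n"
  by (induction n) (auto simp: f_one f_mult power_closed)

lemma powi_closed: "x \<in> D \<Longrightarrow> f x \<noteq> 0 \<Longrightarrow> x powi n \<in> D"
  by (auto simp: power_int_def power_closed inverse_closed)

lemma f_powi: "x \<in> D \<Longrightarrow> f x \<noteq> 0 \<Longrightarrow> f (x powi n) = f x powi n"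
  by (auto simp: power_int_def f_power inverse_closed f_inverse)

end

lemma partial_hom_id: "partial_hom UNIV (\<lambda>x. x)"
  by unfold_locales auto

section \<open>Group rings with exponents in a subgroup, and their evaluation at characters\<close>

section \<open>Group rings and their fraction fields\<close>

definition subgrp :: "'a::ab_group_add set \<Rightarrow> bool" where
  "subgrp H \<longleftrightarrow> 0 \<in> H \<and> (\<forall>x\<in>H. \<forall>y\<in>H. x - y \<in> H)"

lemma subgrp_zero: "subgrp H \<Longrightarrow> 0 \<in> H"
  by (simp add: subgrp_def)

lemma subgrp_diff: "subgrp H \<Longrightarrow> x \<in> H \<Longrightarrow> y \<in> H \<Longrightarrow> x - y \<in> H"
  by (simp add: subgrp_def)

lemma subgrp_uminus: "subgrp H \<Longrightarrow> x \<in> H \<Longrightarrow> - x \<in> H"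
  using subgrp_diff[of H 0 x] by (simp add: subgrp_zero)

lemma subgrp_add: "subgrp H \<Longrightarrow> x \<in> H \<Longrightarrow> y \<in> H \<Longrightarrow> x + y \<in> H"
  using subgrp_diff[of H x "- y"] by (simp add: subgrp_uminus)

lemma subgrp_UNIV: "subgrp UNIV"
  by (simp add: subgrp_def)

text \<open>Exponents are cut out of one type by a subgroup, so that Laurent rings with integral or
  partly rational exponents share one ambient field.\<close>

definition group_ring_on :: "'a set \<Rightarrow> ('a, int) laurent set" where
  "group_ring_on H = {p. Poly_Mapping.keys p \<subseteq> H}"

lemma group_ring_on_UNIV [simp]: "group_ring_on UNIV = UNIV"
  by (simp add: group_ring_on_def)

lemma group_ring_on_mono: "H \<subseteq> H' \<Longrightarrow> group_ring_on H \<subseteq> group_ring_on H'"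
  by (auto simp: group_ring_on_def)

lemma group_ring_add: "p \<in> group_ring_on H \<Longrightarrow> q \<in> group_ring_on H \<Longrightarrow> p + q \<in> group_ring_on H"
  using Poly_Mapping.keys_add[of p q] by (auto simp: group_ring_on_def)

lemma group_ring_uminus: "p \<in> group_ring_on H \<Longrightarrow> - p \<in> group_ring_on H"
  by (auto simp: group_ring_on_def)

lemma group_ring_zero: "0 \<in> group_ring_on H"
  by (simp add: group_ring_on_def)

lemma group_ring_sum: "(\<And>x. x \<in> A \<Longrightarrow> g x \<in> group_ring_on H) \<Longrightarrow> sum g A \<in> group_ring_on H"
  by (induction A rule: infinite_finite_induct) (auto intro: group_ring_zero group_ring_add)

lemma group_ring_mult:
  assumes "subgrp H" "p \<in> group_ring_on H" "q \<in> group_ring_on H"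
  shows "p * q \<in> group_ring_on H"
  using Poly_Mapping.keys_mult[of p q] assms subgrp_add[OF assms(1)]
  by (fastforce simp: group_ring_on_def)

lemma group_ring_single: "n \<in> H \<Longrightarrow> Poly_Mapping.single n c \<in> group_ring_on H"
  by (simp add: group_ring_on_def)

lemma group_ring_one: "subgrp H \<Longrightarrow> 1 \<in> group_ring_on H"
  by (simp add: group_ring_on_def subgrp_zero)

lemma laurent_expand:
  "p = (\<Sum>n\<in>Poly_Mapping.keys p. Poly_Mapping.single n (Poly_Mapping.lookup p n))"
  by (rule poly_mapping_eqI)
    (simp add: lookup_sum lookup_single when_def sum.delta' not_in_keys_iff_lookup_eq_zero)

definition char_eval :: "('a \<Rightarrow> 'b::comm_ring_1) \<Rightarrow> ('a, int) laurent \<Rightarrow> 'b" where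
  "char_eval \<chi> p = (\<Sum>n\<in>Poly_Mapping.keys p. of_int (Poly_Mapping.lookup p n) * \<chi> n)"

lemma char_eval_superset:
  assumes "finite A" "Poly_Mapping.keys p \<subseteq> A"
  shows "char_eval \<chi> p = (\<Sum>n\<in>A. of_int (Poly_Mapping.lookup p n) * \<chi> n)"
  unfolding char_eval_def
  by (rule sum.mono_neutral_left) (use assms in \<open>auto simp: not_in_keys_iff_lookup_eq_zero\<close>)

lemma char_eval_single [simp]: "char_eval \<chi> (Poly_Mapping.single n c) = of_int c * \<chi> n"
  by (simp add: char_eval_def)

lemma char_eval_zero [simp]: "char_eval \<chi> 0 = 0"
  by (simp add: char_eval_def)

lemma char_eval_add: "char_eval \<chi> (p + q) = char_eval \<chi> p + char_eval \<chi> q"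
proof -
  let ?A = "Poly_Mapping.keys p \<union> Poly_Mapping.keys q"
  have "char_eval \<chi> r = (\<Sum>n\<in>?A. of_int (Poly_Mapping.lookup r n) * \<chi> n)"
    if "r \<in> {p, q, p + q}" for r
    using that Poly_Mapping.keys_add[of p q] by (intro char_eval_superset) auto
  then show ?thesis
    by (simp add: lookup_add ring_distribs sum.distrib)
qed

lemma char_eval_sum: "char_eval \<chi> (sum g A) = (\<Sum>x\<in>A. char_eval \<chi> (g x))"
  by (induction A rule: infinite_finite_induct) (auto simp: char_eval_add)

lemma char_eval_cong:
  "p \<in> group_ring_on H \<Longrightarrow> (\<And>n. n \<in> H \<Longrightarrow> \<chi> n = \<psi> n) \<Longrightarrow> char_eval \<chi> p = char_eval \<psi> p"
  unfolding char_eval_def group_ring_on_def by (rule sum.cong) auto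

lemma char_eval_mult:
  assumes "p \<in> group_ring_on H" "q \<in> group_ring_on H"
    and "\<And>m n. m \<in> H \<Longrightarrow> n \<in> H \<Longrightarrow> \<chi> (m + n) = \<chi> m * \<chi> n"
  shows "char_eval \<chi> (p * q) = char_eval \<chi> p * char_eval \<chi> q"
proof -
  let ?P = "Poly_Mapping.keys p" and ?Q = "Poly_Mapping.keys q"
  have "p * q = (\<Sum>m\<in>?P. Poly_Mapping.single m (Poly_Mapping.lookup p m)) *
      (\<Sum>n\<in>?Q. Poly_Mapping.single n (Poly_Mapping.lookup q n))"
    by (simp only: laurent_expand[symmetric])
  also have "\<dots> = (\<Sum>m\<in>?P. \<Sum>n\<in>?Q.
      Poly_Mapping.single (m + n) (Poly_Mapping.lookup p m * Poly_Mapping.lookup q n))"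
    by (simp add: sum_product mult_single)
  also have "char_eval \<chi> \<dots> =
      (\<Sum>m\<in>?P. \<Sum>n\<in>?Q. of_int (Poly_Mapping.lookup p m * Poly_Mapping.lookup q n) * \<chi> (m + n))"
    by (simp add: char_eval_sum)
  also have "\<dots> = (\<Sum>m\<in>?P. \<Sum>n\<in>?Q.
      (of_int (Poly_Mapping.lookup p m) * \<chi> m) * (of_int (Poly_Mapping.lookup q n) * \<chi> n))"
    using assms by (intro sum.cong refl) (auto simp: group_ring_on_def subset_eq)
  also have "\<dots> = char_eval \<chi> p * char_eval \<chi> q"
    by (simp add: char_eval_def sum_product)
  finally show ?thesis .
qed

lemma (in partial_hom) char_eval_closed:
  assumes "p \<in> group_ring_on H" "\<And>n. n \<in> H \<Longrightarrow> \<chi> n \<in> D"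
  shows "char_eval \<chi> p \<in> D"
  using assms unfolding char_eval_def group_ring_on_def
  by (auto intro!: sum_closed mult_closed of_int_closed)

lemma (in partial_hom) f_char_eval:
  assumes "p \<in> group_ring_on H" "\<And>n. n \<in> H \<Longrightarrow> \<chi> n \<in> D"
  shows "f (char_eval \<chi> p) = char_eval (\<lambda>n. f (\<chi> n)) p"
proof -
  have *: "\<chi> n \<in> D" if "n \<in> Poly_Mapping.keys p" for n
    using assms that by (auto simp: group_ring_on_def)
  show ?thesis
    unfolding char_eval_def
    by (subst f_sum) (auto simp: * mult_closed of_int_closed f_mult f_of_int)
qed

section \<open>Localisation of a group ring at the kernel of a character\<close>

section \<open>Extending characters to fractions\<close>

text \<open>For a character on \<open>H\<close> this is the localisation of the group ring at the
  prime ideal of elements killed by \<open>char_eval \<chi>\<close>, the natural domain of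
  \<open>char_ext\<close>.\<close>

definition char_dom :: "'a::linordered_ab_group_add set \<Rightarrow> ('a \<Rightarrow> 'b::field) \<Rightarrow> ('a, int) laurent fract set" where
  "char_dom H \<chi> = {Fraction_Field.Fract a b | a b.
     a \<in> group_ring_on H \<and> b \<in> group_ring_on H \<and> char_eval \<chi> b \<noteq> 0}"

abbreviation char_ext :: "'a::linordered_ab_group_add set \<Rightarrow> ('a \<Rightarrow> 'b::field) \<Rightarrow> ('a, int) laurent fract \<Rightarrow> 'b" where
  "char_ext H \<chi> \<equiv> frac_ext (group_ring_on H) (char_eval \<chi>)"

lemma frac_ext_cong:
  assumes "\<And>a. a \<in> R \<Longrightarrow> \<phi> a = \<psi> a"
  shows "frac_ext R \<phi> = frac_ext R \<psi>"
proof -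
  have "(\<exists>a\<in>R. \<exists>b\<in>R. b \<noteq> 0 \<and> \<phi> b \<noteq> 0 \<and> f = Fraction_Field.Fract a b \<and> g = \<phi> a / \<phi> b) \<longleftrightarrow>
     (\<exists>a\<in>R. \<exists>b\<in>R. b \<noteq> 0 \<and> \<psi> b \<noteq> 0 \<and> f = Fraction_Field.Fract a b \<and> g = \<psi> a / \<psi> b)" for f g
    using assms by metis
  then show ?thesis
    unfolding frac_ext_def by presburger
qed

locale lattice_char =
  fixes H :: "'a::linordered_ab_group_add set" and \<chi> :: "'a \<Rightarrow> 'b::field"
  assumes subgrp: "subgrp H"
    and char_add: "m \<in> H \<Longrightarrow> n \<in> H \<Longrightarrow> \<chi> (m + n) = \<chi> m * \<chi> n"
    and char_nonzero: "n \<in> H \<Longrightarrow> \<chi> n \<noteq> 0"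
begin

lemma char_0: "\<chi> 0 = 1"
  using char_add[of 0 0] char_nonzero[of 0] subgrp_zero[OF subgrp] by simp

lemma char_uminus: "n \<in> H \<Longrightarrow> \<chi> (- n) = inverse (\<chi> n)"
  using char_add[of n "- n"] subgrp_uminus[OF subgrp, of n] char_0
  by (simp add: inverse_unique)

lemma eval_one: "char_eval \<chi> 1 = 1"
  by (simp add: char_0 flip: single_one)

lemma eval_mult: "p \<in> group_ring_on H \<Longrightarrow> q \<in> group_ring_on H \<Longrightarrow>
    char_eval \<chi> (p * q) = char_eval \<chi> p * char_eval \<chi> q"
  by (rule char_eval_mult[where H = H]) (auto simp: char_add)

text \<open>Two representations of a fraction give a cross-multiplied identity inside the group
  ring, and evaluation is multiplicative there; so the description in \<open>frac_ext\<close> picks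
  out one value.\<close>

lemma ext_Fract:
  assumes a: "a \<in> group_ring_on H" and b: "b \<in> group_ring_on H" and nz: "char_eval \<chi> b \<noteq> 0"
  shows "char_ext H \<chi> (Fraction_Field.Fract a b) = char_eval \<chi> a / char_eval \<chi> b"
  unfolding frac_ext_def
proof (rule the_equality)
  show "\<exists>a'\<in>group_ring_on H. \<exists>b'\<in>group_ring_on H. b' \<noteq> 0 \<and> char_eval \<chi> b' \<noteq> 0 \<and>
      Fraction_Field.Fract a b = Fraction_Field.Fract a' b' \<and>
      char_eval \<chi> a / char_eval \<chi> b = char_eval \<chi> a' / char_eval \<chi> b'"
    using assms by (intro bexI[of _ a] bexI[of _ b]) auto
next
  fix g
  assume "\<exists>a'\<in>group_ring_on H. \<exists>b'\<in>group_ring_on H. b' \<noteq> 0 \<and> char_eval \<chi> b' \<noteq> 0 \<and>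
      Fraction_Field.Fract a b = Fraction_Field.Fract a' b' \<and> g = char_eval \<chi> a' / char_eval \<chi> b'"
  then obtain a' b' where *: "a' \<in> group_ring_on H" "b' \<in> group_ring_on H" "char_eval \<chi> b' \<noteq> 0"
      "Fraction_Field.Fract a b = Fraction_Field.Fract a' b'" "g = char_eval \<chi> a' / char_eval \<chi> b'"
    by blast
  then have "b \<noteq> 0" "b' \<noteq> 0"
    using nz by auto
  then have "a * b' = a' * b"
    using *(4) by (simp add: eq_fract)
  then have "char_eval \<chi> a * char_eval \<chi> b' = char_eval \<chi> a' * char_eval \<chi> b"
    using a b * by (metis eval_mult)
  then show "g = char_eval \<chi> a / char_eval \<chi> b"
    using nz * by (simp add: frac_eq_eq)
qed

lemma Fract_in_dom: "a \<in> group_ring_on H \<Longrightarrow> b \<in> group_ring_on H \<Longrightarrow> char_eval \<chi> b \<noteq> 0 \<Longrightarrow>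
    Fraction_Field.Fract a b \<in> char_dom H \<chi>"
  unfolding char_dom_def by blast

lemma domE:
  assumes "f \<in> char_dom H \<chi>"
  obtains a b where "a \<in> group_ring_on H" "b \<in> group_ring_on H" "char_eval \<chi> b \<noteq> 0"
    "b \<noteq> 0" "f = Fraction_Field.Fract a b"
proof -
  from assms obtain a b where *: "a \<in> group_ring_on H" "b \<in> group_ring_on H" "char_eval \<chi> b \<noteq> 0"
    "f = Fraction_Field.Fract a b"
    unfolding char_dom_def by blast
  moreover from *(3) have "b \<noteq> 0"
    by auto
  ultimately show thesis
    using that by blast
qed

lemma to_field_in_dom: "a \<in> group_ring_on H \<Longrightarrow> to_field a \<in> char_dom H \<chi>"
  unfolding to_field_def by (rule Fract_in_dom) (auto simp: eval_one group_ring_one subgrp)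

lemma ext_to_field: "a \<in> group_ring_on H \<Longrightarrow> char_ext H \<chi> (to_field a) = char_eval \<chi> a"
  unfolding to_field_def by (subst ext_Fract) (auto simp: eval_one group_ring_one subgrp)

lemma partial_hom: "partial_hom (char_dom H \<chi>) (char_ext H \<chi>)"
proof
  note ring = group_ring_add group_ring_mult[OF subgrp] group_ring_uminus
  have 1: "to_field 1 = (1 :: ('a, int) laurent fract)"
    by (simp add: to_field_def One_fract_def)
  show "1 \<in> char_dom H \<chi>" "char_ext H \<chi> 1 = 1"
    using to_field_in_dom[of 1] ext_to_field[of 1] by (auto simp: 1 eval_one group_ring_one subgrp)
  fix x assume "x \<in> char_dom H \<chi>"
  then obtain a b where x: "a \<in> group_ring_on H" "b \<in> group_ring_on H" "char_eval \<chi> b \<noteq> 0"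
      "b \<noteq> 0" "x = Fraction_Field.Fract a b"
    by (rule domE)
  from x show "- x \<in> char_dom H \<chi>"
    by (auto intro!: Fract_in_dom ring)
  from x show "inverse x \<in> char_dom H \<chi>" if "char_ext H \<chi> x \<noteq> 0"
    using that by (auto intro!: Fract_in_dom simp: ext_Fract)
  fix y assume "y \<in> char_dom H \<chi>"
  then obtain c e where y: "c \<in> group_ring_on H" "e \<in> group_ring_on H" "char_eval \<chi> e \<noteq> 0"
      "e \<noteq> 0" "y = Fraction_Field.Fract c e"
    by (rule domE)
  from x y show "x + y \<in> char_dom H \<chi>" "x * y \<in> char_dom H \<chi>"
    by (auto intro!: Fract_in_dom ring simp: eval_mult)
  from x y show "char_ext H \<chi> (x + y) = char_ext H \<chi> x + char_ext H \<chi> y"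
    by (simp add: ext_Fract ring eval_mult char_eval_add field_simps)
  from x y show "char_ext H \<chi> (x * y) = char_ext H \<chi> x * char_ext H \<chi> y"
    by (simp add: ext_Fract ring eval_mult)
qed

end

lemma lattice_charI:
  assumes "subgrp H" "\<And>m n. m \<in> H \<Longrightarrow> n \<in> H \<Longrightarrow> \<chi> (m + n) = \<chi> m * \<chi> n" "\<chi> 0 = 1"
  shows "lattice_char H (\<chi> :: _ \<Rightarrow> 'b::field)"
proof
  show "\<chi> n \<noteq> 0" if "n \<in> H" for n
    using assms(2)[OF that subgrp_uminus[OF assms(1) that]] assms(3) by auto
qed (use assms in auto)

text \<open>No injectivity is needed: a denominator that survives the composite survives the first map.\<close>

lemma char_ext_comp:
  assumes \<chi>: "lattice_char H \<chi>" and \<psi>: "lattice_char H' \<psi>"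
    and dc: "\<forall>n\<in>H. \<chi> n \<in> char_dom H' \<psi> \<and> char_ext H' \<psi> (\<chi> n) = \<theta> n"
  shows "lattice_char H \<theta>"
    and "p \<in> group_ring_on H \<Longrightarrow> char_eval \<chi> p \<in> char_dom H' \<psi>"
    and "p \<in> group_ring_on H \<Longrightarrow> char_ext H' \<psi> (char_eval \<chi> p) = char_eval \<theta> p"
    and "f \<in> char_dom H \<theta> \<Longrightarrow> f \<in> char_dom H \<chi>"
    and "f \<in> char_dom H \<theta> \<Longrightarrow> char_ext H \<chi> f \<in> char_dom H' \<psi>"
    and "f \<in> char_dom H \<theta> \<Longrightarrow> char_ext H' \<psi> (char_ext H \<chi> f) = char_ext H \<theta> f"
proof -
  have dom: "\<chi> n \<in> char_dom H' \<psi>" and comp: "char_ext H' \<psi> (\<chi> n) = \<theta> n"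
    if "n \<in> H" for n
    using dc that by auto
  interpret X: lattice_char H \<chi> by fact
  interpret Y: lattice_char H' \<psi> by fact
  interpret P: partial_hom "char_dom H' \<psi>" "char_ext H' \<psi>" by (rule Y.partial_hom)
  show \<theta>: "lattice_char H \<theta>"
  proof (rule lattice_charI[OF X.subgrp])
    fix m n assume "m \<in> H" "n \<in> H"
    then show "\<theta> (m + n) = \<theta> m * \<theta> n"
      by (simp add: subgrp_add[OF X.subgrp] X.char_add P.f_mult dom flip: comp)
  qed (simp add: comp[symmetric] subgrp_zero X.subgrp X.char_0 P.f_one)
  interpret T: lattice_char H \<theta> by fact
  show cl: "char_eval \<chi> p \<in> char_dom H' \<psi>" if "p \<in> group_ring_on H" for p
    using that dom by (rule P.char_eval_closed)
  show ev: "char_ext H' \<psi> (char_eval \<chi> p) = char_eval \<theta> p" if "p \<in> group_ring_on H" for p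
    using P.f_char_eval[OF that dom] char_eval_cong[OF that comp] by simp
  assume "f \<in> char_dom H \<theta>"
  then obtain a b where f: "a \<in> group_ring_on H" "b \<in> group_ring_on H" "char_eval \<theta> b \<noteq> 0"
      "f = Fraction_Field.Fract a b"
    by (rule T.domE)
  have nz: "char_eval \<chi> b \<noteq> 0"
    using f(2,3) ev[of b] P.f_zero by auto
  have f_eq: "char_ext H \<chi> f = char_eval \<chi> a / char_eval \<chi> b"
    using f nz by (simp add: X.ext_Fract)
  show "f \<in> char_dom H \<chi>"
    using f nz by (auto intro: X.Fract_in_dom)
  show "char_ext H \<chi> f \<in> char_dom H' \<psi>"
    unfolding f_eq by (rule P.divide_closed) (use f cl ev in auto)
  show "char_ext H' \<psi> (char_ext H \<chi> f) = char_ext H \<theta> f"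
    unfolding f_eq using f by (subst P.f_divide) (auto simp: cl ev T.ext_Fract)
qed

section \<open>The common shape of the two kinds of mutation\<close>

section \<open>Monomial characters and mutation characters\<close>

definition mon :: "'a::linordered_ab_group_add \<Rightarrow> ('a, int) laurent fract" where
  "mon n = to_field (monomial n)"

lemma to_field_add: "to_field (p + q) = to_field p + to_field q"
  by (simp add: to_field_def)

lemma to_field_mult: "to_field (p * q) = to_field p * to_field q"
  by (simp add: to_field_def)

lemma to_field_zero [simp]: "to_field 0 = 0"
  by (simp add: to_field_def Zero_fract_def)

lemma to_field_one [simp]: "to_field 1 = 1"
  by (simp add: to_field_def One_fract_def)

lemma to_field_eq_iff [simp]: "to_field p = to_field q \<longleftrightarrow> p = q"
  by (simp add: to_field_def eq_fract)

lemma to_field_sum: "to_field (sum g A) = (\<Sum>x\<in>A. to_field (g x))"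
  by (induction A rule: infinite_finite_induct) (auto simp: to_field_add)

lemma to_field_of_int: "to_field (of_int c) = of_int c"
proof -
  have nat: "to_field (of_nat n) = of_nat n" for n
    by (induction n) (auto simp: to_field_add)
  have "to_field (- p) = - to_field p" for p :: 'a
    using to_field_add[of p "- p"] by (simp add: eq_neg_iff_add_eq_0 add.commute)
  then show ?thesis
    by (cases c) (auto simp: nat simp del: of_nat_Suc)
qed

lemma to_field_single: "to_field (Poly_Mapping.single n c) = of_int c * mon n"
proof -
  have "(of_int c :: ('a, int) laurent) * monomial n = Poly_Mapping.single n c"
    by (simp add: monomial_def mult_single flip: single_of_int)
  then show ?thesis
    unfolding mon_def by (metis to_field_mult to_field_of_int)
qed

lemma mon_0 [simp]: "mon 0 = 1"
  by (simp add: mon_def monomial_def)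

lemma mon_add: "mon (m + n) = mon m * mon n"
  by (simp add: mon_def monomial_def mult_single flip: to_field_mult)

lemma mon_eq_iff [simp]: "mon m = mon n \<longleftrightarrow> m = n"
  by (simp add: mon_def monomial_def) (metis lookup_single_eq lookup_single_not_eq zero_neq_one)

lemma lattice_char_mon: "subgrp H \<Longrightarrow> lattice_char H mon"
  by (rule lattice_charI) (auto simp: mon_add)

lemma mon_nonzero [simp]: "mon n \<noteq> 0"
  using lattice_char.char_nonzero[OF lattice_char_mon[OF subgrp_UNIV]] by auto

lemma mon_uminus: "mon (- n) = inverse (mon n)"
  using lattice_char.char_uminus[OF lattice_char_mon[OF subgrp_UNIV]] by auto

lemma one_plus_mon_nonzero [simp]: "1 + mon u \<noteq> 0"
proof -
  \<comment> \<open>The coefficient is 1, or 2 when \<open>u = 0\<close>, so the case of a trivial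
    exponent is covered as well.\<close>
  have "Poly_Mapping.lookup (1 + monomial u :: ('a, int) laurent) u \<noteq> 0"
    by (simp add: lookup_add monomial_def lookup_one when_def)
  then have "1 + monomial u \<noteq> (0 :: ('a, int) laurent)"
    by auto
  then show ?thesis
    unfolding mon_def by (metis to_field_add to_field_eq_iff to_field_one to_field_zero)
qed

lemma char_eval_mon: "char_eval mon p = to_field p"
proof -
  have "to_field p = (\<Sum>n\<in>Poly_Mapping.keys p. to_field (Poly_Mapping.single n (Poly_Mapping.lookup p n)))"
    by (subst laurent_expand) (rule to_field_sum)
  then show ?thesis
    by (simp add: char_eval_def to_field_single)
qed

text \<open>Brings \<open>varX\<close>, \<open>varA\<close> and \<open>pstar_alg\<close> under the
  theory of characters.\<close>

lemma char_eval_mon_map: "char_eval (\<lambda>n. mon (V n)) p = to_field (monomial_map V p)"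
  by (simp add: char_eval_def monomial_map_def to_field_sum to_field_single)

lemma char_dom_mon: "f \<in> char_dom H mon \<longleftrightarrow>
   (\<exists>a\<in>group_ring_on H. \<exists>b\<in>group_ring_on H. b \<noteq> 0 \<and> f = Fraction_Field.Fract a b)"
proof -
  have "to_field b \<noteq> 0 \<longleftrightarrow> b \<noteq> 0" for b :: "('a, int) laurent"
    using to_field_eq_iff[of b 0] by simp
  then show ?thesis
    unfolding char_dom_def char_eval_mon by auto
qed

lemma char_dom_mon_UNIV [simp]: "char_dom UNIV mon = UNIV"
proof -
  have "f \<in> char_dom UNIV mon" for f :: "('a, int) laurent fract"
    by (cases f) (auto simp: char_dom_mon)
  then show ?thesis
    by blast
qed

lemma char_ext_mon:
  assumes "subgrp H" "f \<in> char_dom H mon"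
  shows "char_ext H mon f = f"
proof -
  interpret lattice_char H mon
    by (rule lattice_char_mon[OF assms(1)])
  from assms(2) obtain a b where "a \<in> group_ring_on H" "b \<in> group_ring_on H" "char_eval mon b \<noteq> 0"
     "b \<noteq> 0" "f = Fraction_Field.Fract a b"
    by (rule domE)
  then show ?thesis
    using ext_Fract[of a b] by (simp add: char_eval_mon) (simp add: to_field_def)
qed

definition exp_char :: "('a \<Rightarrow> 'b::linordered_ab_group_add) \<Rightarrow> ('a \<Rightarrow> int) \<Rightarrow> 'b \<Rightarrow> 'a \<Rightarrow> ('b, int) laurent fract" where
  "exp_char \<tau> l u n = mon (\<tau> n) * (1 + mon u) powi l n"

text \<open>Additivity of \<open>l\<close> is asked on \<open>H\<close> only: on the
  \<open>A\<close> side \<open>l\<close> is the floor of a rational coordinate, which is additive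
  just where that coordinate is integral.\<close>

locale exp_data =
  fixes H :: "'a::linordered_ab_group_add set" and H' :: "'b::linordered_ab_group_add set"
    and \<tau> :: "'a \<Rightarrow> 'b" and l :: "'a \<Rightarrow> int" and u :: 'b
  assumes sub: "subgrp H" and sub': "subgrp H'"
    and tau_add: "\<And>m n. \<tau> (m + n) = \<tau> m + \<tau> n"
    and tau_in: "\<And>n. n \<in> H \<Longrightarrow> \<tau> n \<in> H'"
    and l_add: "\<And>m n. m \<in> H \<Longrightarrow> n \<in> H \<Longrightarrow> l (m + n) = l m + l n"
    and u_in: "u \<in> H'"
begin

lemma lattice_char: "lattice_char H (exp_char \<tau> l u)"
proof (rule lattice_charI[OF sub])
  have "\<tau> 0 = 0" "l 0 = 0"
    using tau_add[of 0 0] l_add[of 0 0] subgrp_zero[OF sub] by auto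
  then show "exp_char \<tau> l u 0 = 1"
    by (simp add: exp_char_def)
qed (simp add: exp_char_def tau_add l_add mon_add power_int_add)

lemma exp_char_in: "n \<in> H \<Longrightarrow> exp_char \<tau> l u n \<in> char_dom H' mon"
proof -
  assume n: "n \<in> H"
  interpret M: lattice_char H' mon
    by (rule lattice_char_mon[OF sub'])
  interpret P: partial_hom "char_dom H' mon" "char_ext H' mon"
    by (rule M.partial_hom)
  have *: "mon m \<in> char_dom H' mon" if "m \<in> H'" for m
    using M.to_field_in_dom[of "monomial m"] that
    by (simp add: mon_def group_ring_single monomial_def)
  then show ?thesis
    unfolding exp_char_def using n
    by (intro P.mult_closed P.powi_closed P.add_closed P.one_closed *)
      (auto simp: tau_in u_in char_ext_mon[OF sub'] P.add_closed P.one_closed *)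
qed

lemma eval_in: "p \<in> group_ring_on H \<Longrightarrow> char_eval (exp_char \<tau> l u) p \<in> char_dom H' mon"
  using partial_hom.char_eval_closed[OF lattice_char.partial_hom[OF lattice_char_mon[OF sub']]]
    exp_char_in by blast

lemma ext_in:
  assumes "f \<in> char_dom H (exp_char \<tau> l u)"
  shows "char_ext H (exp_char \<tau> l u) f \<in> char_dom H' mon"
proof -
  interpret M: lattice_char H' mon
    by (rule lattice_char_mon[OF sub'])
  interpret P: partial_hom "char_dom H' mon" "char_ext H' mon"
    by (rule M.partial_hom)
  interpret E: lattice_char H "exp_char \<tau> l u"
    by (rule lattice_char)
  from assms obtain a b where f: "a \<in> group_ring_on H" "b \<in> group_ring_on H"
     "char_eval (exp_char \<tau> l u) b \<noteq> 0" "b \<noteq> 0" "f = Fraction_Field.Fract a b"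
    by (rule E.domE)
  then show ?thesis
    by (auto simp: E.ext_Fract char_ext_mon[OF sub' eval_in] intro!: P.divide_closed eval_in)
qed

end

text \<open>Both ways around the square extend the same character, so it is enough to compare them
  on monomials. Neither \<open>V\<close> nor \<open>V'\<close> need be injective: \<open>f\<close>
  is given in the domain of \<open>V'\<close>, and injectivity of the mutation after
  \<open>V'\<close> puts \<open>f\<close> into the domain of the other composite too.\<close>

lemma char_ext_square:
  assumes E: "exp_data H H \<tau> l u" and E': "exp_data H' H' \<tau>' l' u'"
    and V_add: "\<And>m n. V (m + n) = V m + V n" and V'_add: "\<And>m n. V' (m + n) = V' m + V' n"
    and V_in: "\<And>n. n \<in> H \<Longrightarrow> V n \<in> H'" and V'_in: "\<And>n. n \<in> H \<Longrightarrow> V' n \<in> H'"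
    and comm: "\<And>n. n \<in> H \<Longrightarrow> V (\<tau> n) = \<tau>' (V' n)" "V u = u'" "\<And>n. n \<in> H \<Longrightarrow> l' (V' n) = l n"
    and inj: "\<And>p. p \<in> group_ring_on H' \<Longrightarrow> p \<noteq> 0 \<Longrightarrow> char_eval (exp_char \<tau>' l' u') p \<noteq> 0"
    and f: "f \<in> char_dom H (\<lambda>n. mon (V' n))"
  shows "char_ext H (exp_char \<tau> l u) f \<in> char_dom H (\<lambda>n. mon (V n))"
    and "char_ext H (\<lambda>n. mon (V n)) (char_ext H (exp_char \<tau> l u) f) =
      char_ext H' (exp_char \<tau>' l' u') (char_ext H (\<lambda>n. mon (V' n)) f)"
proof -
  interpret E: exp_data H H \<tau> l u by fact
  interpret E': exp_data H' H' \<tau>' l' u' by fact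
  interpret X: lattice_char H "exp_char \<tau> l u" by (rule E.lattice_char)
  interpret X': lattice_char H' "exp_char \<tau>' l' u'" by (rule E'.lattice_char)
  have V0: "V 0 = 0" "V' 0 = 0"
    using V_add[of 0 0] V'_add[of 0 0] by auto
  interpret Y: lattice_char H "\<lambda>n. mon (V n)"
    by (rule lattice_charI[OF E.sub]) (auto simp: V_add mon_add V0)
  interpret Y': lattice_char H "\<lambda>n. mon (V' n)"
    by (rule lattice_charI[OF E.sub]) (auto simp: V'_add mon_add V0)
  interpret P: partial_hom "char_dom H (\<lambda>n. mon (V n))" "char_ext H (\<lambda>n. mon (V n))"
    by (rule Y.partial_hom)
  \<comment> \<open>The common character of both composites, here as mutation followed by
    \<open>V\<close>; the relations \<open>comm\<close> identify it with \<open>V'\<close> followed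
    by mutation.\<close>
  define \<theta> where "\<theta> n = mon (V (\<tau> n)) * (1 + mon (V u)) powi l n" for n
  have mon_dom: "mon m \<in> char_dom H (\<lambda>n. mon (V n))"
    and mon_ext: "char_ext H (\<lambda>n. mon (V n)) (mon m) = mon (V m)" if "m \<in> H" for m
    using that Y.to_field_in_dom[of "monomial m"] Y.ext_to_field[of "monomial m"]
    by (auto simp: mon_def[of m] group_ring_single monomial_def)
  have 1: "exp_char \<tau> l u n \<in> char_dom H (\<lambda>n. mon (V n))"
    and 2: "char_ext H (\<lambda>n. mon (V n)) (exp_char \<tau> l u n) = \<theta> n" if "n \<in> H" for n
    using that unfolding exp_char_def \<theta>_def
    by (auto intro!: P.mult_closed P.powi_closed P.add_closed P.one_closed mon_dom
        simp: E.tau_in E.u_in P.f_mult P.f_powi P.f_add P.f_one mon_ext mon_dom P.one_closed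
          P.add_closed P.powi_closed)
  have 12: "\<forall>n\<in>H. exp_char \<tau> l u n \<in> char_dom H (\<lambda>n. mon (V n)) \<and>
      char_ext H (\<lambda>n. mon (V n)) (exp_char \<tau> l u n) = \<theta> n"
    using 1 2 by blast
  note c1 = char_ext_comp[OF X.lattice_char_axioms Y.lattice_char_axioms 12]
  have 3: "mon (V' n) \<in> char_dom H' (exp_char \<tau>' l' u')"
    and 4: "char_ext H' (exp_char \<tau>' l' u') (mon (V' n)) = \<theta> n" if "n \<in> H" for n
    using that X'.to_field_in_dom[of "monomial (V' n)"] X'.ext_to_field[of "monomial (V' n)"]
    by (auto simp: mon_def[of "V' n"] group_ring_single monomial_def V'_in \<theta>_def exp_char_def comm)
  have 34: "\<forall>n\<in>H. mon (V' n) \<in> char_dom H' (exp_char \<tau>' l' u') \<and>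
      char_ext H' (exp_char \<tau>' l' u') (mon (V' n)) = \<theta> n"
    using 3 4 by blast
  note c2 = char_ext_comp[OF Y'.lattice_char_axioms X'.lattice_char_axioms 34]
  interpret T: lattice_char H \<theta> by (rule c1(1))
  \<comment> \<open>A denominator \<open>b\<close> that survives \<open>V'\<close> becomes a nonzero
    Laurent polynomial \<open>?q\<close>; its image under the second mutation is
    \<open>char_eval \<theta> b\<close>, nonzero by \<open>inj\<close>.\<close>
  have "f \<in> char_dom H \<theta>"
  proof -
    from f obtain a b where ab: "a \<in> group_ring_on H" "b \<in> group_ring_on H"
      "char_eval (\<lambda>n. mon (V' n)) b \<noteq> 0" "f = Fraction_Field.Fract a b"
      by (rule Y'.domE)
    let ?q = "monomial_map V' b"
    have q: "?q \<in> group_ring_on H'"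
      using ab(2) V'_in by (auto simp: monomial_map_def group_ring_on_def[of H]
          intro!: group_ring_sum group_ring_single)
    have "?q \<noteq> 0"
      using ab(3) by (auto simp: char_eval_mon_map)
    then have "char_eval \<theta> b \<noteq> 0"
      using inj[OF q] c2(3)[OF ab(2)] X'.ext_to_field[OF q] by (simp add: char_eval_mon_map)
    then show ?thesis
      using ab by (auto intro: T.Fract_in_dom)
  qed
  then show "char_ext H (exp_char \<tau> l u) f \<in> char_dom H (\<lambda>n. mon (V n))"
    and "char_ext H (\<lambda>n. mon (V n)) (char_ext H (exp_char \<tau> l u) f) =
      char_ext H' (exp_char \<tau>' l' u') (char_ext H (\<lambda>n. mon (V' n)) f)"
    using c1(5,6) c2(6) by auto
qed

text \<open>Mutating twice in the same direction is the identity; the hypothesis on \<open>\<tau> u1\<close> covers both the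
  \<open>X\<close> side, where \<open>u1 = u\<close> and \<open>\<tau> u = - u\<close>, and the \<open>A\<close> side, where \<open>u1 = - u\<close> is fixed by \<open>\<tau>\<close>.\<close>

lemma char_ext_inverse:
  assumes E: "exp_data H H \<tau> l u" and E1: "exp_data H H \<tau>1 l1 u1"
    and u1: "\<tau> u1 = - u" "l u1 = 0"
    and comp: "\<And>n. n \<in> H \<Longrightarrow> mon (\<tau> (\<tau>1 n)) = mon n * mon u powi l1 n"
      "\<And>n. n \<in> H \<Longrightarrow> l (\<tau>1 n) = - l1 n"
  shows "p \<in> group_ring_on H \<Longrightarrow> p \<noteq> 0 \<Longrightarrow> char_eval (exp_char \<tau>1 l1 u1) p \<noteq> 0"
    and "f \<in> char_dom H mon \<Longrightarrow> f \<in> char_dom H (exp_char \<tau>1 l1 u1)"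
    and "f \<in> char_dom H mon \<Longrightarrow> char_ext H (exp_char \<tau> l u) (char_ext H (exp_char \<tau>1 l1 u1) f) = f"
proof -
  interpret E: exp_data H H \<tau> l u by fact
  interpret E1: exp_data H H \<tau>1 l1 u1 by fact
  interpret X: lattice_char H "exp_char \<tau> l u" by (rule E.lattice_char)
  interpret X1: lattice_char H "exp_char \<tau>1 l1 u1" by (rule E1.lattice_char)
  interpret P: partial_hom "char_dom H (exp_char \<tau> l u)" "char_ext H (exp_char \<tau> l u)"
    by (rule X.partial_hom)
  have mon_dom: "mon m \<in> char_dom H (exp_char \<tau> l u)"
    and mon_ext: "char_ext H (exp_char \<tau> l u) (mon m) = exp_char \<tau> l u m" if "m \<in> H" for m
    using that X.to_field_in_dom[of "monomial m"] X.ext_to_field[of "monomial m"]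
    by (auto simp: mon_def[of m] group_ring_single monomial_def)
  \<comment> \<open>Replacing \<open>u\<close> by its negative costs a monomial factor. Raised to
    the power \<open>l1 n\<close> it cancels the factor \<open>mon u powi l1 n\<close> that
    \<open>comp\<close> leaves over from the linear parts.\<close>
  have flip: "1 + mon (- u) = inverse (mon u) * (1 + mon u)"
    by (simp add: mon_uminus ring_distribs)
  have ext1: "char_ext H (exp_char \<tau> l u) (1 + mon u1) = inverse (mon u) * (1 + mon u)"
    using E1.u_in by (simp add: P.f_add P.one_closed mon_dom P.f_one mon_ext exp_char_def u1 flip)
  have nz: "inverse (mon u) * (1 + mon u) \<noteq> 0"
    by simp
  have dom1: "(1 + mon u1) powi c \<in> char_dom H (exp_char \<tau> l u)"
    "char_ext H (exp_char \<tau> l u) ((1 + mon u1) powi c) = (inverse (mon u) * (1 + mon u)) powi c" for c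
    using E1.u_in ext1 nz
    by (auto intro!: P.powi_closed simp: P.f_powi P.add_closed P.one_closed mon_dom)
  have 1: "exp_char \<tau>1 l1 u1 n \<in> char_dom H (exp_char \<tau> l u)"
    and 2: "char_ext H (exp_char \<tau> l u) (exp_char \<tau>1 l1 u1 n) = mon n" if n: "n \<in> H" for n
  proof -
    show "exp_char \<tau>1 l1 u1 n \<in> char_dom H (exp_char \<tau> l u)"
      unfolding exp_char_def[of \<tau>1] using n by (intro P.mult_closed dom1 mon_dom E1.tau_in)
    have "char_ext H (exp_char \<tau> l u) (exp_char \<tau>1 l1 u1 n) =
       mon (\<tau> (\<tau>1 n)) * (1 + mon u) powi l (\<tau>1 n) * (inverse (mon u) * (1 + mon u)) powi l1 n"
      unfolding exp_char_def[of \<tau>1] using n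
      by (simp add: P.f_mult dom1 mon_dom E1.tau_in mon_ext) (simp add: exp_char_def)
    also have "\<dots> = mon n"
      using n by (simp add: comp power_int_mult_distrib power_int_inverse power_int_minus)
        (simp add: field_simps)
    finally show "char_ext H (exp_char \<tau> l u) (exp_char \<tau>1 l1 u1 n) = mon n" .
  qed
  then have 12: "\<forall>n\<in>H. exp_char \<tau>1 l1 u1 n \<in> char_dom H (exp_char \<tau> l u) \<and>
      char_ext H (exp_char \<tau> l u) (exp_char \<tau>1 l1 u1 n) = mon n"
    by blast
  note c = char_ext_comp[OF X1.lattice_char_axioms X.lattice_char_axioms 12]
  show "char_eval (exp_char \<tau>1 l1 u1) p \<noteq> 0" if "p \<in> group_ring_on H" "p \<noteq> 0"
    using c(3)[OF that(1)] that(2) P.f_zero to_field_eq_iff[of p 0] by (auto simp: char_eval_mon)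
  show "f \<in> char_dom H (exp_char \<tau>1 l1 u1)" if "f \<in> char_dom H mon"
    using c(4) that by blast
  show "char_ext H (exp_char \<tau> l u) (char_ext H (exp_char \<tau>1 l1 u1) f) = f" if "f \<in> char_dom H mon"
    using c(6)[OF that] char_ext_mon[OF E.sub that] by simp
qed

section \<open>Base change of lattices, matrices and forms under one mutation\<close>

section \<open>Seeds and the linear part of a mutation\<close>

definition vec :: "('i::finite \<Rightarrow> 'b::comm_monoid_add) \<Rightarrow> 'i \<Rightarrow>\<^sub>0 'b" where
  "vec g = (\<Sum>i\<in>UNIV. Poly_Mapping.single i (g i))"

lemma lookup_vec [simp]: "Poly_Mapping.lookup (vec g) i = g i"
  by (simp add: vec_def lookup_sum lookup_single when_def)

lemma lookup_basis_e [simp]: "Poly_Mapping.lookup (basis_e i) j = (if i = j then 1 else 0)"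
  by (simp add: basis_e_def lookup_single when_def)

lemma lookup_basis_f [simp]: "Poly_Mapping.lookup (basis_f i) j = (if i = j then 1 else 0)"
  by (simp add: basis_f_def lookup_single when_def)

lemma lookup_pstar [simp]:
  "Poly_Mapping.lookup (pstar B n) i = (\<Sum>j\<in>UNIV. of_int (Poly_Mapping.lookup n j * B i j))"
  by (simp add: pstar_def lookup_sum lookup_single when_def)

lemma lookup_pstar_basis [simp]: "Poly_Mapping.lookup (pstar B (basis_e k)) i = of_int (B i k)"
proof -
  have "Poly_Mapping.lookup (pstar B (basis_e k)) i = (\<Sum>j\<in>UNIV. if k = j then of_int (B i j) else 0)"
    unfolding lookup_pstar by (rule sum.cong) auto
  then show ?thesis
    by simp
qed

lemma pos_part_0 [simp]: "pos_part 0 = 0"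
  by (simp add: pos_part_def)

lemma pos_part_uminus: "pos_part (- x) = pos_part x - x"
  by (simp add: pos_part_def)

lemma pos_part_mult: "d > 0 \<Longrightarrow> pos_part x * d = pos_part (x * d)"
  by (auto simp: pos_part_def max_def mult_le_0_iff zero_le_mult_iff)

lemma is_seed_iff:
  assumes "\<forall>i. d i > 0"
  shows "is_seed d B \<longleftrightarrow> (\<forall>i j. B i j * d j = - (B j i * d i))"
proof -
  have "(1 / of_int (d i) * of_int (B i j) = - (1 / of_int (d j) * of_int (B j i) :: rat)) \<longleftrightarrow>
     B i j * d j = - (B j i * d i)" for i j
  proof -
    have "(of_int (d i) :: rat) \<noteq> 0" "(of_int (d j) :: rat) \<noteq> 0"
      using assms by (metis less_irrefl of_int_eq_0_iff)+
    then have "(1 / of_int (d i) * of_int (B i j) = - (1 / of_int (d j) * of_int (B j i) :: rat)) \<longleftrightarrow>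
       (of_int (B i j * d j) :: rat) = of_int (- (B j i * d i))"
      by (simp add: field_simps)
    then show ?thesis
      by (simp only: of_int_eq_iff)
  qed
  then show ?thesis
    by (simp add: is_seed_def)
qed

lemma mut_mut [simp]: "mut k (mut k B) = B"
proof (intro ext)
  fix i j
  show "mut k (mut k B) i j = B i j"
    by (simp add: mut_def pos_part_uminus algebra_simps)
qed

context
  fixes d :: "'i::finite \<Rightarrow> int"
  assumes d_pos: "\<forall>i. d i > 0"
begin

lemma seed_skew: "is_seed d B \<Longrightarrow> B i j * d j = - (B j i * d i)"
  using is_seed_iff[OF d_pos] by blast

lemma seed_diag: "is_seed d B \<Longrightarrow> B k k = 0"
  using seed_skew[of B k k] d_pos by (metis less_irrefl mult_eq_0_iff equal_neg_zero)

text \<open>Positive scaling commutes with positive parts, so skew-symmetrizability exchanges the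
  two signs under transposition. This is what makes \<open>tauM\<close> and \<open>tauN\<close> dual
  to each other.\<close>

lemma seed_pos_part: "is_seed d B \<Longrightarrow> pos_part (- B i k) * d k = pos_part (B k i) * d i"
  using seed_skew[of B i k] d_pos by (simp add: pos_part_mult)

lemma is_seed_mut:
  assumes "is_seed d B"
  shows "is_seed d (mut k B)"
  unfolding is_seed_iff[OF d_pos]
proof (intro allI)
  fix i j
  note s = seed_skew[OF assms] and p = seed_pos_part[OF assms]
  show "mut k B i j * d j = - (mut k B j i * d i)"
  proof (cases "i = k \<or> j = k")
    case True
    then show ?thesis
      using s[of i j] by (auto simp: mut_def)
  next
    case False
    have "mut k B i j * d j =
        B i j * d j + B i k * (pos_part (B k j) * d j) + pos_part (- B i k) * (B k j * d j)"
      using False by (simp add: mut_def algebra_simps)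
    \<comment> \<open>Transposition exchanges the two correction terms of the mutation rule: each
      becomes the other one of entry \<open>j i\<close>, up to the common sign and factor
      \<open>d i\<close>.\<close>
    also have "\<dots> = - (B j i * d i) + (B i k * d k) * pos_part (- B j k)
        - (pos_part (- B i k) * d k) * B j k"
      by (simp add: s[of i j] s[of k j] p[of j, symmetric])
    also have "\<dots> = - (B j i * d i) - (B k i * d i) * pos_part (- B j k)
        - (pos_part (B k i) * d i) * B j k"
      by (simp add: s[of i k] p[of i])
    also have "\<dots> = - (mut k B j i * d i)"
      using False by (simp add: mut_def algebra_simps)
    finally show ?thesis .
  qed
qed

end

text \<open>Coordinate change from the basis of \<open>mut k B\<close> to that of \<open>B\<close>:
  \<open>e\<^sub>k\<close> goes to its negative, and \<open>e\<^sub>i\<close> gains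
  \<open>pos_part (B k i)\<close> times \<open>e\<^sub>k\<close>. \<open>tauM\<close> is the
  matching change for the vectors \<open>f\<^sub>i\<close>, where only \<open>f\<^sub>k\<close>
  moves.\<close>

definition tauN :: "'i::finite seed \<Rightarrow> 'i \<Rightarrow> 'i latN \<Rightarrow> 'i latN" where
  "tauN B k n = vec (\<lambda>i. if i = k
     then - Poly_Mapping.lookup n k + (\<Sum>j\<in>UNIV. pos_part (B k j) * Poly_Mapping.lookup n j)
     else Poly_Mapping.lookup n i)"

definition tauM :: "'i::finite seed \<Rightarrow> 'i \<Rightarrow> 'i latM \<Rightarrow> 'i latM" where
  "tauM B k m = vec (\<lambda>i. if i = k then - Poly_Mapping.lookup m k
     else Poly_Mapping.lookup m i + of_int (pos_part (- B i k)) * Poly_Mapping.lookup m k)"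

definition degX :: "'i::finite seed \<Rightarrow> 'i \<Rightarrow> 'i latN \<Rightarrow> int" where
  "degX B k n = - (\<Sum>j\<in>UNIV. B k j * Poly_Mapping.lookup n j)"

definition degA :: "'i \<Rightarrow> 'i latM \<Rightarrow> int" where
  "degA k m = \<lfloor>Poly_Mapping.lookup m k\<rfloor>"

lemma tauN_add: "tauN B k (m + n) = tauN B k m + tauN B k n"
  by (rule poly_mapping_eqI) (simp add: tauN_def lookup_add ring_distribs sum.distrib)

lemma tauM_add: "tauM B k (m + n) = tauM B k m + tauM B k n"
  by (rule poly_mapping_eqI) (simp add: tauM_def lookup_add ring_distribs)

lemma degX_add: "degX B k (m + n) = degX B k m + degX B k n"
  by (simp add: degX_def lookup_add ring_distribs sum.distrib)

lemma sum_zero_at: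
  fixes g h :: "'i::finite \<Rightarrow> 'b::comm_ring_1"
  assumes "c k = 0"
  shows "(\<Sum>j\<in>UNIV. c j * (if j = k then x else h j)) = (\<Sum>j\<in>UNIV. c j * h j)"
  by (rule sum.cong) (use assms in auto)

lemma sum_mult_delta:
  fixes c :: "'i::finite \<Rightarrow> 'b::comm_ring_1"
  shows "(\<Sum>j\<in>UNIV. c j * (if i = j then 1 else 0)) = c i"
proof -
  have "(\<Sum>j\<in>UNIV. c j * (if i = j then 1 else 0)) = (\<Sum>j\<in>UNIV. if i = j then c j else 0)"
    by (rule sum.cong) auto
  then show ?thesis
    by simp
qed

lemma degX_tauN: "B' k k = 0 \<Longrightarrow> degX B' k (tauN B k n) = degX B' k n"
  by (simp add: degX_def tauN_def sum_zero_at)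

text \<open>The same matrix \<open>B\<close> occurs twice. The mutation back from
  \<open>mut k B\<close> uses the other matrix, and then the composite is a transvection.\<close>

lemma tauN_tauN [simp]: "B k k = 0 \<Longrightarrow> tauN B k (tauN B k n) = n"
  by (rule poly_mapping_eqI) (simp add: tauN_def sum_zero_at)

lemma tauM_tauM [simp]: "tauM B k (tauM B k m) = m"
  by (rule poly_mapping_eqI) (simp add: tauM_def)

lemma tauN_basis_same: "B k k = 0 \<Longrightarrow> tauN B k (basis_e k) = - basis_e k"
  by (rule poly_mapping_eqI) (simp add: tauN_def sum_mult_delta)

lemma tauN_basis: "i \<noteq> k \<Longrightarrow>
   tauN B k (basis_e i) = basis_e i + Poly_Mapping.single k (pos_part (B k i))"
  by (rule poly_mapping_eqI)
    (simp add: tauN_def sum_mult_delta lookup_add lookup_single when_def)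

lemma pstar_add: "pstar B (m + n) = pstar B m + pstar B n"
  by (rule poly_mapping_eqI) (simp add: lookup_add ring_distribs sum.distrib)

text \<open>The matrix mutation rule is precisely the base change of the linear map
  \<open>pstar\<close> under \<open>tauN\<close> and \<open>tauM\<close>. Coordinate
  \<open>k\<close> is split off in all sums, since the base changes treat it separately.\<close>

lemma pstar_tau:
  fixes B :: "'i::finite seed"
  assumes kk: "B k k = 0"
  shows "pstar B (tauN B k n) = tauM B k (pstar (mut k B) n)"
proof (rule poly_mapping_eqI)
  fix i
  let ?n = "Poly_Mapping.lookup n"
  have split: "sum g UNIV = g k + sum g (UNIV - {k})" for g :: "'i \<Rightarrow> int"
    by (rule sum.remove) auto
  have split': "sum g UNIV = g k + sum g (UNIV - {k})" for g :: "'i \<Rightarrow> rat"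
    by (rule sum.remove) auto
  have L: "Poly_Mapping.lookup (pstar B (tauN B k n)) i =
      of_int (- ?n k * B i k + (\<Sum>j\<in>UNIV - {k}. pos_part (B k j) * ?n j) * B i k
        + (\<Sum>j\<in>UNIV - {k}. ?n j * B i j))"
    by (simp add: tauN_def split' split kk ring_distribs)
  have mutk: "Poly_Mapping.lookup (pstar (mut k B) n) k = of_int (- (\<Sum>j\<in>UNIV - {k}. ?n j * B k j))"
    by (simp add: mut_def split' kk sum_negf)
  show "Poly_Mapping.lookup (pstar B (tauN B k n)) i =
      Poly_Mapping.lookup (tauM B k (pstar (mut k B) n)) i"
  proof (cases "i = k")
    case True
    then show ?thesis
      unfolding L using mutk by (simp add: tauM_def kk)
  next
    case False
    have "Poly_Mapping.lookup (pstar (mut k B) n) i = of_int (- ?n k * B i k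
       + (\<Sum>j\<in>UNIV - {k}. ?n j * (B i j + B i k * pos_part (B k j) + pos_part (- B i k) * B k j)))"
      using False by (simp add: split' mut_def)
    also have "(\<Sum>j\<in>UNIV - {k}. ?n j * (B i j + B i k * pos_part (B k j) + pos_part (- B i k) * B k j))
      = (\<Sum>j\<in>UNIV - {k}. ?n j * B i j) + (\<Sum>j\<in>UNIV - {k}. pos_part (B k j) * ?n j) * B i k
        + pos_part (- B i k) * (\<Sum>j\<in>UNIV - {k}. ?n j * B k j)"
      by (simp add: ring_distribs sum.distrib sum_distrib_left sum_distrib_right mult_ac)
    finally have "Poly_Mapping.lookup (tauM B k (pstar (mut k B) n)) i =
      of_int (- ?n k * B i k + ((\<Sum>j\<in>UNIV - {k}. ?n j * B i j)
        + (\<Sum>j\<in>UNIV - {k}. pos_part (B k j) * ?n j) * B i k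
        + pos_part (- B i k) * (\<Sum>j\<in>UNIV - {k}. ?n j * B k j)))
        + of_int (pos_part (- B i k)) * of_int (- (\<Sum>j\<in>UNIV - {k}. ?n j * B k j))"
      using False mutk by (simp add: tauM_def)
    then show ?thesis
      unfolding L by (simp only: of_int_add of_int_mult of_int_minus)
  qed
qed

lemma omega_eq_pairing: "omega d B n n' = pairing d (pstar B n) n'"
proof -
  have "pairing d (pstar B n) n' = (\<Sum>j\<in>UNIV. \<Sum>i\<in>UNIV.
     of_int (Poly_Mapping.lookup n i * Poly_Mapping.lookup n' j) * (1 / of_int (d j) * of_int (B j i)))"
    by (simp add: pairing_def sum_distrib_left sum_distrib_right sum_divide_distrib mult_ac)
  then show ?thesis
    unfolding omega_def by (subst sum.swap) simp
qed

context
  fixes d :: "'i::finite \<Rightarrow> int"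
  assumes d_pos: "\<forall>i. d i > 0"
begin

text \<open>The multiple of \<open>f\<^sub>k\<close> that \<open>tauM\<close> spreads over the other
  coordinates cancels what \<open>tauN\<close> collects into coordinate \<open>k\<close>;
  \<open>seed_pos_part\<close> equates the two sums.\<close>

lemma pairing_tau:
  assumes "is_seed d B"
  shows "pairing d (tauM B k m) (tauN B k n) = pairing d m n"
proof -
  let ?n = "Poly_Mapping.lookup n" and ?m = "Poly_Mapping.lookup m"
  have split: "sum g UNIV = g k + sum g (UNIV - {k})" for g :: "'i \<Rightarrow> rat"
    by (rule sum.remove) auto
  have split': "sum g UNIV = g k + sum g (UNIV - {k})" for g :: "'i \<Rightarrow> int"
    by (rule sum.remove) auto
  have dz: "(of_int (d i) :: rat) \<noteq> 0" for i
    using d_pos by (metis less_irrefl of_int_eq_0_iff)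
  have pp: "(of_int (pos_part (- B i k)) / of_int (d i) :: rat) = of_int (pos_part (B k i)) / of_int (d k)" for i
  proof -
    have "(of_int (pos_part (- B i k)) * of_int (d k) :: rat) = of_int (pos_part (B k i)) * of_int (d i)"
      using seed_pos_part[OF d_pos assms, of i k] by (metis of_int_mult)
    then show ?thesis
      using dz by (simp add: field_simps)
  qed
  have "pairing d (tauM B k m) (tauN B k n) =
      - ?m k * (- of_int (?n k) + (\<Sum>j\<in>UNIV - {k}. of_int (pos_part (B k j)) * of_int (?n j))) / of_int (d k)
      + (\<Sum>i\<in>UNIV - {k}. (?m i + of_int (pos_part (- B i k)) * ?m k) * of_int (?n i) / of_int (d i))"
    by (simp add: pairing_def tauM_def tauN_def split split' seed_diag[OF d_pos assms])
  also have "(\<Sum>i\<in>UNIV - {k}. (?m i + of_int (pos_part (- B i k)) * ?m k) * of_int (?n i) / of_int (d i))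
     = (\<Sum>i\<in>UNIV - {k}. ?m i * of_int (?n i) / of_int (d i))
       + (\<Sum>i\<in>UNIV - {k}. ?m k * of_int (?n i) * (of_int (pos_part (- B i k)) / of_int (d i)))"
    by (simp add: ring_distribs add_divide_distrib sum.distrib mult_ac)
  also have "(\<Sum>i\<in>UNIV - {k}. ?m k * of_int (?n i) * (of_int (pos_part (- B i k)) / of_int (d i)))
     = ?m k * (\<Sum>j\<in>UNIV - {k}. of_int (pos_part (B k j)) * of_int (?n j)) / of_int (d k)"
    by (simp only: pp) (simp add: sum_distrib_left sum_divide_distrib mult_ac)
  finally show ?thesis
    by (simp add: pairing_def split algebra_simps add_divide_distrib diff_divide_distrib)
qed

text \<open>So \<open>tauN\<close> is an isometry from the form of \<open>mut k B\<close> to that of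
  \<open>B\<close>; this is why conjugating with it produces variation maps again.\<close>

lemma omega_tau: "is_seed d B \<Longrightarrow> omega d (mut k B) n n' = omega d B (tauN B k n) (tauN B k n')"
  by (simp add: omega_eq_pairing pstar_tau[OF seed_diag[OF d_pos]] pairing_tau)

end

section \<open>The substitution formulas of mutation rewritten as characters\<close>

section \<open>Mutations as character extensions\<close>

lemma (in lattice_char) char_sum:
  assumes "\<And>i. i \<in> A \<Longrightarrow> g i \<in> H"
  shows "\<chi> (sum g A) = (\<Prod>i\<in>A. \<chi> (g i))" and "sum g A \<in> H"
proof -
  have "\<chi> (sum g A) = (\<Prod>i\<in>A. \<chi> (g i)) \<and> sum g A \<in> H"
    using assms
    by (induction A rule: infinite_finite_induct)
      (auto simp: char_0 subgrp_zero[OF subgrp] char_add subgrp_add[OF subgrp])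
  then show "\<chi> (sum g A) = (\<Prod>i\<in>A. \<chi> (g i))" and "sum g A \<in> H"
    by auto
qed

text \<open>The homomorphism \<open>g\<close> from the integers plays the role of the multiples of
  \<open>g 1\<close>, which lets the power law be used in an abstract exponent group.\<close>

lemma (in lattice_char) char_powi:
  assumes add: "\<And>a b. g (a + b) = g a + g b" and H: "\<And>a. g a \<in> H"
  shows "\<chi> (g (c :: int)) = \<chi> (g 1) powi c"
proof (induction c rule: int_induct[where k = 0])
  case base
  have "g 0 = 0"
    using add[of 0 0] by (metis add_0 add_cancel_right_right)
  then show ?case
    by (simp add: char_0)
next
  case (step1 c)
  then show ?case
    by (simp add: add char_add H power_int_add char_nonzero)
next
  case (step2 c)
  have "\<chi> (g c) = \<chi> (g (c - 1)) * \<chi> (g 1)"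
    using add[of "c - 1" 1] by (simp add: char_add H)
  with step2 show ?case
    by (simp add: power_int_diff char_nonzero H field_simps)
qed

lemmas mon_lattice = lattice_char_mon[OF subgrp_UNIV]

lemma mon_sum: "mon (sum g A) = (\<Prod>i\<in>A. mon (g i))"
  by (rule lattice_char.char_sum(1)[OF mon_lattice]) simp

lemma mon_powi: "(\<And>a b. g (a + b) = g a + g b) \<Longrightarrow> mon (g (c :: int)) = mon (g 1) powi c"
  by (rule lattice_char.char_powi[OF mon_lattice]) auto

lemma mon_diff: "mon (m - n) = mon m / mon n"
  using mon_add[of m "- n"] by (simp add: mon_uminus divide_inverse)

lemma Xvar_eq_mon: "Xvar i = mon (basis_e i)"
  by (simp add: Xvar_def mon_def)

lemma Avar_eq_mon: "Avar i = mon (basis_f i)"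
  by (simp add: Avar_def mon_def)

text \<open>The Fock-Goncharov splitting of a mutation into a linear change of exponents and a power
  of a binomial. The binomial is \<open>1 + X\<^sub>k\<close> on one side and its image under
  \<open>pstar_alg\<close> on the other.\<close>

abbreviation charX :: "'i::{finite,linorder} seed \<Rightarrow> 'i \<Rightarrow> 'i latN \<Rightarrow> 'i fieldX" where
  "charX B k \<equiv> exp_char (tauN B k) (degX B k) (basis_e k)"

abbreviation charA :: "'i::{finite,linorder} seed \<Rightarrow> 'i \<Rightarrow> 'i latM \<Rightarrow> 'i fieldA" where
  "charA B k \<equiv> exp_char (tauM B k) (degA k) (pstar B (basis_e k))"

definition int_exp :: "'i set \<Rightarrow> 'i latM set" where
  "int_exp J = {m. \<forall>i\<in>J. Poly_Mapping.lookup m i \<in> \<int>}"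

lemma poly_A_ZQ_eq: "poly_A_ZQ J = group_ring_on (int_exp J)"
  by (auto simp: poly_A_ZQ_def group_ring_on_def int_exp_def)

lemma LP_A_eq: "LP_A = to_field ` group_ring_on (int_exp UNIV)"
  by (auto simp: LP_A_def group_ring_on_def int_exp_def subset_eq intro!: arg_cong[where f = "image to_field"])

lemma subgrp_int_exp: "subgrp (int_exp J)"
  by (auto simp: subgrp_def int_exp_def lookup_minus)

lemma int_exp_mono: "J \<subseteq> J' \<Longrightarrow> int_exp J' \<subseteq> int_exp J"
  by (auto simp: int_exp_def)

lemma pstar_in_int_exp: "pstar B n \<in> int_exp J"
  by (auto simp: int_exp_def)

lemma exp_data_X: "exp_data UNIV UNIV (tauN B k) (degX B k) (basis_e k)"
  by unfold_locales (auto simp: subgrp_UNIV tauN_add degX_add)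

lemma exp_data_A:
  assumes "k \<in> J"
  shows "exp_data (int_exp J) (int_exp J) (tauM B k) (degA k) (pstar B (basis_e k))"
proof
  fix m n assume "m \<in> int_exp J" "n \<in> int_exp J"
  then have "Poly_Mapping.lookup m k \<in> \<int>" "Poly_Mapping.lookup n k \<in> \<int>"
    using assms by (auto simp: int_exp_def)
  then show "degA k (m + n) = degA k m + degA k n"
    by (auto simp: degA_def lookup_add elim!: Ints_cases simp flip: of_int_add)
next
  show "tauM B k m \<in> int_exp J" if "m \<in> int_exp J" for m
    using that assms by (auto simp: int_exp_def tauM_def)
qed (auto simp: subgrp_int_exp tauM_add pstar_in_int_exp)

lemma mut_X_gen_eq:
  assumes "B k k = 0"
  shows "mut_X_gen B k i = charX B k (basis_e i)"
proof (cases "i = k")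
  case True
  then show ?thesis
    using assms by (simp add: mut_X_gen_def exp_char_def tauN_basis_same degX_def sum_mult_delta
        Xvar_eq_mon mon_uminus)
next
  case False
  have "mon (Poly_Mapping.single k (pos_part (B k i))) = (mon (basis_e k) :: 'a fieldX) powi pos_part (B k i)"
    unfolding basis_e_def by (rule mon_powi) (simp add: single_add)
  then show ?thesis
    using False by (simp add: mut_X_gen_def exp_char_def tauN_basis degX_def sum_mult_delta
        Xvar_eq_mon mon_add)
qed

text \<open>Substituting for the variables is evaluating a character, and a character of the lattice
  is determined by its values on the basis.\<close>

lemma mut_X_eq:
  assumes "B k k = 0"
  shows "mut_X B k = char_ext UNIV (charX B k)"
proof -
  interpret lattice_char UNIV "charX B k"
    by (rule exp_data.lattice_char[OF exp_data_X])
  have single: "charX B k (Poly_Mapping.single i c) = charX B k (basis_e i) powi c" for i c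
    using char_powi[of "Poly_Mapping.single i" c] by (simp add: single_add basis_e_def)
  have "charX B k n = (\<Prod>i\<in>UNIV. mut_X_gen B k i powi Poly_Mapping.lookup n i)" for n
  proof -
    have "n = (\<Sum>i\<in>UNIV. Poly_Mapping.single i (Poly_Mapping.lookup n i))"
      by (rule poly_mapping_eqI) (simp add: lookup_sum lookup_single when_def)
    then have "charX B k n = (\<Prod>i\<in>UNIV. charX B k (Poly_Mapping.single i (Poly_Mapping.lookup n i)))"
      using char_sum(1)[of UNIV "\<lambda>i. Poly_Mapping.single i (Poly_Mapping.lookup n i)"] by simp
    also have "\<dots> = (\<Prod>i\<in>UNIV. charX B k (basis_e i) powi Poly_Mapping.lookup n i)"
      by (simp only: single)
    finally show ?thesis
      by (simp add: mut_X_gen_eq[of B k, OF assms])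
  qed
  then have "subst_X (mut_X_gen B k) = char_eval (charX B k)"
    by (intro ext) (simp add: subst_X_def char_eval_def)
  then show ?thesis
    by (simp add: mut_X_def)
qed

text \<open>In the exchange relation the first monomial is factored out; as the positive parts of
  \<open>x\<close> and \<open>- x\<close> differ by \<open>x\<close>, what remains is one plus the
  monomial with exponent \<open>pstar B (basis_e k)\<close>.\<close>

lemma mut_A_gen_eq:
  assumes "B k k = 0"
  shows "mut_A_gen B k i = charA B k (basis_f i)"
proof (cases "i = k")
  case False
  have "tauM B k (basis_f i) = basis_f i"
    using False by (intro poly_mapping_eqI) (simp add: tauM_def)
  then show ?thesis
    using False by (simp add: mut_A_gen_def exp_char_def degA_def Avar_eq_mon)
next
  case True
  define v :: "('a \<Rightarrow> int) \<Rightarrow> 'a latM"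
    where "v c = (\<Sum>j\<in>UNIV. Poly_Mapping.single j (of_int (c j)))" for c
  have lv: "Poly_Mapping.lookup (v c) j = of_int (c j)" for c j
    by (simp add: v_def lookup_sum lookup_single when_def)
  have "mon (Poly_Mapping.single j (of_int c)) = (mon (basis_f j) :: 'a fieldA) powi c" for j c
    unfolding basis_f_def
    using mon_powi[of "\<lambda>c. Poly_Mapping.single j (of_int c :: rat)" c] by (simp add: single_add)
  then have v: "(\<Prod>j\<in>UNIV. mon (basis_f j) powi c j) = mon (v c)" for c
    by (simp add: v_def mon_sum)
  have t: "tauM B k (basis_f k) = v (\<lambda>j. pos_part (- B j k)) - basis_f k"
    using assms by (intro poly_mapping_eqI) (simp add: tauM_def lookup_minus lv)
  have w: "v (\<lambda>j. pos_part (B j k)) = v (\<lambda>j. pos_part (- B j k)) + pstar B (basis_e k)"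
    by (intro poly_mapping_eqI) (simp add: lookup_add lv pos_part_uminus del: lookup_pstar)
  show ?thesis
    using True by (simp add: mut_A_gen_def v exp_char_def degA_def t w mon_add mon_diff Avar_eq_mon
        del: lookup_pstar) (simp add: field_simps)
qed

lemma mut_A_eq:
  assumes "B k k = 0" "k \<in> J"
  shows "mut_A J B k = char_ext (int_exp J) (charA B k)"
proof -
  interpret lattice_char "int_exp J" "charA B k"
    by (rule exp_data.lattice_char[OF exp_data_A[OF assms(2)]])
  let ?z = "\<lambda>m :: 'a latM. \<Sum>j\<in>- J. Poly_Mapping.single j (Poly_Mapping.lookup m j)"
  have lz: "Poly_Mapping.lookup (?z m) i = (if i \<in> J then 0 else Poly_Mapping.lookup m i)" for m i
    by (simp add: lookup_sum lookup_single when_def sum.delta')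
  have *: "charA B k m = (\<Prod>i\<in>J. mut_A_gen B k i powi \<lfloor>Poly_Mapping.lookup m i\<rfloor>) * mon (?z m)"
    if m: "m \<in> int_exp J" for m
  proof -
    let ?g = "\<lambda>i. Poly_Mapping.single i (of_int \<lfloor>Poly_Mapping.lookup m i\<rfloor> :: rat)"
    have int: "of_int \<lfloor>Poly_Mapping.lookup m i\<rfloor> = Poly_Mapping.lookup m i" if "i \<in> J" for i
      using that m by (auto simp: int_exp_def)
    have single_in: "Poly_Mapping.single i (of_int c :: rat) \<in> int_exp J" for i c
      by (simp add: int_exp_def lookup_single when_def)
    have m_eq: "m = sum ?g J + ?z m"
      by (rule poly_mapping_eqI)
        (simp add: lookup_add lz, simp add: lookup_sum lookup_single when_def sum.delta' int)
    have z_in: "?z m \<in> int_exp J"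
      by (simp add: int_exp_def lz)
    have z: "charA B k (?z m) = mon (?z m)"
    proof -
      have "tauM B k (?z m) = ?z m"
        using assms(2) by (intro poly_mapping_eqI) (simp add: tauM_def lz)
      then show ?thesis
        using assms(2) by (simp add: exp_char_def degA_def lz)
    qed
    have "charA B k m = charA B k (sum ?g J) * charA B k (?z m)"
      by (subst m_eq, rule char_add) (auto intro!: char_sum(2) single_in z_in)
    also have "charA B k (sum ?g J) = (\<Prod>i\<in>J. charA B k (?g i))"
      by (rule char_sum) (rule single_in)
    also have "\<dots> = (\<Prod>i\<in>J. charA B k (basis_f i) powi \<lfloor>Poly_Mapping.lookup m i\<rfloor>)"
    proof (rule prod.cong[OF refl])
      fix i
      show "charA B k (?g i) = charA B k (basis_f i) powi \<lfloor>Poly_Mapping.lookup m i\<rfloor>"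
        using char_powi[of "\<lambda>c. Poly_Mapping.single i (of_int c)" "\<lfloor>Poly_Mapping.lookup m i\<rfloor>"]
        by (simp add: single_in single_add basis_f_def)
    qed
    finally show ?thesis
      by (simp add: mut_A_gen_eq[of B k, OF assms(1)] z)
  qed
  have "subst_A J (mut_A_gen B k) p = char_eval (charA B k) p" if "p \<in> group_ring_on (int_exp J)" for p
    unfolding subst_A_def char_eval_def
    by (rule sum.cong) (use that * in \<open>auto simp: group_ring_on_def mult.assoc mon_def\<close>)
  then show ?thesis
    unfolding mut_A_def poly_A_ZQ_eq by (rule frac_ext_cong)
qed

lemma charX_inverse:
  fixes B :: "'i::{finite,linorder} seed"
  assumes "B k k = 0"
  shows "p \<noteq> 0 \<Longrightarrow> char_eval (charX (mut k B) k) p \<noteq> 0"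
    and "f \<in> char_dom UNIV (charX (mut k B) k)"
    and "char_ext UNIV (charX B k) (char_ext UNIV (charX (mut k B) k) f) = f"
proof -
  \<comment> \<open>Row \<open>k\<close> changes sign under mutation, so the two involutions use
    opposite positive parts; their difference is the full entry, which yields the transvection along
    \<open>e\<^sub>k\<close>.\<close>
  have "tauN B k (tauN (mut k B) k n) = n + Poly_Mapping.single k (degX (mut k B) k n)" for n
    by (rule poly_mapping_eqI)
      (auto simp: tauN_def sum_zero_at assms lookup_add lookup_single when_def degX_def mut_def
        pos_part_uminus left_diff_distrib sum_subtractf sum_negf)
  moreover have "mon (Poly_Mapping.single k c) = (mon (basis_e k) :: 'i fieldX) powi c" for c
    unfolding basis_e_def by (rule mon_powi) (simp add: single_add)
  ultimately have "mon (tauN B k (tauN (mut k B) k n)) = mon n * mon (basis_e k) powi degX (mut k B) k n" for n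
    by (simp add: mon_add)
  moreover have "degX B k (tauN (mut k B) k n) = - degX (mut k B) k n" for n
    by (subst degX_tauN) (simp_all add: assms, simp add: degX_def mut_def sum_negf)
  moreover have "degX B k (basis_e k) = 0"
    by (simp add: degX_def sum_mult_delta assms)
  ultimately have "mon (tauN B k (tauN (mut k B) k n)) = mon n * mon (basis_e k) powi degX (mut k B) k n"
    "degX B k (tauN (mut k B) k n) = - degX (mut k B) k n" "degX B k (basis_e k) = 0" for n
    by blast+
  note * = char_ext_inverse[OF exp_data_X exp_data_X tauN_basis_same[of B k, OF assms] this(3) this(1,2)]
  show "p \<noteq> 0 \<Longrightarrow> char_eval (charX (mut k B) k) p \<noteq> 0"
    and "f \<in> char_dom UNIV (charX (mut k B) k)"
    and "char_ext UNIV (charX B k) (char_ext UNIV (charX (mut k B) k) f) = f"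
    using * by simp_all
qed

lemma charA_inverse:
  fixes B :: "'i::{finite,linorder} seed"
  assumes kk: "B k k = 0" and k: "k \<in> J"
  shows "p \<in> group_ring_on (int_exp J) \<Longrightarrow> p \<noteq> 0 \<Longrightarrow> char_eval (charA (mut k B) k) p \<noteq> 0"
    and "f \<in> char_dom (int_exp J) mon \<Longrightarrow> f \<in> char_dom (int_exp J) (charA (mut k B) k)"
    and "f \<in> char_dom (int_exp J) mon \<Longrightarrow>
      char_ext (int_exp J) (charA B k) (char_ext (int_exp J) (charA (mut k B) k) f) = f"
proof -
  let ?u = "pstar B (basis_e k)" and ?u1 = "pstar (mut k B) (basis_e k)"
  \<comment> \<open>The one-parameter subgroup through \<open>?u\<close>, so that the power of
    \<open>mon ?u\<close> becomes a monomial.\<close>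
  define v :: "int \<Rightarrow> 'i latM" where "v c = vec (\<lambda>i. of_int (c * B i k))" for c
  have "v (a + b) = v a + v b" for a b
    by (rule poly_mapping_eqI) (simp add: v_def lookup_add ring_distribs)
  then have v: "mon (v c) = mon (v 1) powi c" for c
    by (rule mon_powi)
  have v1: "v 1 = ?u"
    by (rule poly_mapping_eqI) (simp add: v_def del: lookup_pstar)
  have 1: "mon (tauM B k (tauM (mut k B) k m)) = mon m * mon ?u powi degA k m" if "m \<in> int_exp J" for m
  proof -
    have "of_int (degA k m) = Poly_Mapping.lookup m k"
      using that k by (auto simp: int_exp_def degA_def)
    then have "tauM B k (tauM (mut k B) k m) = m + v (degA k m)"
      by (intro poly_mapping_eqI)
        (simp add: tauM_def v_def mut_def lookup_add pos_part_uminus algebra_simps kk)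
    then show ?thesis
      by (simp add: mon_add v[of "degA k m"] v1)
  qed
  have 2: "degA k (tauM (mut k B) k m) = - degA k m" if "m \<in> int_exp J" for m
  proof -
    have "Poly_Mapping.lookup m k \<in> \<int>"
      using that k by (auto simp: int_exp_def)
    then show ?thesis
      by (auto simp: degA_def tauM_def elim!: Ints_cases simp flip: of_int_minus)
  qed
  \<comment> \<open>The vector \<open>?u1\<close> is the negative of \<open>?u\<close>, and its
    coordinate \<open>k\<close> is a diagonal entry, hence zero; \<open>tauM\<close> fixes such
    vectors.\<close>
  have 3: "tauM B k ?u1 = - ?u"
    by (rule poly_mapping_eqI) (simp add: tauM_def mut_def kk del: lookup_pstar)
  have 4: "degA k ?u1 = 0"
    by (simp add: degA_def mut_def kk del: lookup_pstar)
  show "p \<in> group_ring_on (int_exp J) \<Longrightarrow> p \<noteq> 0 \<Longrightarrow> char_eval (charA (mut k B) k) p \<noteq> 0"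
    and "f \<in> char_dom (int_exp J) mon \<Longrightarrow> f \<in> char_dom (int_exp J) (charA (mut k B) k)"
    and "f \<in> char_dom (int_exp J) mon \<Longrightarrow>
      char_ext (int_exp J) (charA B k) (char_ext (int_exp J) (charA (mut k B) k) f) = f"
    using char_ext_inverse[OF exp_data_A[OF k] exp_data_A[OF k] 3 4 1 2] by blast+
qed

section \<open>Composite mutations and their action on upper cluster algebras\<close>

section \<open>Sequences of mutations\<close>

primrec iter_mut :: "('i seed \<Rightarrow> 'i \<Rightarrow> 'f \<Rightarrow> 'f) \<Rightarrow> 'i list \<Rightarrow> 'i seed \<Rightarrow> 'f \<Rightarrow> 'f" where
  "iter_mut mu [] B = id"
| "iter_mut mu (k # ks) B = mu B k \<circ> iter_mut mu ks (mut k B)"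

lemma mut_seq_X_eq_iter: "mut_seq_X ks B = iter_mut mut_X ks B"
  by (induction ks arbitrary: B) auto

lemma mut_seq_A_eq_iter: "mut_seq_A J ks B = iter_mut (mut_A J) ks B"
  by (induction ks arbitrary: B) auto

text \<open>Abstracts what the two sides share. \<open>K_hom\<close> says that \<open>K\<close> is a
  subfield: the whole field on the \<open>X\<close> side, the fractions with integral unfrozen
  exponents on the \<open>A\<close> side.\<close>

locale mutation_system =
  fixes S :: "'i seed set" and J :: "'i set" and K :: "'f::field set"
    and mu :: "'i seed \<Rightarrow> 'i \<Rightarrow> 'f \<Rightarrow> 'f"
  assumes mut_in: "B \<in> S \<Longrightarrow> k \<in> J \<Longrightarrow> mut k B \<in> S"
    and mu_hom: "B \<in> S \<Longrightarrow> k \<in> J \<Longrightarrow> partial_hom K (mu B k)"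
    and mu_in: "B \<in> S \<Longrightarrow> k \<in> J \<Longrightarrow> x \<in> K \<Longrightarrow> mu B k x \<in> K"
    and mu_mu: "B \<in> S \<Longrightarrow> k \<in> J \<Longrightarrow> x \<in> K \<Longrightarrow> mu B k (mu (mut k B) k x) = x"
    and K_hom: "partial_hom K (\<lambda>x. x)"
begin

lemma mut_seq_in: "B \<in> S \<Longrightarrow> ks \<in> lists J \<Longrightarrow> mut_seq ks B \<in> S"
  by (induction ks arbitrary: B) (auto simp: mut_in)

lemma iter_in: "B \<in> S \<Longrightarrow> ks \<in> lists J \<Longrightarrow> x \<in> K \<Longrightarrow> iter_mut mu ks B x \<in> K"
  by (induction ks arbitrary: B) (auto simp: mut_in mu_in)

lemma iter_hom: "B \<in> S \<Longrightarrow> ks \<in> lists J \<Longrightarrow> partial_hom K (iter_mut mu ks B)"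
proof (induction ks arbitrary: B)
  case Nil
  then show ?case
    using K_hom by (simp add: id_def)
next
  case (Cons k ks)
  then have B: "mut k B \<in> S" "ks \<in> lists J" "k \<in> J"
    by (auto simp: mut_in)
  interpret f: partial_hom K "mu B k"
    using Cons.prems B by (intro mu_hom)
  interpret g: partial_hom K "iter_mut mu ks (mut k B)"
    using Cons.IH B by blast
  note * = iter_in[OF B(1,2)]
  show ?case
    by unfold_locales
      (auto simp: f.one_closed g.f_one f.f_one g.add_closed g.f_add f.f_add * g.mult_closed g.f_mult
        f.f_mult g.uminus_closed f.f_zero intro: g.inverse_closed)
qed

lemma iter_inj: "B \<in> S \<Longrightarrow> ks \<in> lists J \<Longrightarrow> inj_on (iter_mut mu ks B) K"
proof (induction ks arbitrary: B)
  case (Cons k ks)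
  then have B: "mut k B \<in> S" "ks \<in> lists J" "k \<in> J"
    by (auto simp: mut_in)
  have "inj_on (mu B k) K"
    using mu_mu[OF B(1,3)] by (intro inj_on_inverseI[of _ "mu (mut k B) k"]) simp
  moreover have "iter_mut mu ks (mut k B) ` K \<subseteq> K"
    using iter_in[OF B(1,2)] by blast
  ultimately have "inj_on (mu B k) (iter_mut mu ks (mut k B) ` K)"
    by (rule inj_on_subset)
  then show ?case
    unfolding iter_mut.simps by (intro comp_inj_on Cons.IH[OF B(1,2)])
qed auto

lemma iter_image: "B \<in> S \<Longrightarrow> ks \<in> lists J \<Longrightarrow> iter_mut mu ks B ` K = K"
proof (induction ks arbitrary: B)
  case (Cons k ks)
  then have B: "mut k B \<in> S" "ks \<in> lists J" "k \<in> J"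
    by (auto simp: mut_in)
  have "mu B k ` K = K"
  proof
    show "K \<subseteq> mu B k ` K"
    proof
      fix x assume x: "x \<in> K"
      then have "x = mu B k (mu (mut k B) k x)"
        using mu_mu Cons.prems B by simp
      then show "x \<in> mu B k ` K"
        using mu_in[OF B(1,3) x] by blast
    qed
  qed (use mu_in Cons.prems B in auto)
  moreover have "iter_mut mu (k # ks) B ` K = mu B k ` (iter_mut mu ks (mut k B) ` K)"
    by (simp add: image_comp)
  ultimately show ?case
    using Cons.IH[OF B(1,2)] by simp
qed simp

definition upper :: "'f set \<Rightarrow> 'i seed \<Rightarrow> 'f set" where
  "upper L B = (\<Inter>ks\<in>lists J. iter_mut mu ks B ` L)"

lemma upper_subset: "upper L B \<subseteq> L"
proof -
  have "iter_mut mu [] B ` L = L"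
    by simp
  then show ?thesis
    unfolding upper_def by (metis INF_lower lists.Nil)
qed

lemma mu_upper:
  assumes "B \<in> S" "k \<in> J" "L \<subseteq> K"
  shows "mu B k ` upper L (mut k B) = upper L B"
proof -
  have *: "mu B k x \<in> upper L B" if B: "B \<in> S" and x: "x \<in> upper L (mut k B)" for B x
    unfolding upper_def
  proof
    fix ks assume ks: "ks \<in> lists J"
    \<comment> \<open>Starting from \<open>mut k B\<close>, the extra first step \<open>k\<close>
      leads back to \<open>B\<close>, so the test for \<open>k # ks\<close> there becomes the test
      for \<open>ks\<close> at \<open>B\<close> once \<open>mu_mu\<close> cancels the
      detour.\<close>
    have "k # ks \<in> lists J"
      using ks assms(2) by simp
    with x have "x \<in> iter_mut mu (k # ks) (mut k B) ` L"
      unfolding upper_def by (rule INT_D)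
    then obtain y where y: "y \<in> L" "x = mu (mut k B) k (iter_mut mu ks B y)"
      by auto
    then have "mu B k x = iter_mut mu ks B y"
      using mu_mu[OF B assms(2)] iter_in[OF B ks] assms(3) by auto
    then show "mu B k x \<in> iter_mut mu ks B ` L"
      using y by blast
  qed
  show ?thesis
  proof
    show "mu B k ` upper L (mut k B) \<subseteq> upper L B"
      using * assms by blast
    show "upper L B \<subseteq> mu B k ` upper L (mut k B)"
    proof
      fix x assume x: "x \<in> upper L B"
      then have "mu (mut k B) k x \<in> upper L (mut k B)"
        using *[of "mut k B" x] mut_in assms by simp
      moreover have "x = mu B k (mu (mut k B) k x)"
        using mu_mu assms upper_subset x by (metis subsetD)
      ultimately show "x \<in> mu B k ` upper L (mut k B)"
        by blast
    qed
  qed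
qed

lemma iter_upper:
  "B \<in> S \<Longrightarrow> ks \<in> lists J \<Longrightarrow> L \<subseteq> K \<Longrightarrow> iter_mut mu ks B ` upper L (mut_seq ks B) = upper L B"
proof (induction ks arbitrary: B)
  case (Cons k ks)
  then have B: "mut k B \<in> S" "ks \<in> lists J" "k \<in> J"
    by (auto simp: mut_in)
  have "iter_mut mu (k # ks) B ` upper L (mut_seq (k # ks) B) =
      mu B k ` (iter_mut mu ks (mut k B) ` upper L (mut_seq ks (mut k B)))"
    by (simp add: image_comp)
  then show ?case
    using Cons.IH[OF B(1,2) Cons.prems(3)] mu_upper Cons.prems B by simp
qed simp

end

lemma char_dom_subset_mon: "char_dom H \<chi> \<subseteq> char_dom H mon"
proof
  fix f assume "f \<in> char_dom H \<chi>"
  then obtain a b where "a \<in> group_ring_on H" "b \<in> group_ring_on H" "char_eval \<chi> b \<noteq> 0"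
    "f = Fraction_Field.Fract a b"
    unfolding char_dom_def by blast
  moreover from this(3) have "b \<noteq> 0"
    by auto
  ultimately show "f \<in> char_dom H mon"
    unfolding char_dom_mon by blast
qed

lemma monomial_in_group_ring: "n \<in> H \<Longrightarrow> monomial n \<in> group_ring_on H"
  by (simp add: monomial_def group_ring_single)

lemma to_field_eq_0_iff: "to_field p = 0 \<longleftrightarrow> p = 0"
  by (metis to_field_eq_iff to_field_zero)

lemma char_dom_mono:
  assumes "H \<subseteq> H'"
  shows "char_dom H \<chi> \<subseteq> char_dom H' \<chi>"
  using group_ring_on_mono[OF assms] unfolding char_dom_def by blast

lemma partial_hom_mon:
  assumes "subgrp H"
  shows "partial_hom (char_dom H mon) (\<lambda>x. x)"
proof -
  interpret partial_hom "char_dom H mon" "char_ext H mon"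
    by (rule lattice_char.partial_hom[OF lattice_char_mon[OF assms]])
  show ?thesis
    by unfold_locales
      (use one_closed add_closed mult_closed uminus_closed inverse_closed in
        \<open>auto simp: char_ext_mon[OF assms]\<close>)
qed

lemma to_field_in_mon: "subgrp H \<Longrightarrow> to_field ` group_ring_on H \<subseteq> char_dom H mon"
  using lattice_char.to_field_in_dom[OF lattice_char_mon] by blast

lemma charX_dom:
  assumes "B k k = 0"
  shows "char_dom UNIV (charX B k) = UNIV"
proof -
  have "mut k B k k = 0"
    using assms by (simp add: mut_def)
  from charX_inverse(2)[of "mut k B", OF this] show ?thesis
    by auto
qed

lemma charX_nonzero:
  assumes "B k k = 0" "p \<noteq> 0"
  shows "char_eval (charX B k) p \<noteq> 0"
proof -
  have "mut k B k k = 0"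
    using assms by (simp add: mut_def)
  from charX_inverse(1)[of "mut k B", OF this assms(2)] show ?thesis
    by simp
qed

lemma charA_nonzero:
  assumes "B k k = 0" "k \<in> J" "p \<in> group_ring_on (int_exp J)" "p \<noteq> 0"
  shows "char_eval (charA B k) p \<noteq> 0"
proof -
  have "mut k B k k = 0"
    using assms by (simp add: mut_def)
  from charA_inverse(1)[of "mut k B", OF this assms(2-4)] show ?thesis
    by simp
qed

lemma charA_dom:
  assumes "B k k = 0" "k \<in> J"
  shows "char_dom (int_exp J) (charA B k) = char_dom (int_exp J) mon"
proof -
  have "mut k B k k = 0"
    using assms by (simp add: mut_def)
  from charA_inverse(2)[of "mut k B", OF this assms(2)] show ?thesis
    using char_dom_subset_mon by auto
qed

lemma mut_A_in:
  assumes "B k k = 0" "k \<in> J" "x \<in> char_dom (int_exp J) mon"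
  shows "mut_A J B k x \<in> char_dom (int_exp J) mon"
  unfolding mut_A_eq[of B k, OF assms(1,2)]
  by (rule exp_data.ext_in[OF exp_data_A[OF assms(2)]]) (simp add: charA_dom assms)

text \<open>The same character can be restricted to the lattice where frozen exponents are integral
  too, and both extensions agree there. This stability is what later allows elements to be split by
  fractional parts.\<close>

lemma mut_A_in_integral:
  assumes "B k k = 0" "k \<in> J" "x \<in> char_dom (int_exp UNIV) mon"
  shows "mut_A J B k x \<in> char_dom (int_exp UNIV) mon"
proof -
  interpret Z: lattice_char "int_exp UNIV" "charA B k"
    by (rule exp_data.lattice_char[OF exp_data_A]) simp
  interpret A: lattice_char "int_exp J" "charA B k"
    by (rule exp_data.lattice_char[OF exp_data_A[OF assms(2)]])
  have x: "x \<in> char_dom (int_exp UNIV) (charA B k)"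
    using assms(1,3) by (simp add: charA_dom)
  then obtain a b where ab: "a \<in> group_ring_on (int_exp UNIV)" "b \<in> group_ring_on (int_exp UNIV)"
    "char_eval (charA B k) b \<noteq> 0" "x = Fraction_Field.Fract a b"
    by (rule Z.domE)
  moreover from ab have "a \<in> group_ring_on (int_exp J)" "b \<in> group_ring_on (int_exp J)"
    using group_ring_on_mono[OF int_exp_mono[of J UNIV]] by auto
  ultimately have "mut_A J B k x = char_ext (int_exp UNIV) (charA B k) x"
    using assms by (simp add: mut_A_eq A.ext_Fract Z.ext_Fract)
  then show ?thesis
    using exp_data.ext_in[OF exp_data_A x] by simp
qed

lemma mut_A_frozen:
  assumes "B k k = 0" "k \<in> J" "z \<in> frozen_M J"
  shows "mut_A J B k (mon z) = mon z"
proof -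
  interpret A: lattice_char "int_exp J" "charA B k"
    by (rule exp_data.lattice_char[OF exp_data_A[OF assms(2)]])
  have k: "Poly_Mapping.lookup z k = 0" and z: "z \<in> int_exp J"
    using assms by (auto simp: frozen_M_def int_exp_def)
  then have "tauM B k z = z" "degA k z = 0"
    by (auto intro!: poly_mapping_eqI simp: tauM_def degA_def)
  moreover have "mut_A J B k (mon z) = charA B k z"
    using assms(1,2) z by (simp add: mut_A_eq mon_def A.ext_to_field group_ring_single monomial_def)
  ultimately show ?thesis
    by (simp add: exp_char_def)
qed

locale cluster =
  fixes J :: "'i::{finite,linorder} set" and d :: "'i \<Rightarrow> int"
  assumes d_pos: "\<forall>i. d i > 0"
begin

abbreviation K :: "'i fieldA set" where
  "K \<equiv> char_dom (int_exp J) mon"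

abbreviation LP_ZQ :: "'i fieldA set" where
  "LP_ZQ \<equiv> to_field ` group_ring_on (int_exp J)"

sublocale X: mutation_system "Collect (is_seed d)" J "UNIV :: 'i fieldX set" mut_X
proof (rule mutation_system.intro)
  fix B :: "'i seed" and k
  assume B: "B \<in> Collect (is_seed d)"
  then have kk: "B k k = 0"
    using seed_diag[OF d_pos] by auto
  show "mut k B \<in> Collect (is_seed d)"
    using is_seed_mut[OF d_pos] B by simp
  show "partial_hom UNIV (mut_X B k)"
    using lattice_char.partial_hom[OF exp_data.lattice_char[OF exp_data_X], of B k]
    unfolding charX_dom[of B k, OF kk] mut_X_eq[of B k, OF kk] .
  show "mut_X B k (mut_X (mut k B) k x) = x" for x
    using charX_inverse(3)[of B k, OF kk] kk by (simp add: mut_X_eq mut_def)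
next
  show "partial_hom UNIV (\<lambda>x :: 'i fieldX. x)"
    by (rule partial_hom_id)
qed auto

sublocale A: mutation_system "Collect (is_seed d)" J K "mut_A J"
proof (rule mutation_system.intro)
  fix B :: "'i seed" and k
  assume B: "B \<in> Collect (is_seed d)" and k: "k \<in> J"
  then have kk: "B k k = 0"
    using seed_diag[OF d_pos] by auto
  show "mut k B \<in> Collect (is_seed d)"
    using is_seed_mut[OF d_pos] B by simp
  show "partial_hom K (mut_A J B k)"
    using lattice_char.partial_hom[OF exp_data.lattice_char[OF exp_data_A[OF k]], of B]
    unfolding charA_dom[of B k, OF kk k] mut_A_eq[of B k, OF kk k] .
  fix x assume x: "x \<in> K"
  show "mut_A J B k x \<in> K"
    by (rule mut_A_in[of B k, OF kk k x])
  have "mut k B k k = 0"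
    using kk by (simp add: mut_def)
  then show "mut_A J B k (mut_A J (mut k B) k x) = x"
    using charA_inverse(3)[of B k, OF kk k x] kk k by (simp add: mut_A_eq)
next
  show "partial_hom K (\<lambda>x. x)"
    by (rule partial_hom_mon[OF subgrp_int_exp])
qed

lemma upper_X_eq: "upper_X J B = X.upper LP_X B"
  by (simp add: upper_X_def X.upper_def mut_seq_X_eq_iter)

lemma upper_A_eq: "upper_A J B = A.upper LP_A B"
  by (simp add: upper_A_def A.upper_def mut_seq_A_eq_iter)

lemma LP_ZQ_subset: "LP_ZQ \<subseteq> K"
  by (rule to_field_in_mon[OF subgrp_int_exp])

lemma iter_frozen:
  "is_seed d B \<Longrightarrow> ks \<in> lists J \<Longrightarrow> z \<in> frozen_M J \<Longrightarrow> iter_mut (mut_A J) ks B (mon z) = mon z"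
  by (induction ks arbitrary: B) (auto simp: mut_A_frozen seed_diag[OF d_pos] is_seed_mut[OF d_pos])

lemma iter_integral:
  "is_seed d B \<Longrightarrow> ks \<in> lists J \<Longrightarrow> x \<in> char_dom (int_exp UNIV) mon \<Longrightarrow>
    iter_mut (mut_A J) ks B x \<in> char_dom (int_exp UNIV) mon"
  by (induction ks arbitrary: B) (auto simp: mut_A_in_integral seed_diag[OF d_pos] is_seed_mut[OF d_pos])

end

section \<open>The grading by frozen exponents modulo integers\<close>

section \<open>Rational powers of the frozen variables\<close>

lemma common_denominator:
  assumes H: "subgrp H" and "finite Z" and "\<And>z. z \<in> Z \<Longrightarrow> c z \<in> char_dom H mon"
  shows "\<exists>b\<in>group_ring_on H. b \<noteq> 0 \<and> (\<forall>z\<in>Z. \<exists>a\<in>group_ring_on H. c z * to_field b = to_field a)"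
  using assms(2,3)
proof (induction Z rule: finite_induct)
  case empty
  then show ?case
    by (intro bexI[of _ 1]) (auto simp: group_ring_one H)
next
  case (insert w Z)
  then obtain b where b: "b \<in> group_ring_on H" "b \<noteq> 0"
    "\<forall>z\<in>Z. \<exists>a\<in>group_ring_on H. c z * to_field b = to_field a"
    by auto
  from insert.prems[of w] obtain a' b' where w: "a' \<in> group_ring_on H" "b' \<in> group_ring_on H"
    "b' \<noteq> 0" "c w = Fraction_Field.Fract a' b'"
    by (auto simp: char_dom_mon)
  show ?case
  proof (rule bexI[of _ "b * b'"], intro conjI ballI)
    fix z assume "z \<in> insert w Z"
    then consider "z = w" | "z \<in> Z"
      by auto
    then show "\<exists>a\<in>group_ring_on H. c z * to_field (b * b') = to_field a"
    proof cases
      case 1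
      then have "c z * to_field (b * b') = to_field (a' * b)"
        using w by (simp add: to_field_def eq_fract mult_ac)
      then show ?thesis
        using group_ring_mult[OF H] w b by blast
    next
      case 2
      then obtain a where a: "a \<in> group_ring_on H" "c z * to_field b = to_field a"
        using b by blast
      then have "c z * to_field (b * b') = to_field (a * b')"
        unfolding to_field_mult by (simp only: mult.assoc[symmetric])
      then show ?thesis
        using group_ring_mult[OF H] w a by blast
    qed
  qed (use b w group_ring_mult[OF H] in auto)
qed

lemma lookup_mult_monomial:
  "Poly_Mapping.lookup (a * Poly_Mapping.single z 1) (n + z) = Poly_Mapping.lookup a n"
  for a :: "('a::ab_group_add, int) laurent"
proof -
  have "a * Poly_Mapping.single z 1 =
      (\<Sum>m\<in>Poly_Mapping.keys a. Poly_Mapping.single (m + z) (Poly_Mapping.lookup a m))"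
    by (subst laurent_expand[of a]) (simp add: sum_distrib_right mult_single)
  then show ?thesis
    by (simp add: lookup_sum lookup_single when_def not_in_keys_iff_lookup_eq_zero)
qed

text \<open>\<open>Z\<close> meets each coset of \<open>H\<close> at most once. After multiplication
  by a common denominator the summands have supports in disjoint cosets, so no cancellation between
  them is possible.\<close>

lemma monomials_independent:
  assumes H: "subgrp H" and fin: "finite Z" and c: "\<And>z. z \<in> Z \<Longrightarrow> c z \<in> char_dom H mon"
    and distinct: "\<And>z z'. z \<in> Z \<Longrightarrow> z' \<in> Z \<Longrightarrow> z - z' \<in> H \<Longrightarrow> z = z'"
    and zero: "(\<Sum>z\<in>Z. c z * mon z) = 0" and z: "z \<in> Z"
  shows "c z = 0"
proof -
  have "\<exists>b\<in>group_ring_on H. b \<noteq> 0 \<and> (\<forall>z\<in>Z. \<exists>a\<in>group_ring_on H. c z * to_field b = to_field a)"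
    by (rule common_denominator[OF H fin]) (rule c)
  then obtain b where b: "b \<noteq> 0"
    "\<forall>z\<in>Z. \<exists>a\<in>group_ring_on H. c z * to_field b = to_field a"
    by blast
  then obtain a where a: "\<And>z. z \<in> Z \<Longrightarrow> a z \<in> group_ring_on H"
    "\<And>z. z \<in> Z \<Longrightarrow> c z * to_field b = to_field (a z)"
    by metis
  have "to_field (\<Sum>z\<in>Z. a z * monomial z) = (\<Sum>z\<in>Z. c z * mon z) * to_field b"
    unfolding to_field_sum sum_distrib_right
  proof (rule sum.cong[OF refl])
    fix z assume "z \<in> Z"
    then show "to_field (a z * monomial z) = c z * mon z * to_field b"
      unfolding to_field_mult mon_def a(2)[OF \<open>z \<in> Z\<close>, symmetric] by (simp only: mult_ac)
  qed
  then have p0: "(\<Sum>z\<in>Z. a z * monomial z) = 0"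
    using zero by (simp add: to_field_eq_0_iff)
  have "Poly_Mapping.lookup (a z) n = 0" for n
  proof (cases "n \<in> H")
    case False
    then show ?thesis
      using a(1)[OF z] by (auto simp: group_ring_on_def not_in_keys_iff_lookup_eq_zero)
  next
    case n: True
    have other: "Poly_Mapping.lookup (a y * monomial y) (n + z) = 0" if y: "y \<in> Z" "y \<noteq> z" for y
    proof -
      have "n + (z - y) \<notin> H"
      proof
        assume "n + (z - y) \<in> H"
        from subgrp_diff[OF H this n] have "z - y \<in> H"
          by simp
        then show False
          using distinct[OF z y(1)] y(2) by simp
      qed
      then have "Poly_Mapping.lookup (a y) (n + (z - y)) = 0"
        using a(1)[OF y(1)] by (auto simp: group_ring_on_def not_in_keys_iff_lookup_eq_zero)
      then show ?thesis
        using lookup_mult_monomial[of "a y" y "n + (z - y)"] by (simp add: monomial_def)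
    qed
    have "0 = Poly_Mapping.lookup (\<Sum>z\<in>Z. a z * monomial z) (n + z)"
      by (simp add: p0)
    also have "\<dots> = Poly_Mapping.lookup (a z * monomial z) (n + z)"
      using other unfolding lookup_sum by (subst sum.remove[OF fin z]) simp
    finally show ?thesis
      by (simp add: monomial_def lookup_mult_monomial)
  qed
  then have "a z = 0"
    by (intro poly_mapping_eqI) simp
  then have "c z * to_field b = 0"
    using a(2)[OF z] by (simp only: to_field_zero)
  moreover have "to_field b \<noteq> 0"
    using b(1) by (simp only: to_field_eq_0_iff not_False_eq_True)
  ultimately show ?thesis
    by (metis mult_eq_0_iff)
qed

text \<open>The standard representative of an exponent modulo integral exponents; unfrozen
  coordinates are set to zero because they are integral wherever this is applied.\<close>

definition frac_part :: "'i set \<Rightarrow> 'i::finite latM \<Rightarrow> 'i latM" where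
  "frac_part J m = vec (\<lambda>i. if i \<in> J then 0 else frac (Poly_Mapping.lookup m i))"

text \<open>The graded component of class \<open>z\<close>, divided by the monomial of
  \<open>z\<close> so that it has integral exponents and can lie in \<open>LP_A\<close>.\<close>

definition homog_part :: "'i set \<Rightarrow> 'i::{finite,linorder} latM \<Rightarrow> ('i latM, int) laurent \<Rightarrow> ('i latM, int) laurent" where
  "homog_part J z p = (\<Sum>m\<in>{m\<in>Poly_Mapping.keys p. frac_part J m = z}.
     Poly_Mapping.single (m - z) (Poly_Mapping.lookup p m))"

lemma frac_part_frozen: "frac_part J m \<in> frozen_M J"
  by (auto simp: frozen_M_def frac_part_def)

lemma frac_part_eqI:
  assumes "frac_part J m - frac_part J m' \<in> int_exp UNIV"
  shows "frac_part J m = frac_part J m'"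
proof (rule poly_mapping_eqI)
  fix i
  have "frac x = frac y" if "frac x - frac y \<in> \<int>" for x y :: rat
  proof -
    from that obtain c where c: "frac x - frac y = of_int c"
      by (auto elim: Ints_cases)
    moreover have "\<bar>frac x - frac y\<bar> < 1"
      using frac_ge_0[of x] frac_ge_0[of y] frac_lt_1[of x] frac_lt_1[of y] by linarith
    ultimately have "\<bar>of_int c :: rat\<bar> < of_int 1"
      by simp
    then have "\<bar>c\<bar> < 1"
      by (simp only: of_int_abs[symmetric] of_int_less_iff)
    then show ?thesis
      using c by simp
  qed
  moreover have "Poly_Mapping.lookup (frac_part J m - frac_part J m') i \<in> \<int>"
    using assms by (auto simp: int_exp_def)
  ultimately show "Poly_Mapping.lookup (frac_part J m) i = Poly_Mapping.lookup (frac_part J m') i"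
    by (auto simp: frac_part_def lookup_minus split: if_splits)
qed

lemma homog_part_integral:
  assumes "p \<in> group_ring_on (int_exp J)"
  shows "homog_part J z p \<in> group_ring_on (int_exp UNIV)"
proof -
  have "m - frac_part J m \<in> int_exp UNIV" if "m \<in> Poly_Mapping.keys p" for m
    using that assms by (auto simp: group_ring_on_def int_exp_def frac_part_def lookup_minus frac_def)
  then show ?thesis
    unfolding homog_part_def by (auto intro!: group_ring_sum group_ring_single)
qed

lemma homog_part_sum:
  assumes "finite Z" "frac_part J ` Poly_Mapping.keys p \<subseteq> Z"
  shows "to_field p = (\<Sum>z\<in>Z. to_field (homog_part J z p) * mon z)"
proof -
  have "to_field (homog_part J z p) * mon z =
      (\<Sum>m\<in>{m\<in>Poly_Mapping.keys p. frac_part J m = z}. of_int (Poly_Mapping.lookup p m) * mon m)" for z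
    by (simp add: homog_part_def to_field_sum to_field_single sum_distrib_right mult.assoc flip: mon_add)
  then have "(\<Sum>z\<in>Z. to_field (homog_part J z p) * mon z) = char_eval mon p"
    using sum.group[of "Poly_Mapping.keys p" Z "frac_part J"
        "\<lambda>m. of_int (Poly_Mapping.lookup p m) * mon m"] assms
    by (simp add: char_eval_def)
  then show ?thesis
    by (simp add: char_eval_mon)
qed

context cluster
begin

text \<open>Monomials with distinct fractional parts are linearly independent over the fractions with integral
  exponents, and mutations preserve those fractions, so each homogeneous part of an element can be
  treated separately.\<close>

lemma extend_upper_A:
  assumes B: "is_seed d B"
  shows "extend_ZQ J (upper_A J B) = A.upper LP_ZQ B"
proof
  have frozen_int: "frozen_M J \<subseteq> int_exp J"
    by (auto simp: frozen_M_def int_exp_def)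
  have K0_K: "char_dom (int_exp UNIV) mon \<subseteq> K"
    by (intro char_dom_mono int_exp_mono) simp
  have LP_K0: "LP_A \<subseteq> char_dom (int_exp UNIV) mon"
    unfolding LP_A_eq by (rule to_field_in_mon[OF subgrp_int_exp])
  have mon_K: "mon z \<in> K" if "z \<in> frozen_M J" for z
  proof -
    have "to_field (monomial z) \<in> LP_ZQ"
      using that frozen_int by (intro imageI monomial_in_group_ring) blast
    then show ?thesis
      unfolding mon_def[of z] using LP_ZQ_subset by (rule rev_subsetD)
  qed
  show "extend_ZQ J (upper_A J B) \<subseteq> A.upper LP_ZQ B"
  proof
    fix x assume "x \<in> extend_ZQ J (upper_A J B)"
    then obtain Z r where x: "x = (\<Sum>z\<in>Z. r z * mon z)" "Z \<subseteq> frozen_M J"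
      and r: "\<forall>z\<in>Z. r z \<in> upper_A J B"
      unfolding extend_ZQ_def mon_def by blast
    show "x \<in> A.upper LP_ZQ B"
      unfolding A.upper_def
    proof
      fix ks assume ks: "ks \<in> lists J"
      interpret I: partial_hom K "iter_mut (mut_A J) ks B"
        by (rule A.iter_hom) (use B ks in auto)
      have "\<forall>z\<in>Z. \<exists>p. p \<in> group_ring_on (int_exp UNIV) \<and> r z = iter_mut (mut_A J) ks B (to_field p)"
        using r ks unfolding upper_A_eq A.upper_def LP_A_eq by blast
      then obtain p where p: "\<And>z. z \<in> Z \<Longrightarrow> p z \<in> group_ring_on (int_exp UNIV)"
        "\<And>z. z \<in> Z \<Longrightarrow> r z = iter_mut (mut_A J) ks B (to_field (p z))"
        by metis
      have pK: "to_field (p z) \<in> K" if "z \<in> Z" for z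
        using p(1)[OF that] K0_K LP_K0 by (auto simp: LP_A_eq)
      let ?q = "\<Sum>z\<in>Z. p z * monomial z"
      have "p z * monomial z \<in> group_ring_on (int_exp J)" if "z \<in> Z" for z
        using p(1)[OF that] that x(2) frozen_int group_ring_on_mono[OF int_exp_mono[of J UNIV]]
        by (auto intro!: group_ring_mult[OF subgrp_int_exp] group_ring_single simp: monomial_def)
      then have "?q \<in> group_ring_on (int_exp J)"
        by (rule group_ring_sum)
      moreover have "x = iter_mut (mut_A J) ks B (to_field ?q)"
      proof -
        have "iter_mut (mut_A J) ks B (to_field ?q) =
           (\<Sum>z\<in>Z. iter_mut (mut_A J) ks B (to_field (p z) * mon z))"
          unfolding to_field_sum to_field_mult mon_def[symmetric]
          by (rule I.f_sum) (use x(2) in \<open>auto intro!: I.mult_closed pK mon_K\<close>)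
        also have "\<dots> = (\<Sum>z\<in>Z. r z * mon z)"
          using x(2) by (intro sum.cong) (auto simp: I.f_mult pK mon_K p(2) iter_frozen[OF B ks])
        finally show ?thesis
          using x by simp
      qed
      ultimately show "x \<in> iter_mut (mut_A J) ks B ` LP_ZQ"
        by blast
    qed
  qed
  show "A.upper LP_ZQ B \<subseteq> extend_ZQ J (upper_A J B)"
  proof
    fix x assume x: "x \<in> A.upper LP_ZQ B"
    then obtain p where p: "p \<in> group_ring_on (int_exp J)" "x = to_field p"
      using A.upper_subset by blast
    let ?Z = "frac_part J ` Poly_Mapping.keys p"
    have "to_field (homog_part J z p) \<in> upper_A J B" if z: "z \<in> ?Z" for z
      unfolding upper_A_eq A.upper_def
    proof
      fix ks assume ks: "ks \<in> lists J"
      interpret I: partial_hom K "iter_mut (mut_A J) ks B"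
        by (rule A.iter_hom) (use B ks in auto)
      interpret L: partial_hom "char_dom (int_exp UNIV) mon" "\<lambda>x. x :: 'i fieldA"
        by (rule partial_hom_mon[OF subgrp_int_exp])
      from x ks obtain p' where p': "p' \<in> group_ring_on (int_exp J)"
        "x = iter_mut (mut_A J) ks B (to_field p')"
        unfolding A.upper_def by blast
      \<comment> \<open>The two expansions of \<open>x\<close> may involve different classes; over
        the union they become comparable, absent components being zero.\<close>
      let ?W = "?Z \<union> frac_part J ` Poly_Mapping.keys p'"
      let ?q = "\<lambda>z. to_field (homog_part J z p)" and ?q' = "\<lambda>z. to_field (homog_part J z p')"
      have W: "?W \<subseteq> frozen_M J" "finite ?W"
        using frac_part_frozen by auto
      have q: "?q z \<in> char_dom (int_exp UNIV) mon" "?q' z \<in> char_dom (int_exp UNIV) mon" for z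
        using LP_K0 homog_part_integral[OF p(1)] homog_part_integral[OF p'(1)] by (auto simp: LP_A_eq)
      have "x = iter_mut (mut_A J) ks B (\<Sum>z\<in>?W. ?q' z * mon z)"
        unfolding p'(2) by (subst homog_part_sum[of ?W J p']) auto
      also have "\<dots> = (\<Sum>z\<in>?W. iter_mut (mut_A J) ks B (?q' z * mon z))"
        by (rule I.f_sum) (use W q K0_K mon_K in \<open>blast intro: I.mult_closed\<close>)
      also have "\<dots> = (\<Sum>z\<in>?W. iter_mut (mut_A J) ks B (?q' z) * mon z)"
      proof (rule sum.cong[OF refl])
        fix z assume "z \<in> ?W"
        then have "z \<in> frozen_M J"
          using W by blast
        then show "iter_mut (mut_A J) ks B (?q' z * mon z) = iter_mut (mut_A J) ks B (?q' z) * mon z"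
          using q K0_K by (subst I.f_mult) (auto simp: mon_K iter_frozen[OF B ks])
      qed
      \<comment> \<open>Subtracting the expansion of \<open>x\<close> in the initial seed from the
        mutated one leaves a relation with integral coefficient fractions; independence then matches
        the components class by class.\<close>
      finally have s0: "(\<Sum>z\<in>?W. (?q z - iter_mut (mut_A J) ks B (?q' z)) * mon z) = 0"
        using homog_part_sum[of ?W J p] p(2) by (simp add: left_diff_distrib sum_subtractf)
      have s1: "?q z - iter_mut (mut_A J) ks B (?q' z) \<in> char_dom (int_exp UNIV) mon" for z
        using L.add_closed[OF q(1) L.uminus_closed[OF iter_integral[OF B ks q(2)]]] by simp
      have s2: "y = z" if "y \<in> ?W" "z \<in> ?W" "y - z \<in> int_exp UNIV" for y z
        using that frac_part_eqI by blast
      have "?q z - iter_mut (mut_A J) ks B (?q' z) = 0"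
        by (rule monomials_independent[OF subgrp_int_exp[of UNIV] W(2),
              where c = "\<lambda>z. ?q z - iter_mut (mut_A J) ks B (?q' z)" and z = z])
          (rule s1, erule (2) s2, rule s0, rule UnI1[OF z])
      then show "?q z \<in> iter_mut (mut_A J) ks B ` LP_A"
        using homog_part_integral[OF p'(1)] by (auto simp: LP_A_eq)
    qed
    moreover have "x = (\<Sum>z\<in>?Z. to_field (homog_part J z p) * to_field (monomial z))"
      unfolding p(2) mon_def[symmetric] by (rule homog_part_sum) auto
    ultimately show "x \<in> extend_ZQ J (upper_A J B)"
      unfolding extend_ZQ_def mem_Collect_eq
      by (intro exI[of _ ?Z] exI[of _ "\<lambda>z. to_field (homog_part J z p)"] conjI)
        (auto simp: frac_part_frozen)
  qed
qed

end

section \<open>Compatibility of \<open>pstar\<close> with sequences of mutations\<close>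

section \<open>Monomial maps and mutations\<close>

lemma varX_eq: "varX V = char_ext UNIV (\<lambda>n. mon (V n))"
  by (simp add: varX_def char_eval_mon_map[abs_def])

lemma varA_eq: "varA J W = char_ext (int_exp J) (\<lambda>m. mon (W m))"
  by (simp add: varA_def poly_A_ZQ_eq char_eval_mon_map[abs_def])

lemma pstar_alg_eq: "pstar_alg B = char_ext UNIV (\<lambda>n. mon (pstar B n))"
  by (simp add: pstar_alg_def char_eval_mon_map[abs_def])

lemma lattice_char_mon_map:
  assumes "subgrp H" "additive V"
  shows "lattice_char H (\<lambda>n. mon (V n))"
  by (rule lattice_charI[OF assms(1)])
    (auto simp: additive.add[OF assms(2)] additive.zero[OF assms(2)] mon_add)

lemma additive_pstar: "additive (pstar B)"
  by standard (rule pstar_add)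

lemma varX_to_field: "additive V \<Longrightarrow> varX V (to_field p) = to_field (monomial_map V p)"
  unfolding varX_eq
  by (subst lattice_char.ext_to_field[OF lattice_char_mon_map[OF subgrp_UNIV]])
    (auto simp: char_eval_mon_map)

lemma varA_to_field: "additive W \<Longrightarrow> p \<in> group_ring_on (int_exp J) \<Longrightarrow>
    varA J W (to_field p) = to_field (monomial_map W p)"
  unfolding varA_eq
  by (subst lattice_char.ext_to_field[OF lattice_char_mon_map[OF subgrp_int_exp]])
    (auto simp: char_eval_mon_map)

lemma pstar_alg_to_field: "pstar_alg B (to_field p) = to_field (monomial_map (pstar B) p)"
  unfolding pstar_alg_eq
  by (subst lattice_char.ext_to_field[OF lattice_char_mon_map[OF subgrp_UNIV additive_pstar]])
    (auto simp: char_eval_mon_map)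

lemma monomial_map_in:
  "p \<in> group_ring_on H \<Longrightarrow> (\<And>n. n \<in> H \<Longrightarrow> V n \<in> H') \<Longrightarrow> monomial_map V p \<in> group_ring_on H'"
  unfolding monomial_map_def
  by (intro group_ring_sum group_ring_single) (auto simp: group_ring_on_def)

text \<open>An instance of the square with \<open>pstar\<close> of the two seeds as vertical maps:
  \<open>pstar_tau\<close> matches the linear parts, and coordinate \<open>k\<close> of
  \<open>pstar (mut k B) n\<close> is the binomial exponent of the \<open>X\<close>
  mutation.\<close>

lemma (in cluster) pstar_mut:
  assumes B: "is_seed d B" and k: "k \<in> J" and f: "f \<in> char_dom UNIV (\<lambda>n. mon (pstar (mut k B) n))"
  shows "mut_X B k f \<in> char_dom UNIV (\<lambda>n. mon (pstar B n))"
    and "pstar_alg B (mut_X B k f) = mut_A J B k (pstar_alg (mut k B) f)"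
proof -
  have kk: "B k k = 0"
    using seed_diag[OF d_pos B] .
  have deg: "degA k (pstar (mut k B) n) = degX B k n" for n
  proof -
    have "Poly_Mapping.lookup (pstar (mut k B) n) k = of_int (degX B k n)"
      by (simp add: degX_def mut_def sum_negf mult.commute)
    then show ?thesis
      unfolding degA_def by (simp only: floor_of_int)
  qed
  note * = char_ext_square[OF exp_data_X exp_data_A[OF k] pstar_add pstar_add
      pstar_in_int_exp pstar_in_int_exp pstar_tau[of B k, OF kk] refl deg
      charA_nonzero[of B k, OF kk k] f]
  show "mut_X B k f \<in> char_dom UNIV (\<lambda>n. mon (pstar B n))"
    and "pstar_alg B (mut_X B k f) = mut_A J B k (pstar_alg (mut k B) f)"
    unfolding mut_X_eq[of B k, OF kk] mut_A_eq[of B k, OF kk k] pstar_alg_eq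
    by (rule *; assumption)+
qed

lemma (in cluster) pstar_iter:
  "is_seed d B \<Longrightarrow> ks \<in> lists J \<Longrightarrow> f \<in> char_dom UNIV (\<lambda>n. mon (pstar (mut_seq ks B) n)) \<Longrightarrow>
    iter_mut mut_X ks B f \<in> char_dom UNIV (\<lambda>n. mon (pstar B n)) \<and>
    pstar_alg B (iter_mut mut_X ks B f) = iter_mut (mut_A J) ks B (pstar_alg (mut_seq ks B) f)"
proof (induction ks arbitrary: B)
  case (Cons k ks)
  then have B: "is_seed d (mut k B)" "k \<in> J" "ks \<in> lists J"
    by (auto simp: is_seed_mut[OF d_pos])
  have "f \<in> char_dom UNIV (\<lambda>n. mon (pstar (mut_seq ks (mut k B)) n))"
    using Cons.prems(3) by simp
  from Cons.IH[OF B(1,3) this] pstar_mut[OF Cons.prems(1) B(2)] show ?case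
    by simp
qed auto

section \<open>Duality between the two kinds of variation maps\<close>

section \<open>Pairing, pullback and variation maps\<close>

lemma additive_latN:
  fixes g :: "'i::finite latN \<Rightarrow> rat"
  assumes "additive g"
  shows "g n = (\<Sum>i\<in>UNIV. of_int (Poly_Mapping.lookup n i) * g (basis_e i))"
proof -
  have single: "g (Poly_Mapping.single i c) = of_int c * g (basis_e i)" for i c
  proof (induction c rule: int_induct[where k = 0])
    case base
    then show ?case
      using additive.zero[OF assms] by simp
  next
    case (step1 c)
    then show ?case
      using additive.add[OF assms, of "Poly_Mapping.single i c" "basis_e i"]
      by (simp add: basis_e_def single_add[symmetric] algebra_simps)
  next
    case (step2 c)
    then show ?case
      using additive.diff[OF assms, of "Poly_Mapping.single i c" "basis_e i"]
      by (simp add: basis_e_def single_diff[symmetric] algebra_simps)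
  qed
  have "n = (\<Sum>i\<in>UNIV. Poly_Mapping.single i (Poly_Mapping.lookup n i))"
    by (rule poly_mapping_eqI) (simp add: lookup_sum lookup_single when_def)
  then have "g n = g (\<Sum>i\<in>UNIV. Poly_Mapping.single i (Poly_Mapping.lookup n i))"
    by simp
  then show ?thesis
    by (simp add: additive.sum[OF assms] single)
qed

lemma pairing_add_left: "pairing d (m + m') n = pairing d m n + pairing d m' n"
  by (simp add: pairing_def lookup_add ring_distribs add_divide_distrib sum.distrib)

lemma pairing_add_right: "pairing d m (n + n') = pairing d m n + pairing d m n'"
  by (simp add: pairing_def lookup_add ring_distribs add_divide_distrib sum.distrib)

lemma pairing_basis_e: "pairing d m (basis_e i) = Poly_Mapping.lookup m i / of_int (d i)"
proof -
  have "pairing d m (basis_e i) =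
      (\<Sum>j\<in>UNIV. if i = j then Poly_Mapping.lookup m j / of_int (d j) else 0)"
    unfolding pairing_def by (rule sum.cong) auto
  then show ?thesis
    by simp
qed

lemma pairing_basis_f: "pairing d (basis_f i) n = of_int (Poly_Mapping.lookup n i) / of_int (d i)"
proof -
  have "pairing d (basis_f i) n =
      (\<Sum>j\<in>UNIV. if i = j then of_int (Poly_Mapping.lookup n j) / of_int (d j) else 0)"
    unfolding pairing_def by (rule sum.cong) auto
  then show ?thesis
    by simp
qed

lemma lookup_pullback:
  "Poly_Mapping.lookup (pullback d V m) i = of_int (d i) * pairing d m (V (basis_e i))"
  by (simp add: pullback_def lookup_sum lookup_single when_def)

lemma additive_pullback: "additive (pullback d V)"
  by standard
    (rule poly_mapping_eqI, simp add: lookup_pullback lookup_add pairing_add_left ring_distribs)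

lemma omega_add_left: "omega d B (m + m') n = omega d B m n + omega d B m' n"
  by (simp add: omega_eq_pairing pstar_add pairing_add_left)

lemma omega_add_right: "omega d B m (n + n') = omega d B m n + omega d B m n'"
  by (simp add: omega_eq_pairing pairing_add_right)

text \<open>Multiples are compared through their exponentials: \<open>mon_powi\<close> turns both
  sides into the same integer power, and \<open>mon\<close> is injective.\<close>

lemma additive_single:
  fixes V :: "('i::{finite,linorder}) latN \<Rightarrow> 'i latN"
  assumes "additive V" "V (basis_e i) = basis_e j"
  shows "V (Poly_Mapping.single i c) = Poly_Mapping.single j c"
proof -
  have "(mon (V (Poly_Mapping.single i c)) :: 'i fieldX) = mon (V (Poly_Mapping.single i 1)) powi c"
    by (rule mon_powi[of "\<lambda>c. V (Poly_Mapping.single i c)"])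
      (simp add: single_add additive.add[OF assms(1)])
  also have "V (Poly_Mapping.single i 1) = Poly_Mapping.single j 1"
    using assms(2) by (simp add: basis_e_def)
  also have "(mon (Poly_Mapping.single j 1) :: 'i fieldX) powi c = mon (Poly_Mapping.single j c)"
    by (rule mon_powi[symmetric]) (simp add: single_add)
  finally show ?thesis
    by simp
qed

context cluster
begin

lemma d_nonzero: "(of_int (d i) :: rat) \<noteq> 0"
  using d_pos by (metis less_irrefl of_int_eq_0_iff)

lemma pairing_eqI:
  assumes "\<And>n. pairing d m n = pairing d m' n"
  shows "m = m'"
  by (rule poly_mapping_eqI)
    (use assms[of "basis_e _"] d_nonzero in \<open>simp add: pairing_basis_e\<close>)

lemma pairing_pull: "additive V \<Longrightarrow> pairing d (pullback d V m) n = pairing d m (V n)"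
  by (rule pairing_pullback) (use d_pos in auto)

lemma pairing_tauM: "is_seed d B \<Longrightarrow> pairing d (tauM B k m) n = pairing d m (tauN B k n)"
  using pairing_tau[OF d_pos, of B k m "tauN B k n"] seed_diag[OF d_pos] by simp

lemma omega_skew:
  assumes "is_seed d B"
  shows "omega d B n n' = - omega d B n' n"
proof -
  have basis: "omega d B (basis_e i) (basis_e j) = - omega d B (basis_e j) (basis_e i)" for i j
  proof -
    have "of_int (B j i * d i) = (of_int (- (B i j * d j)) :: rat)"
      using seed_skew[OF d_pos assms, of j i] by simp
    then show ?thesis
      using d_nonzero by (simp add: omega_eq_pairing pairing_basis_e field_simps del: lookup_pstar)
  qed
  have 1: "additive (omega d B n)" for n
    by standard (rule omega_add_right)
  have 2: "additive (\<lambda>n. omega d B n n')" for n'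
    by standard (rule omega_add_left)
  have 3: "omega d B (basis_e i) n' = - omega d B n' (basis_e i)" for i n'
    unfolding additive_latN[OF 1, of _ n'] additive_latN[OF 2, of n']
    by (simp add: basis[of i] sum_negf)
  show ?thesis
    unfolding additive_latN[OF 1, of n' n] additive_latN[OF 2, of n n']
    by (simp add: 3 sum_negf)
qed

text \<open>The pullback has the transposed matrix of \<open>V\<close>, rescaled by the multipliers.
  Its unfrozen rows are the images of unfrozen basis vectors under \<open>V\<close>, which settles
  the first conditions; the conditions on \<open>pstar\<close> and on \<open>omega\<close> are the
  same after pairing with the basis.\<close>

lemma variation_N_iff_M:
  assumes t: "is_seed d t" and t': "is_seed d t'" and sim: "similar J d \<sigma> t t'" and V: "additive V"
  shows "variation_N J d \<sigma> t t' V \<longleftrightarrow> variation_M J \<sigma> t t' (pullback d V)"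
proof -
  let ?W = "pullback d V"
  have \<sigma>: "\<sigma> permutes J" and d\<sigma>: "\<And>i. i \<in> J \<Longrightarrow> d (\<sigma> i) = d i"
    using sim by (auto simp: similar_def)
  have inv: "inv \<sigma> l \<in> J" "\<sigma> (inv \<sigma> l) = l" if "l \<in> J" for l
    using that \<sigma> by (auto simp: permutes_inverses permutes_in_image[OF permutes_inv[OF \<sigma>]])
  \<comment> \<open>At the only nonzero entry of an unfrozen row the indices correspond under
    \<open>\<sigma>\<close>, and similarity makes the quotient of multipliers equal to 1.\<close>
  have coord: "Poly_Mapping.lookup (?W (basis_f i)) l =
      of_int (d l) / of_int (d i) * of_int (Poly_Mapping.lookup (V (basis_e l)) i)" for i l
    by (simp add: lookup_pullback pairing_basis_f)
  have basis: "(\<forall>k\<in>J. V (basis_e k) = basis_e (inv \<sigma> k)) \<longleftrightarrow>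
      (\<forall>k\<in>J. ?W (basis_f k) - basis_f (\<sigma> k) \<in> frozen_M J) \<and> (\<forall>j\<in>- J. ?W (basis_f j) \<in> frozen_M J)"
    (is "?L \<longleftrightarrow> ?R")
  proof
    assume L: ?L
    then have *: "Poly_Mapping.lookup (?W (basis_f i)) l = (if inv \<sigma> l = i then 1 else 0)"
      if "l \<in> J" for i l
      using that d\<sigma>[OF inv(1)[OF that]] inv(2)[OF that] d_nonzero by (auto simp: coord)
    show ?R
      using * \<sigma> inv by (auto simp: frozen_M_def lookup_minus permutes_inv_eq permutes_in_image)
  next
    assume R: ?R
    show ?L
    proof
      fix l assume l: "l \<in> J"
      show "V (basis_e l) = basis_e (inv \<sigma> l)"
      proof (rule poly_mapping_eqI)
        fix i
        have W: "Poly_Mapping.lookup (?W (basis_f i)) l = (if \<sigma> i = l then 1 else 0)"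
        proof (cases "i \<in> J")
          case True
          then show ?thesis
            using R l by (auto simp: frozen_M_def lookup_minus)
        next
          case False
          then have "\<sigma> i = i"
            using \<sigma> by (simp add: permutes_def)
          then show ?thesis
            using R l False by (auto simp: frozen_M_def)
        qed
        show "Poly_Mapping.lookup (V (basis_e l)) i = Poly_Mapping.lookup (basis_e (inv \<sigma> l)) i"
        proof (cases "\<sigma> i = l")
          case True
          then have "i = inv \<sigma> l"
            using \<sigma> by (metis permutes_inverses(2))
          moreover from this have "d i = d l"
            using d\<sigma>[OF inv(1)[OF l]] inv(2)[OF l] by simp
          ultimately show ?thesis
            using W True d_nonzero by (simp add: coord)
        next
          case False
          then have "inv \<sigma> l \<noteq> i"
            using inv(2)[OF l] by auto
          then show ?thesis
            using W False d_nonzero by (simp add: coord)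
        qed
      qed
    qed
  qed
  have om: "(\<forall>i. \<forall>k\<in>J. omega d t (V (basis_e i)) (V (basis_e k)) = omega d t' (basis_e i) (basis_e k))
      \<longleftrightarrow> (\<forall>k\<in>J. ?W (pstar t (basis_e k)) = pstar t' (basis_e (\<sigma> k)))" (is "?L \<longleftrightarrow> ?R")
    if Ve: "\<forall>k\<in>J. V (basis_e k) = basis_e (inv \<sigma> k)"
  proof -
    have *: "?W (pstar t (basis_e k)) = pstar t' (basis_e (\<sigma> k)) \<longleftrightarrow>
      (\<forall>i. omega d t (V (basis_e i)) (V (basis_e (\<sigma> k))) = omega d t' (basis_e i) (basis_e (\<sigma> k)))"
      if k: "k \<in> J" for k
    proof -
      have \<sigma>k: "\<sigma> k \<in> J" "inv \<sigma> (\<sigma> k) = k"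
        using \<sigma> k by (auto simp: permutes_in_image permutes_inverses)
      have "?W (pstar t (basis_e k)) = pstar t' (basis_e (\<sigma> k)) \<longleftrightarrow>
        (\<forall>i. pairing d (?W (pstar t (basis_e k))) (basis_e i) = pairing d (pstar t' (basis_e (\<sigma> k))) (basis_e i))"
        using d_nonzero by (auto simp: pairing_basis_e intro!: poly_mapping_eqI simp del: lookup_pstar)
      \<comment> \<open>Through \<open>pstar\<close> the unfrozen vector enters the form in the
        first slot, in the definition of \<open>variation_N\<close> in the second; skew-symmetry
        converts one into the other.\<close>
      also have "\<dots> \<longleftrightarrow> (\<forall>i. - omega d t (V (basis_e i)) (basis_e k) = - omega d t' (basis_e i) (basis_e (\<sigma> k)))"
        unfolding pairing_pull[OF V] omega_eq_pairing[symmetric]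
        using omega_skew[OF t, of "basis_e k"] omega_skew[OF t', of "basis_e (\<sigma> k)"] by metis
      finally show ?thesis
        using Ve \<sigma>k by simp
    qed
    have "?R \<longleftrightarrow> (\<forall>l\<in>J. \<forall>i. omega d t (V (basis_e i)) (V (basis_e l)) = omega d t' (basis_e i) (basis_e l))"
      using * inv permutes_in_image[OF \<sigma>] by metis
    then show ?thesis
      by blast
  qed
  show ?thesis
    unfolding variation_N_def variation_M_def using V additive_pullback[of d V] basis om by blast
qed

text \<open>Bilinear extension of the condition on basis vectors. The general form is applied below
  to base-changed vectors and to preimages, which are not basis vectors.\<close>

lemma omega_variation:
  assumes V: "variation_N J d \<sigma> t t' V" and m: "\<And>l. l \<notin> J \<Longrightarrow> Poly_Mapping.lookup m l = 0"
  shows "omega d t (V n) (V m) = omega d t' n m"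
proof -
  have add: "additive V"
    using V by (simp add: variation_N_def)
  have basis: "omega d t (V n) (V (basis_e l)) = omega d t' n (basis_e l)" if "l \<in> J" for l
  proof -
    have 1: "additive (\<lambda>n. omega d t (V n) (V (basis_e l)))"
      by standard (simp add: additive.add[OF add] omega_add_left)
    have 2: "additive (\<lambda>n. omega d t' n (basis_e l))"
      by standard (simp add: omega_add_left)
    show ?thesis
      unfolding additive_latN[OF 1, of n] additive_latN[OF 2, of n]
      using V that by (intro sum.cong) (auto simp: variation_N_def)
  qed
  have 1: "additive (\<lambda>m. omega d t (V n) (V m))"
    by standard (simp add: additive.add[OF add] omega_add_right)
  have 2: "additive (\<lambda>m. omega d t' n m)"
    by standard (simp add: omega_add_right)
  show ?thesis
    unfolding additive_latN[OF 1, of m] additive_latN[OF 2, of m]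
    by (rule sum.cong) (use m basis in auto)
qed

end

section \<open>Conjugated variation maps and the invariance of upper cluster algebras\<close>

section \<open>Variation maps commute with mutations\<close>

context cluster
begin

text \<open>Expresses the binomial exponent by the form with an unfrozen second argument, which is
  exactly what variation maps preserve.\<close>

lemma degX_eq_omega: "of_int (degX B k n) = - of_int (d k) * omega d B n (basis_e k)"
  using d_nonzero[of k]
  by (simp add: degX_def omega_eq_pairing pairing_basis_e sum_negf mult.commute)

lemma pullback_unfrozen:
  assumes "similar J d \<sigma> t t'" "variation_N J d \<sigma> t t' V" "l \<in> J"
  shows "Poly_Mapping.lookup (pullback d V m) l = Poly_Mapping.lookup m (inv \<sigma> l)"
proof -
  have \<sigma>: "\<sigma> permutes J" and "\<And>i. i \<in> J \<Longrightarrow> d (\<sigma> i) = d i"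
    using assms by (auto simp: similar_def)
  moreover have "inv \<sigma> l \<in> J" "\<sigma> (inv \<sigma> l) = l"
    using \<sigma> assms by (auto simp: permutes_inverses permutes_in_image[OF permutes_inv[OF \<sigma>]])
  ultimately have "d (inv \<sigma> l) = d l"
    by metis
  then show ?thesis
    using assms d_nonzero[of l] by (simp add: lookup_pullback variation_N_def pairing_basis_e)
qed

lemma pullback_int_exp:
  assumes "similar J d \<sigma> t t'" "variation_N J d \<sigma> t t' V" "m \<in> int_exp J"
  shows "pullback d V m \<in> int_exp J"
proof -
  have \<sigma>: "\<sigma> permutes J"
    using assms by (simp add: similar_def)
  have "inv \<sigma> l \<in> J" if "l \<in> J" for l
    using that permutes_in_image[OF permutes_inv[OF \<sigma>]] by blast
  then show ?thesis
    using assms by (simp add: int_exp_def pullback_unfrozen[OF assms(1,2)])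
qed

lemma similar_mut:
  assumes "similar J d \<sigma> t t'" "k \<in> J"
  shows "similar J d \<sigma> (mut k t) (mut (\<sigma> k) t')"
proof -
  have "\<sigma> permutes J"
    using assms by (simp add: similar_def)
  then have "\<sigma> i = \<sigma> k \<longleftrightarrow> i = k" for i
    by (metis permutes_inverses(2))
  then show ?thesis
    using assms by (auto simp: similar_def mut_def)
qed

text \<open>The outer \<open>tauN t k\<close> serves as its own inverse: it takes the result from
  the basis of \<open>t\<close> to that of \<open>mut k t\<close>.\<close>

definition mut_var :: "('i \<Rightarrow> 'i) \<Rightarrow> 'i seed \<Rightarrow> 'i seed \<Rightarrow> 'i \<Rightarrow> ('i latN \<Rightarrow> 'i latN) \<Rightarrow> 'i latN \<Rightarrow> 'i latN" where
  "mut_var \<sigma> t t' k V n = tauN t k (V (tauN t' (\<sigma> k) n))"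

context
  fixes t t' :: "'i seed" and \<sigma> :: "'i \<Rightarrow> 'i" and V :: "'i latN \<Rightarrow> 'i latN" and k :: 'i
  assumes t: "is_seed d t" and t': "is_seed d t'" and sim: "similar J d \<sigma> t t'"
    and V: "variation_N J d \<sigma> t t' V" and k: "k \<in> J"
begin

lemma sigma: "\<sigma> permutes J"
  using sim by (simp add: similar_def)

lemma sigma_k: "\<sigma> k \<in> J" "inv \<sigma> (\<sigma> k) = k"
  using sigma k by (auto simp: permutes_in_image permutes_inverses)

lemma kk: "t k k = 0" "t' (\<sigma> k) (\<sigma> k) = 0"
  using seed_diag[OF d_pos] t t' by auto

lemma V_additive: "additive V"
  using V by (simp add: variation_N_def)

lemma V_basis: "l \<in> J \<Longrightarrow> V (basis_e l) = basis_e (inv \<sigma> l)"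
  using V by (simp add: variation_N_def)

lemma mut_var_add: "mut_var \<sigma> t t' k V (m + n) = mut_var \<sigma> t t' k V m + mut_var \<sigma> t t' k V n"
  by (simp add: mut_var_def tauN_add additive.add[OF V_additive])

lemma tauN_mut_var: "tauN t k (mut_var \<sigma> t t' k V n) = V (tauN t' (\<sigma> k) n)"
  by (simp add: mut_var_def kk)

text \<open>The two sign changes at \<open>k\<close> cancel. For the other unfrozen vectors,
  similarity makes the correction added by \<open>tauN t'\<close> correspond to the one removed by
  \<open>tauN t\<close>.\<close>

lemma mut_var_basis:
  assumes l: "l \<in> J"
  shows "mut_var \<sigma> t t' k V (basis_e l) = basis_e (inv \<sigma> l)"
proof (cases "l = \<sigma> k")
  case True
  have "tauN t k (- basis_e k) = basis_e k"
    using tauN_tauN[of t k "basis_e k"] by (simp add: tauN_basis_same kk)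
  then show ?thesis
    unfolding mut_var_def using True
    by (simp add: tauN_basis_same kk additive.minus[OF V_additive] V_basis sigma_k)
next
  case False
  let ?i = "inv \<sigma> l"
  have i: "?i \<in> J" "\<sigma> ?i = l" "?i \<noteq> k"
    using l False sigma by (auto simp: permutes_inverses permutes_in_image[OF permutes_inv[OF sigma]])
  then have "t' (\<sigma> k) l = t k ?i"
    using sim k unfolding similar_def by metis
  then have "V (tauN t' (\<sigma> k) (basis_e l)) = basis_e ?i + Poly_Mapping.single k (pos_part (t k ?i))"
    using False l
    by (simp add: tauN_basis additive.add[OF V_additive] V_basis sigma_k
        additive_single[OF V_additive, of "\<sigma> k" k])
  then have "V (tauN t' (\<sigma> k) (basis_e l)) = tauN t k (basis_e ?i)"
    using i by (simp add: tauN_basis)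
  then show ?thesis
    by (simp add: mut_var_def kk)
qed

lemma variation_mut_var: "variation_N J d \<sigma> (mut k t) (mut (\<sigma> k) t') (mut_var \<sigma> t t' k V)"
  unfolding variation_N_def
proof (intro conjI allI ballI)
  show "additive (mut_var \<sigma> t t' k V)"
    by standard (rule mut_var_add)
  fix l assume l: "l \<in> J"
  show "mut_var \<sigma> t t' k V (basis_e l) = basis_e (inv \<sigma> l)"
    by (rule mut_var_basis[OF l])
  fix i
  \<comment> \<open>The base change only adds a multiple of the unfrozen vector with index
    \<open>\<sigma> k\<close>, so the result stays in the unfrozen span where
    \<open>omega_variation\<close> applies.\<close>
  have "Poly_Mapping.lookup (tauN t' (\<sigma> k) (basis_e l)) j = 0" if "j \<notin> J" for j
    using that l sigma_k by (auto simp: tauN_def)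
  from omega_variation[OF V this]
  show "omega d (mut k t) (mut_var \<sigma> t t' k V (basis_e i)) (mut_var \<sigma> t t' k V (basis_e l)) =
      omega d (mut (\<sigma> k) t') (basis_e i) (basis_e l)"
    by (simp add: omega_tau[OF d_pos] t t' tauN_mut_var)
qed

text \<open>The linear parts match by construction of \<open>mut_var\<close>. The binomial exponents
  match because \<open>degX\<close> is given by \<open>omega\<close> and \<open>d\<close>, and
  because the base changes leave it invariant.\<close>

lemma varX_mut:
  assumes f: "f \<in> char_dom UNIV (\<lambda>n. mon (mut_var \<sigma> t t' k V n))"
  shows "mut_X t' (\<sigma> k) f \<in> char_dom UNIV (\<lambda>n. mon (V n))"
    and "varX V (mut_X t' (\<sigma> k) f) = mut_X t k (varX (mut_var \<sigma> t t' k V) f)"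
proof -
  have deg: "degX t k (mut_var \<sigma> t t' k V n) = degX t' (\<sigma> k) n" for n
  proof -
    have "d (\<sigma> k) = d k"
      using sim k by (simp add: similar_def)
    moreover have "omega d t (V n') (V (basis_e (\<sigma> k))) = omega d t' n' (basis_e (\<sigma> k))" for n'
      by (rule omega_variation[OF V]) (use sigma_k in auto)
    then have "omega d t (V n') (basis_e k) = omega d t' n' (basis_e (\<sigma> k))" for n'
      by (simp add: V_basis sigma_k)
    ultimately have "(of_int (degX t k (V n')) :: rat) = of_int (degX t' (\<sigma> k) n')" for n'
      by (simp add: degX_eq_omega)
    then have "degX t k (V n') = degX t' (\<sigma> k) n'" for n'
      by (simp only: of_int_eq_iff)
    then have "degX t k (V (tauN t' (\<sigma> k) n)) = degX t' (\<sigma> k) n"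
      by (simp add: degX_tauN kk)
    then show ?thesis
      by (simp add: mut_var_def degX_tauN kk)
  qed
  have "V (basis_e (\<sigma> k)) = basis_e k"
    by (simp add: V_basis sigma_k)
  note * = char_ext_square[OF exp_data_X exp_data_X additive.add[OF V_additive] mut_var_add UNIV_I UNIV_I
      tauN_mut_var[symmetric] this deg charX_nonzero[of t, OF kk(1)] f]
  show "mut_X t' (\<sigma> k) f \<in> char_dom UNIV (\<lambda>n. mon (V n))"
    and "varX V (mut_X t' (\<sigma> k) f) = mut_X t k (varX (mut_var \<sigma> t t' k V) f)"
    unfolding mut_X_eq[of t, OF kk(1)] mut_X_eq[of t', OF kk(2)] varX_eq
    by (rule *; assumption)+
qed

lemma varA_mut:
  assumes f: "f \<in> char_dom (int_exp J) (\<lambda>m. mon (pullback d (mut_var \<sigma> t t' k V) m))"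
  shows "mut_A J t k f \<in> char_dom (int_exp J) (\<lambda>m. mon (pullback d V m))"
    and "varA J (pullback d V) (mut_A J t k f) =
      mut_A J t' (\<sigma> k) (varA J (pullback d (mut_var \<sigma> t t' k V)) f)"
proof -
  let ?W = "pullback d V" and ?W' = "pullback d (mut_var \<sigma> t t' k V)"
  have add': "additive (mut_var \<sigma> t t' k V)"
    by standard (rule mut_var_add)
  \<comment> \<open>Checked by pairing with an arbitrary vector, where it becomes the relation on
    \<open>N\<close> that defines \<open>mut_var\<close>.\<close>
  have comm: "?W (tauM t k m) = tauM t' (\<sigma> k) (?W' m)" for m
    by (rule pairing_eqI)
      (simp add: pairing_pull[OF V_additive] pairing_pull[OF add'] pairing_tauM t t' mut_var_def kk)
  have p: "?W (pstar t (basis_e k)) = pstar t' (basis_e (\<sigma> k))"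
    using V k variation_N_iff_M[OF t t' sim V_additive] by (simp add: variation_M_def)
  have deg: "degA (\<sigma> k) (?W' m) = degA k m" for m
    using pullback_unfrozen[OF similar_mut[OF sim k] variation_mut_var sigma_k(1)] sigma_k
    by (simp add: degA_def)
  note in1 = pullback_int_exp[OF sim V]
  note in2 = pullback_int_exp[OF similar_mut[OF sim k] variation_mut_var]
  note * = char_ext_square[OF exp_data_A[OF k] exp_data_A[OF sigma_k(1)]
      additive.add[OF additive_pullback] additive.add[OF additive_pullback] in1 in2
      comm p deg charA_nonzero[of t', OF kk(2) sigma_k(1)] f]
  show "mut_A J t k f \<in> char_dom (int_exp J) (\<lambda>m. mon (?W m))"
    and "varA J ?W (mut_A J t k f) = mut_A J t' (\<sigma> k) (varA J ?W' f)"
    unfolding mut_A_eq[of t, OF kk(1) k] mut_A_eq[of t', OF kk(2) sigma_k(1)] varA_eq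
    by (rule *; assumption)+
qed

end

text \<open>The witness is the map conjugated along the whole sequence, running between the end
  seeds. A single induction treats both sides, so that the same lattice map serves \<open>X\<close>
  and, through its pullback, \<open>A\<close>.\<close>

lemma variation_iter:
  assumes "is_seed d t" "is_seed d t'" "similar J d \<sigma> t t'" "variation_N J d \<sigma> t t' V" "ks \<in> lists J"
  shows "\<exists>V'. additive V' \<and> (\<forall>m\<in>int_exp J. pullback d V' m \<in> int_exp J) \<and>
    (\<forall>f\<in>char_dom UNIV (\<lambda>n. mon (V' n)).
      iter_mut mut_X (map \<sigma> ks) t' f \<in> char_dom UNIV (\<lambda>n. mon (V n)) \<and>
      varX V (iter_mut mut_X (map \<sigma> ks) t' f) = iter_mut mut_X ks t (varX V' f)) \<and>
    (\<forall>f\<in>char_dom (int_exp J) (\<lambda>m. mon (pullback d V' m)).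
      iter_mut (mut_A J) ks t f \<in> char_dom (int_exp J) (\<lambda>m. mon (pullback d V m)) \<and>
      varA J (pullback d V) (iter_mut (mut_A J) ks t f) =
        iter_mut (mut_A J) (map \<sigma> ks) t' (varA J (pullback d V') f))"
  using assms
proof (induction ks arbitrary: t t' V)
  case Nil
  then have "additive V" "\<forall>m\<in>int_exp J. pullback d V m \<in> int_exp J"
    using pullback_int_exp by (auto simp: variation_N_def)
  then show ?case
    by (intro exI[of _ V]) simp
next
  case (Cons k ks)
  then have k: "k \<in> J" "ks \<in> lists J"
    by auto
  note prems = Cons.prems(1-4) k(1)
  from Cons.IH[OF is_seed_mut[OF d_pos prems(1)] is_seed_mut[OF d_pos prems(2)]
      similar_mut[OF prems(3,5)] variation_mut_var[OF prems] k(2)]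
  obtain V' where V': "additive V'" "\<forall>m\<in>int_exp J. pullback d V' m \<in> int_exp J"
    and X: "\<forall>f\<in>char_dom UNIV (\<lambda>n. mon (V' n)).
      iter_mut mut_X (map \<sigma> ks) (mut (\<sigma> k) t') f \<in> char_dom UNIV (\<lambda>n. mon (mut_var \<sigma> t t' k V n)) \<and>
      varX (mut_var \<sigma> t t' k V) (iter_mut mut_X (map \<sigma> ks) (mut (\<sigma> k) t') f) =
        iter_mut mut_X ks (mut k t) (varX V' f)"
    and A: "\<forall>f\<in>char_dom (int_exp J) (\<lambda>m. mon (pullback d V' m)).
      iter_mut (mut_A J) ks (mut k t) f \<in> char_dom (int_exp J) (\<lambda>m. mon (pullback d (mut_var \<sigma> t t' k V) m)) \<and>
      varA J (pullback d (mut_var \<sigma> t t' k V)) (iter_mut (mut_A J) ks (mut k t) f) =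
        iter_mut (mut_A J) (map \<sigma> ks) (mut (\<sigma> k) t') (varA J (pullback d V') f)"
    by blast
  show ?case
    using V' X A varX_mut[OF prems] varA_mut[OF prems] by (intro exI[of _ V'] conjI) auto
qed

text \<open>To test the image at the end of \<open>ks\<close> starting from \<open>t\<close>, the
  element is expanded at the end of the relabelled sequence \<open>map \<sigma> ks\<close> starting
  from \<open>t'\<close>.\<close>

lemma varX_upper:
  assumes "is_seed d t" "is_seed d t'" "similar J d \<sigma> t t'" "variation_N J d \<sigma> t t' V"
    and x: "x \<in> X.upper LP_X t'"
  shows "varX V x \<in> X.upper LP_X t"
  unfolding X.upper_def
proof
  fix ks assume ks: "ks \<in> lists J"
  obtain V' where V': "additive V'"
    and X: "\<forall>f\<in>char_dom UNIV (\<lambda>n. mon (V' n)).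
      varX V (iter_mut mut_X (map \<sigma> ks) t' f) = iter_mut mut_X ks t (varX V' f)"
    using variation_iter[OF assms(1-4) ks] by blast
  have "map \<sigma> ks \<in> lists J"
    using ks assms(3) by (auto simp: similar_def permutes_in_image)
  with x have "x \<in> iter_mut mut_X (map \<sigma> ks) t' ` LP_X"
    unfolding X.upper_def by (rule INT_D)
  then obtain p where p: "x = iter_mut mut_X (map \<sigma> ks) t' (to_field p)"
    by (auto simp: LP_X_def)
  have "to_field p \<in> char_dom UNIV (\<lambda>n. mon (V' n))"
    by (rule lattice_char.to_field_in_dom[OF lattice_char_mon_map[OF subgrp_UNIV V']]) simp
  then have "varX V x = iter_mut mut_X ks t (to_field (monomial_map V' p))"
    using X p V' by (simp add: varX_to_field)
  then show "varX V x \<in> iter_mut mut_X ks t ` LP_X"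
    by (auto simp: LP_X_def)
qed

lemma varA_upper:
  assumes "is_seed d t" "is_seed d t'" "similar J d \<sigma> t t'" "variation_N J d \<sigma> t t' V"
    and x: "x \<in> A.upper LP_ZQ t"
  shows "varA J (pullback d V) x \<in> A.upper LP_ZQ t'"
  unfolding A.upper_def
proof
  fix ks' assume ks': "ks' \<in> lists J"
  have \<sigma>: "\<sigma> permutes J"
    using assms(3) by (simp add: similar_def)
  \<comment> \<open>On this side the image has to be tested along sequences from \<open>t'\<close>,
    so these are relabelled backwards.\<close>
  define ks where "ks = map (inv \<sigma>) ks'"
  have ks: "ks \<in> lists J" "map \<sigma> ks = ks'"
    using ks' permutes_in_image[OF permutes_inv[OF \<sigma>]]
    by (auto simp: ks_def permutes_inverses[OF \<sigma>] comp_def)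
  obtain V' where V': "\<forall>m\<in>int_exp J. pullback d V' m \<in> int_exp J"
    and A: "\<forall>f\<in>char_dom (int_exp J) (\<lambda>m. mon (pullback d V' m)).
      varA J (pullback d V) (iter_mut (mut_A J) ks t f) =
        iter_mut (mut_A J) (map \<sigma> ks) t' (varA J (pullback d V') f)"
    using variation_iter[OF assms(1-4) ks(1)] by blast
  from x ks(1) have "x \<in> iter_mut (mut_A J) ks t ` LP_ZQ"
    unfolding A.upper_def by (rule INT_D)
  then obtain p where p: "p \<in> group_ring_on (int_exp J)" "x = iter_mut (mut_A J) ks t (to_field p)"
    by auto
  have "to_field p \<in> char_dom (int_exp J) (\<lambda>m. mon (pullback d V' m))"
    by (rule lattice_char.to_field_in_dom[OF lattice_char_mon_map[OF subgrp_int_exp additive_pullback] p(1)])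
  then have "varA J (pullback d V) x = iter_mut (mut_A J) ks' t' (to_field (monomial_map (pullback d V') p))"
    using A p ks by (simp add: varA_to_field[OF additive_pullback])
  moreover have "monomial_map (pullback d V') p \<in> group_ring_on (int_exp J)"
    using p(1) V' by (intro monomial_map_in) auto
  ultimately show "varA J (pullback d V) x \<in> iter_mut (mut_A J) ks' t' ` LP_ZQ"
    by blast
qed

end

section \<open>From monomial maps back to lattice maps; the Poisson condition\<close>

section \<open>Monomial maps\<close>

lemma monomial_map_superset:
  assumes "finite A" "Poly_Mapping.keys p \<subseteq> A"
  shows "monomial_map L p = (\<Sum>n\<in>A. Poly_Mapping.single (L n) (Poly_Mapping.lookup p n))"
  unfolding monomial_map_def
  by (rule sum.mono_neutral_left) (use assms in \<open>auto simp: not_in_keys_iff_lookup_eq_zero\<close>)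

lemma monomial_map_single [simp]:
  "monomial_map L (Poly_Mapping.single n c) = Poly_Mapping.single (L n) c"
  by (simp add: monomial_map_def)

lemma monomial_map_monomial [simp]: "monomial_map L (monomial n) = monomial (L n)"
  by (simp add: monomial_def)

lemma monomial_map_zero [simp]: "monomial_map L 0 = 0"
  by (simp add: monomial_map_def)

lemma monomial_map_add: "monomial_map L (p + q) = monomial_map L p + monomial_map L q"
proof -
  let ?A = "Poly_Mapping.keys p \<union> Poly_Mapping.keys q"
  have "monomial_map L r = (\<Sum>n\<in>?A. Poly_Mapping.single (L n) (Poly_Mapping.lookup r n))"
    if "r \<in> {p, q, p + q}" for r
    using that Poly_Mapping.keys_add[of p q] by (intro monomial_map_superset) auto
  then show ?thesis
    by (simp add: lookup_add single_add sum.distrib)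
qed

lemma monomial_map_sum: "monomial_map L (sum g A) = (\<Sum>x\<in>A. monomial_map L (g x))"
  by (induction A rule: infinite_finite_induct) (auto simp: monomial_map_add)

lemma monomial_map_comp: "monomial_map L (monomial_map L' p) = monomial_map (\<lambda>n. L (L' n)) p"
  unfolding monomial_map_def[of L' p] by (simp add: monomial_map_sum) (simp add: monomial_map_def)

lemma lookup_monomial_map:
  assumes "inj L"
  shows "Poly_Mapping.lookup (monomial_map L p) (L n) = Poly_Mapping.lookup p n"
  using assms
  by (simp add: monomial_map_def lookup_sum lookup_single when_def inj_eq not_in_keys_iff_lookup_eq_zero)

lemma keys_monomial_map_subset: "Poly_Mapping.keys (monomial_map L p) \<subseteq> L ` Poly_Mapping.keys p"
  for p :: "('a, int) laurent"
  unfolding monomial_map_def by (rule order_trans[OF keys_sum]) auto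

lemma monomial_eq_iff: "monomial m = (monomial n :: ('a, int) laurent) \<longleftrightarrow> m = n"
  by (simp add: monomial_def) (metis lookup_single_eq lookup_single_not_eq zero_neq_one)

text \<open>The bracket of two monomials is a multiple of one monomial, which gives necessity.
  Conversely, injectivity of \<open>U\<close> keeps the terms of an image separate, so the double
  sum can be reindexed without merging coefficients.\<close>

lemma preserves_poisson_iff:
  assumes U: "additive U" and inj: "inj U"
  shows "preserves_poisson d s s' U \<longleftrightarrow> (\<forall>m n. omega d s m n = omega d s' (U m) (U n))"
proof
  assume pres: "preserves_poisson d s s' U"
  show "\<forall>m n. omega d s m n = omega d s' (U m) (U n)"
  proof (intro allI)
    fix m n
    have "monomial_map U (poisson d s (Poly_Mapping.single m 1) (Poly_Mapping.single n 1)) =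
        poisson d s' (Poly_Mapping.single (U m) 1) (Poly_Mapping.single (U n) 1)"
      using pres by (simp add: preserves_poisson_def del: single_one)
    then have "Poly_Mapping.single (U m + U n) (- omega d s m n) =
        Poly_Mapping.single (U m + U n) (- omega d s' (U m) (U n))"
      by (simp add: poisson_def additive.add[OF U] del: single_uminus)
    then have "- omega d s m n = - omega d s' (U m) (U n)"
      by (metis lookup_single_eq)
    then show "omega d s m n = omega d s' (U m) (U n)"
      by simp
  qed
next
  assume om: "\<forall>m n. omega d s m n = omega d s' (U m) (U n)"
  have keys: "Poly_Mapping.keys (monomial_map U p) = U ` Poly_Mapping.keys p" for p :: "('a latN, rat) laurent"
  proof
    have "x \<in> U ` Poly_Mapping.keys p" if "x \<in> Poly_Mapping.keys (monomial_map U p)" for x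
    proof (rule ccontr)
      assume "x \<notin> U ` Poly_Mapping.keys p"
      then have "Poly_Mapping.lookup (monomial_map U p) x = 0"
        unfolding monomial_map_def lookup_sum
        by (intro sum.neutral) (auto simp: lookup_single when_def)
      with that show False
        by auto
    qed
    then show "Poly_Mapping.keys (monomial_map U p) \<subseteq> U ` Poly_Mapping.keys p"
      by blast
    show "U ` Poly_Mapping.keys p \<subseteq> Poly_Mapping.keys (monomial_map U p)"
      by (auto simp: in_keys_iff lookup_monomial_map[OF inj])
  qed
  have inj': "inj_on U A" for A
    using inj by (rule inj_on_subset) simp
  show "preserves_poisson d s s' U"
    unfolding preserves_poisson_def
  proof (intro allI)
    fix f g :: "('a latN, rat) laurent"
    have "poisson d s' (monomial_map U f) (monomial_map U g) =
      (\<Sum>m\<in>Poly_Mapping.keys f. \<Sum>n\<in>Poly_Mapping.keys g. Poly_Mapping.single (U m + U n)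
         (Poly_Mapping.lookup f m * Poly_Mapping.lookup g n * (- omega d s' (U m) (U n))))"
      unfolding poisson_def keys sum.reindex[OF inj'] by (simp add: lookup_monomial_map[OF inj])
    then show "monomial_map U (poisson d s f g) = poisson d s' (monomial_map U f) (monomial_map U g)"
      using om by (simp add: poisson_def monomial_map_sum additive.add[OF U])
  qed
qed

lemma varX_varX:
  assumes "additive V" "additive V'" "\<And>n. V (V' n) = n"
  shows "varX V (varX V' f) = f"
proof -
  note L = lattice_char_mon_map[OF subgrp_UNIV]
  have "\<forall>n\<in>UNIV. mon (V' n) \<in> char_dom UNIV (\<lambda>n. mon (V n)) \<and>
      char_ext UNIV (\<lambda>n. mon (V n)) (mon (V' n)) = mon n"
    using lattice_char.to_field_in_dom[OF L[OF assms(1)]]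
      lattice_char.ext_to_field[OF L[OF assms(1)]]
    by (auto simp: mon_def[of "V' _"] monomial_def assms(3))
  from char_ext_comp(6)[OF L[OF assms(2)] L[OF assms(1)] this, of f]
  show ?thesis
    using char_ext_mon[OF subgrp_UNIV, of f] by (simp add: varX_eq)
qed

text \<open>Monomials detect injectivity. For surjectivity, a preimage of a monomial may be any
  Laurent polynomial, but the support of its image lies in the range of \<open>V\<close>.\<close>

lemma bij_of_bij_varX:
  assumes V: "additive V" and bij: "bij_betw (varX V) LP_X LP_X"
  shows "bij V"
proof (rule bijI)
  have mon_LP: "to_field (monomial n) \<in> LP_X" for n :: "'a latN"
    by (simp add: LP_X_def)
  show "inj V"
  proof (rule injI)
    fix m n assume "V m = V n"
    then have "varX V (to_field (monomial m)) = varX V (to_field (monomial n))"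
      by (simp add: varX_to_field[OF V])
    then have "to_field (monomial m) = (to_field (monomial n) :: 'a fieldX)"
      by (rule inj_onD[OF bij_betw_imp_inj_on[OF bij]]) (rule mon_LP)+
    then show "m = n"
      by (simp add: monomial_eq_iff)
  qed
  show "surj V"
    unfolding surj_def
  proof
    fix m :: "'a latN"
    have "to_field (monomial m) \<in> varX V ` LP_X"
      using bij mon_LP by (simp add: bij_betw_def)
    then obtain p :: "('a latN, int) laurent" where p: "monomial_map V p = monomial m"
      by (auto simp: LP_X_def varX_to_field[OF V])
    have "m \<in> Poly_Mapping.keys (monomial_map V p)"
      by (simp add: p monomial_def)
    then have "m \<in> V ` Poly_Mapping.keys p"
      by (rule rev_subsetD[OF _ keys_monomial_map_subset])
    then show "\<exists>n. m = V n"
      by auto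
  qed
qed

section \<open>Twist endomorphisms, their inverses, and the intertwining property\<close>

section \<open>Twists\<close>

lemma partial_hom_inv:
  assumes "partial_hom UNIV f" "bij f"
  shows "partial_hom UNIV (inv f)"
proof -
  interpret partial_hom UNIV f by fact
  have "f (inv f x) = x" "inv f (f y) = y" for x y
    using assms(2) by (simp_all add: bij_is_surj surj_f_inv_f bij_is_inj inv_f_f)
  then show ?thesis
    by unfold_locales (auto intro: injD[OF bij_is_inj[OF assms(2)]] simp: f_one f_add f_mult)
qed

lemma ring_endo_on_comp:
  assumes f: "partial_hom D f" and g: "partial_hom E g" and "U \<subseteq> D" "f ` U \<subseteq> E" "(g \<circ> f) ` U \<subseteq> U"
  shows "ring_endo_on U (g \<circ> f)"
proof -
  interpret f: partial_hom D f by fact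
  interpret g: partial_hom E g by fact
  have "x \<in> D" "f x \<in> E" if "x \<in> U" for x
    using that assms by auto
  then show ?thesis
    using assms(5)
    by (simp add: ring_endo_on_def f.f_one g.f_one f.f_add g.f_add f.f_mult g.f_mult)
qed

lemma similar_sym:
  assumes "similar J d \<sigma> t t'"
  shows "similar J d (inv \<sigma>) t' t"
proof -
  have \<sigma>: "\<sigma> permutes J"
    using assms by (simp add: similar_def)
  have "inv \<sigma> i \<in> J" "\<sigma> (inv \<sigma> i) = i" if "i \<in> J" for i
    using that \<sigma> by (auto simp: permutes_inverses permutes_in_image[OF permutes_inv[OF \<sigma>]])
  then show ?thesis
    using assms permutes_inv[OF \<sigma>] unfolding similar_def by metis
qed

context cluster
begin

lemma bij_iter_X: "is_seed d t \<Longrightarrow> ks \<in> lists J \<Longrightarrow> bij (iter_mut mut_X ks t)"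
  using X.iter_inj X.iter_image by (auto simp: bij_def)

text \<open>The identification \<open>g\<close> is kept general: it is the inverse of the composite
  mutation for the given twist and the mutation itself for the inverse twist.\<close>

lemma varX_ring_endo:
  assumes s: "is_seed d s" "is_seed d s'" "similar J d \<sigma> s s'" "variation_N J d \<sigma> s s' V"
    and g: "partial_hom UNIV g" "g ` upper_X J s \<subseteq> upper_X J s'"
  shows "ring_endo_on (upper_X J s') (g \<circ> varX V)"
proof -
  have V: "additive V"
    using s(4) by (simp add: variation_N_def)
  note L = lattice_char_mon_map[OF subgrp_UNIV V]
  show ?thesis
  proof (rule ring_endo_on_comp[OF _ g(1)])
    show "partial_hom (char_dom UNIV (\<lambda>n. mon (V n))) (varX V)"
      unfolding varX_eq by (rule lattice_char.partial_hom[OF L])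
    show "upper_X J s' \<subseteq> char_dom UNIV (\<lambda>n. mon (V n))"
      using X.upper_subset lattice_char.to_field_in_dom[OF L] by (fastforce simp: upper_X_eq LP_X_def)
    show "(g \<circ> varX V) ` upper_X J s' \<subseteq> upper_X J s'"
      using varX_upper[OF s] g(2) by (auto simp: upper_X_eq)
  qed simp
qed

lemma twist_X_endo:
  assumes t: "is_seed d t" and ks: "ks \<in> lists J" and t': "t' = mut_seq ks t"
    and sim: "similar J d \<sigma> t t'" and V: "variation_N J d \<sigma> t t' V"
  shows "ring_endo_on (upper_X J t') (inv (mut_seq_X ks t) \<circ> varX V)"
  unfolding mut_seq_X_eq_iter
proof (rule varX_ring_endo[OF t _ sim V])
  let ?M = "iter_mut mut_X ks t"
  have bij: "bij ?M"
    using t ks by (rule bij_iter_X)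
  show "is_seed d t'"
    using X.mut_seq_in t ks t' by auto
  show "partial_hom UNIV (inv ?M)"
    using X.iter_hom t ks by (intro partial_hom_inv bij) auto
  have "?M ` upper_X J t' = upper_X J t"
    using X.iter_upper[of t ks LP_X] t ks by (simp add: upper_X_eq t')
  then show "inv ?M ` upper_X J t \<subseteq> upper_X J t'"
    using image_inv_f_f[OF bij_is_inj[OF bij], of "upper_X J t'"] by simp
qed

lemma twist_A_endo:
  assumes t: "is_seed d t" and ks: "ks \<in> lists J" and t': "t' = mut_seq ks t"
    and sim: "similar J d \<sigma> t t'" and V: "variation_N J d \<sigma> t t' V"
  shows "ring_endo_on (extend_ZQ J (upper_A J t)) (mut_seq_A J ks t \<circ> varA J (pullback d V))"
  unfolding mut_seq_A_eq_iter extend_upper_A[OF t]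
proof (rule ring_endo_on_comp)
  let ?M = "iter_mut (mut_A J) ks t" and ?W = "pullback d V"
  note L = lattice_char_mon_map[OF subgrp_int_exp additive_pullback]
  have seed': "is_seed d t'"
    using X.mut_seq_in t ks t' by auto
  show "partial_hom (char_dom (int_exp J) (\<lambda>m. mon (?W m))) (varA J ?W)"
    unfolding varA_eq by (rule lattice_char.partial_hom[OF L])
  show "partial_hom K ?M"
    using A.iter_hom t ks by auto
  show "A.upper LP_ZQ t \<subseteq> char_dom (int_exp J) (\<lambda>m. mon (?W m))"
    using A.upper_subset lattice_char.to_field_in_dom[OF L] by blast
  have up: "varA J ?W x \<in> A.upper LP_ZQ t'" if "x \<in> A.upper LP_ZQ t" for x
    using that by (rule varA_upper[OF t seed' sim V])
  then show "varA J ?W ` A.upper LP_ZQ t \<subseteq> K"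
    using A.upper_subset LP_ZQ_subset by blast
  have "?M ` A.upper LP_ZQ t' = A.upper LP_ZQ t"
    using A.iter_upper[of t ks LP_ZQ] t ks LP_ZQ_subset by (simp add: t')
  then show "(?M \<circ> varA J ?W) ` A.upper LP_ZQ t \<subseteq> A.upper LP_ZQ t"
    using up by auto
qed

lemma variation_N_inv:
  assumes \<sigma>: "\<sigma> permutes J" and V: "variation_N J d \<sigma> t t' V" and bij: "bij V"
  shows "variation_N J d (inv \<sigma>) t' t (inv V)"
proof -
  have add: "additive V"
    using V by (simp add: variation_N_def)
  have V_inv: "V (inv V n) = n" "inv V (V n) = n" for n
    using bij by (simp_all add: bij_is_surj surj_f_inv_f bij_is_inj inv_f_f)
  have basis: "inv V (basis_e k) = basis_e (\<sigma> k)" if "k \<in> J" for k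
  proof -
    have "V (basis_e (\<sigma> k)) = basis_e k"
      using V that \<sigma> by (simp add: variation_N_def permutes_in_image permutes_inverses)
    then show ?thesis
      by (metis V_inv(2))
  qed
  show ?thesis
    unfolding variation_N_def
  proof (intro conjI ballI allI)
    show "additive (inv V)"
      by standard (metis V_inv additive.add[OF add])
    fix k assume k: "k \<in> J"
    show "inv V (basis_e k) = basis_e (inv (inv \<sigma>) k)"
      using basis[OF k] \<sigma> by (simp add: permutes_inv_inv)
    fix i
    \<comment> \<open>The preimage of \<open>basis_e i\<close> can be any lattice vector when
      \<open>i\<close> is frozen, hence the appeal to the bilinear version.\<close>
    have "omega d t (V (inv V (basis_e i))) (V (basis_e (\<sigma> k))) = omega d t' (inv V (basis_e i)) (basis_e (\<sigma> k))"
      using k \<sigma> by (intro omega_variation[OF V]) (auto simp: permutes_in_image)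
    moreover have "V (basis_e (\<sigma> k)) = basis_e k"
      using basis[OF k] V_inv(1) by metis
    ultimately show "omega d t' (inv V (basis_e i)) (inv V (basis_e k)) = omega d t (basis_e i) (basis_e k)"
      by (simp add: V_inv basis[OF k])
  qed
qed

text \<open>On Laurent polynomials \<open>pstar_alg\<close> can be moved past the composite mutation
  to \<open>t'\<close>. The mutation on the \<open>A\<close> side is injective on \<open>K\<close>
  and cancels, leaving two monomial maps, which agree as soon as they agree on monomials.\<close>

lemma pstar_intertwines_iff:
  assumes t: "is_seed d t" and ks: "ks \<in> lists J" and t': "t' = mut_seq ks t"
    and sim: "similar J d \<sigma> t t'" and V: "variation_N J d \<sigma> t t' V" and U: "additive U"
  shows "(\<forall>f\<in>LP_X. pstar_alg t (mut_seq_X ks t (varX U f)) =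
        mut_seq_A J ks t (varA J (pullback d V) (pstar_alg t f))) \<longleftrightarrow>
    (\<forall>n. pstar t' (U n) = pullback d V (pstar t n))"
proof -
  let ?W = "pullback d V" and ?M = "iter_mut (mut_A J) ks t"
  have inj: "inj_on ?M K"
    using A.iter_inj t ks by simp
  have "pstar_alg t (mut_seq_X ks t (varX U (to_field p))) =
      mut_seq_A J ks t (varA J ?W (pstar_alg t (to_field p))) \<longleftrightarrow>
      monomial_map (\<lambda>n. pstar t' (U n)) p = monomial_map (\<lambda>n. ?W (pstar t n)) p"
    (is "?l = ?r \<longleftrightarrow> _") for p
  proof -
    have q: "monomial_map (pstar B) q \<in> group_ring_on (int_exp J)" for B :: "'i seed" and q
      by (rule monomial_map_in[where H = UNIV]) (auto simp: pstar_in_int_exp simp del: lookup_pstar)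
    have W: "monomial_map ?W q \<in> group_ring_on (int_exp J)" if "q \<in> group_ring_on (int_exp J)" for q
      using that by (rule monomial_map_in) (rule pullback_int_exp[OF sim V])
    have "to_field (monomial_map U p) \<in> char_dom UNIV (\<lambda>n. mon (pstar t' n))"
      by (rule lattice_char.to_field_in_dom[OF lattice_char_mon_map[OF subgrp_UNIV additive_pstar]]) simp
    then have l: "?l = ?M (to_field (monomial_map (pstar t') (monomial_map U p)))"
      using pstar_iter[OF t ks] by (simp add: mut_seq_X_eq_iter varX_to_field[OF U] t' pstar_alg_to_field)
    have r: "?r = ?M (to_field (monomial_map ?W (monomial_map (pstar t) p)))"
      by (simp add: mut_seq_A_eq_iter pstar_alg_to_field varA_to_field[OF additive_pullback q])
    have "to_field (monomial_map (pstar t') (monomial_map U p)) \<in> K"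
      "to_field (monomial_map ?W (monomial_map (pstar t) p)) \<in> K"
      using LP_ZQ_subset q W by blast+
    then show ?thesis
      unfolding l r by (simp add: inj_on_eq_iff[OF inj] monomial_map_comp)
  qed
  then have "(\<forall>f\<in>LP_X. pstar_alg t (mut_seq_X ks t (varX U f)) =
        mut_seq_A J ks t (varA J ?W (pstar_alg t f))) \<longleftrightarrow>
      (\<forall>p :: ('i latN, int) laurent.
        monomial_map (\<lambda>n. pstar t' (U n)) p = monomial_map (\<lambda>n. ?W (pstar t n)) p)"
    by (auto simp: LP_X_def)
  also have "\<dots> \<longleftrightarrow> (\<forall>n. pstar t' (U n) = ?W (pstar t n))"
  proof
    assume *: "\<forall>p :: ('i latN, int) laurent.
        monomial_map (\<lambda>n. pstar t' (U n)) p = monomial_map (\<lambda>n. ?W (pstar t n)) p"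
    show "\<forall>n. pstar t' (U n) = ?W (pstar t n)"
    proof
      fix n
      show "pstar t' (U n) = ?W (pstar t n)"
        using *[rule_format, of "monomial n"] by (simp only: monomial_map_monomial monomial_eq_iff)
    qed
  qed simp
  finally show ?thesis .
qed

end

theorem theorem4p19:
  fixes Iuf :: "'i::{finite,linorder} set"
    and d :: "'i \<Rightarrow> int"
    and t t' :: "'i seed"
    and ks :: "'i list"
    and \<sigma> :: "'i \<Rightarrow> 'i"
    and varN :: "'i latN \<Rightarrow> 'i latN"
    and varM :: "'i latM \<Rightarrow> 'i latM"
    and twX twXinv :: "'i fieldX \<Rightarrow> 'i fieldX"
    and twA :: "'i fieldA \<Rightarrow> 'i fieldA"
  assumes d_pos: "\<forall>i. d i > 0"
    and seed: "is_seed d t"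
    and dirs: "ks \<in> lists Iuf"
    and t': "t' = mut_seq ks t"
    and sim: "similar Iuf d \<sigma> t t'"
    and lin: "additive varN"
    and varM: "varM = pullback d varN"
    and twX: "twX = inv (mut_seq_X ks t) \<circ> varX varN"
    and twA: "twA = mut_seq_A Iuf ks t \<circ> varA Iuf varM"
    and twXinv: "twXinv = mut_seq_X ks t \<circ> inv twX \<circ> inv (mut_seq_X ks t)"
  shows "(twist_endo_X Iuf d \<sigma> t t' (inv (mut_seq_X ks t)) varN twX
            \<longleftrightarrow> twist_endo_A Iuf \<sigma> t t' (mut_seq_A Iuf ks t) varM twA)
       \<and> (twist_auto_X Iuf d \<sigma> t t' (inv (mut_seq_X ks t)) varN twX \<longrightarrow>
            twist_auto_X Iuf d (inv \<sigma>) t' t (mut_seq_X ks t) (inv varN) twXinv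
            \<and> (preserves_poisson d t t' (inv varN)
                 \<longleftrightarrow> (\<forall>f\<in>LP_X. pstar_alg t (twXinv f) = twA (pstar_alg t f))))"
proof (intro conjI impI)
  interpret cluster Iuf d
    by unfold_locales (rule d_pos)
  let ?M = "mut_seq_X ks t"
  have seed': "is_seed d t'"
    using X.mut_seq_in seed dirs t' by auto
  \<comment> \<open>Each variation condition already implies that the corresponding map is a ring
    endomorphism, so the equivalence reduces to duality of variation maps.\<close>
  show "twist_endo_X Iuf d \<sigma> t t' (inv ?M) varN twX
      \<longleftrightarrow> twist_endo_A Iuf \<sigma> t t' (mut_seq_A Iuf ks t) varM twA"
    using variation_N_iff_M[OF seed seed' sim lin] twist_X_endo[OF seed dirs t' sim, of varN]
      twist_A_endo[OF seed dirs t' sim, of varN]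
    unfolding twist_endo_X_def twist_endo_A_def varM twX twA by blast
  assume is_auto: "twist_auto_X Iuf d \<sigma> t t' (inv ?M) varN twX"
  then have V: "variation_N Iuf d \<sigma> t t' varN" and bij_LP: "bij_betw (varX varN) LP_X LP_X"
    by (auto simp: twist_auto_X_def twist_endo_X_def)
  have bij: "bij varN"
    by (rule bij_of_bij_varX[OF lin bij_LP])
  then have V_inv: "varN (inv varN n) = n" "inv varN (varN n) = n" for n
    by (simp_all add: bij_is_surj surj_f_inv_f bij_is_inj inv_f_f)
  have \<sigma>: "\<sigma> permutes Iuf"
    using sim by (simp add: similar_def)
  have var_inv: "variation_N Iuf d (inv \<sigma>) t' t (inv varN)"
    by (rule variation_N_inv[OF \<sigma> V bij])
  then have lin': "additive (inv varN)"
    by (simp add: variation_N_def)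
  have X_inv: "varX varN (varX (inv varN) f) = f" "varX (inv varN) (varX varN f) = f" for f
    by (rule varX_varX[OF lin lin' V_inv(1)], rule varX_varX[OF lin' lin V_inv(2)])
  have bij_X: "bij (varX varN)"
    by (rule bij_betw_byWitness[where f' = "varX (inv varN)"]) (auto simp: X_inv)
  have inv_X: "inv (varX varN) = varX (inv varN)"
    by (rule inv_equality) (simp_all add: X_inv)
  have bij_M: "bij ?M"
    unfolding mut_seq_X_eq_iter by (rule bij_iter_X[OF seed dirs])
  \<comment> \<open>The inverse of the given twist is \<open>varX (inv varN) \<circ> ?M\<close>;
    transporting it to \<open>t\<close> by \<open>?M\<close> cancels one mutation.\<close>
  have tw: "twXinv = ?M \<circ> varX (inv varN)"
  proof -
    have "inv twX = varX (inv varN) \<circ> ?M"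
      unfolding twX using bij_M bij_X by (simp add: o_inv_distrib bij_imp_bij_inv inv_inv_eq inv_X)
    then show ?thesis
      unfolding twXinv using bij_M by (simp add: fun_eq_iff bij_is_surj surj_f_inv_f)
  qed
  show "twist_auto_X Iuf d (inv \<sigma>) t' t ?M (inv varN) twXinv"
    unfolding twist_auto_X_def twist_endo_X_def
  proof (intro conjI)
    show "ring_endo_on (upper_X Iuf t) twXinv"
      unfolding tw
    proof (rule varX_ring_endo[OF seed' seed similar_sym[OF sim] var_inv])
      show "partial_hom UNIV ?M"
        unfolding mut_seq_X_eq_iter using X.iter_hom seed dirs by auto
      show "?M ` upper_X Iuf t' \<subseteq> upper_X Iuf t"
        unfolding mut_seq_X_eq_iter upper_X_eq t'
        using X.iter_upper[of t ks LP_X] seed dirs by simp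
    qed
    show "bij_betw (varX (inv varN)) LP_X LP_X"
      by (rule bij_betw_byWitness[where f' = "varX varN"])
        (auto simp: X_inv LP_X_def varX_to_field[OF lin] varX_to_field[OF lin'])
  qed (use var_inv tw in auto)
  \<comment> \<open>Pairing both sides with an arbitrary \<open>m\<close> moves the pullback
    \<open>varM\<close> over to \<open>varN m\<close>.\<close>
  have "(\<forall>n. pstar t' (inv varN n) = varM (pstar t n)) \<longleftrightarrow>
      (\<forall>n m. omega d t' (inv varN n) m = omega d t n (varN m))"
    unfolding omega_eq_pairing varM pairing_pull[OF lin, symmetric]
    using pairing_eqI by metis
  \<comment> \<open>Since \<open>varN\<close> is bijective, \<open>m\<close> may be replaced by
    \<open>inv varN m\<close>, which turns adjointness into preservation of the form.\<close>
  also have "\<dots> \<longleftrightarrow> (\<forall>n m. omega d t n m = omega d t' (inv varN n) (inv varN m))"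
    by (metis V_inv)
  finally show "preserves_poisson d t t' (inv varN) \<longleftrightarrow>
      (\<forall>f\<in>LP_X. pstar_alg t (twXinv f) = twA (pstar_alg t f))"
    using pstar_intertwines_iff[OF seed dirs t' sim V lin']
      preserves_poisson_iff[OF lin' bij_is_inj[OF bij_imp_bij_inv[OF bij]], of d t t']
    by (simp add: tw twA varM)
qed

end
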